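(* Let $m$ be an odd positive integer, $n\ge1$, let $D\subset\mathbb{C}^n$ be open and symmetric with $\Omega_D$ star-like with respect to every variable, let $f\in\mathcal{SR}(\Omega_D)$, and let $G\subset H\in\mathcal{P}(n)$. Let $$f(x)=\sum_{K\subset H}\ \sum_{T\in\llbracket 0,\frac{m-3}{2}\rrbracket^{|G|}}(-1)^{|H\setminus K|}|x_G|^{2T}(\overline{x})_{H\setminus K}\odot\mathcal{E}^{H,G}_{K,T}(f)(x)$$ be the further decomposition, relative to $G$, of the Almansi-type decomposition $f=\sum_{K\subset H}(-1)^{|H\setminus K|}(\overline{x})_{H\setminus K}\odot\mathcal{S}^H_K(f)$ of $f$ with respect to $H$, with harmonic components $\mathcal{E}^{H,G}_{K,T}(f)$, i.e. $\Delta_{m+1,g}\mathcal{E}^{H,G}_{K,T}(f)=0$ for all $g\in G$. For any $T\in\llbracket 0,\frac{m-3}{2}\rrbracket^{|G|}$ define $$\mathcal{G}^{H,G}_T(f)=\sum_{K\subset H}(-1)^{|H\setminus K|}(\overline{x})_{H\setminus K}\odot\mathcal{E}^{H,G}_{K,T}(f)\in\mathcal{S}(\Omega_D).$$ Then we can write $$f(x)=\sum_{T\in\llbracket 0,\frac{m-3}{2}\rrbracket^{|G|}}|x_G|^{2T}\,\mathcal{G}^{H,G}_T(f)(x),$$ where the functions $\mathcal{G}^{H,G}_T(f)$ are biharmonic, namely $\Delta_{m+1,g}^2\mathcal{G}^{H,G}_T(f)=0$ for every $g\in G$.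
   Context: $\mathbb{R}_m$ is the real Clifford algebra generated by $e_1,\dots,e_m$ with $e_ie_j+e_je_i=-2\delta_{ij}$; $\mathbb{R}^{m+1}$ is identified with the paravectors $x_0+\sum_{i=1}^m x_ie_i$, with $\overline{x_0+\sum x_ie_i}=x_0-\sum x_ie_i$ and Euclidean norm $|x|$; $\mathbb{S}=\{x\in\mathbb{R}^{m+1}:x_0=0,\ \sum_{i=1}^m x_i^2=1\}$. Every $x\in\mathbb{R}^{m+1}$ is $\alpha+J\beta$ with $\alpha\in\mathbb{R}$, $\beta\ge0$, $J\in\mathbb{S}$. $\llbracket a,b\rrbracket$ is the set of integers $t$ with $a\le t\le b$. $\mathcal{P}(n)$ is the set of subsets of $\{1,\dots,n\}$; $\{\varepsilon_K\}_{K\in\mathcal{P}(n)}$ is a basis of $\mathbb{R}^{2^n}$. $D\subset\mathbb{C}^n$ is symmetric if it is invariant under conjugation of each single variable, $z\mapsto\bar z^h$. $\Omega_D=\{(\alpha_l+J_l\beta_l)_{l=1}^n:(\alpha_l+i\beta_l)_l\in D,\ J_1,\dots,J_n\in\mathbb{S}\}\subset(\mathbb{R}^{m+1})^n$. $\Omega_D$ is star-like with respect to every variable if for each $h$ and each $y\in\Omega_D$ the set $\{x\in\mathbb{R}^{m+1}:(y_1,\dots,y_{h-1},x,y_{h+1},\dots,y_n)\in\Omega_D\}$ is star-like with centre $0$. A stem function is $F=\sum_K\varepsilon_KF_K:D\to\mathbb{R}_m\otimes\mathbb{R}^{2^n}$ with $F_K(\bar z^h)=F_K(z)$ if $h\notin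 K$, $F_K(\bar z^h)=-F_K(z)$ if $h\in K$. For $K=\{k_1<\dots<k_p\}$, $[J_K,a]=J_{k_1}\cdots J_{k_p}a$. $F$ induces the slice function $\mathcal{I}(F)(x)=\sum_K[J_K,F_K(z)]$, $x=(\alpha_l+J_l\beta_l)_l$, $z=(\alpha_l+i\beta_l)_l$; $\mathcal{S}(\Omega_D)$ is the set of slice functions. $f=\mathcal{I}(F)$ is slice regular ($f\in\mathcal{SR}(\Omega_D)$) if $F$ is $C^1$ and $\partial_{\alpha_h}F_K=\partial_{\beta_h}F_{K\cup\{h\}}$, $\partial_{\beta_h}F_K=-\partial_{\alpha_h}F_{K\cup\{h\}}$ for all $h$ and all $K\not\ni h$. The slice product is $\mathcal{I}(F)\odot\mathcal{I}(G)=\mathcal{I}(F\otimes G)$, $F\otimes G=\sum_{H,K}(-1)^{|H\cap K|}\varepsilon_{H\Delta K}F_HG_K$. The spherical $H$-derivative of $f=\mathcal{I}(F)$ is $f'_{s,H}=\mathcal{I}(F'_H)$, defined at the points of $\Omega_D$ with $x_h\notin\mathbb{R}$ for all $h\in H$, where $F'_H=\sum_{K\cap H=\emptyset}\varepsilon_K\beta_H^{-1}F_{K\cup H}$, $\beta_H=\prod_{h\in H}\beta_h$. For $K=\{k_1<\dots<k_p\}\subset H$, $\mathcal{S}^H_K(f):=(x_{k_1}\odot\cdots\odot x_{k_p}\odot f)'_{s,H}$, where $x_j$ (resp. $\overline{x}_j$) denotes the slice function induced by $\alpha_j+\varepsilon_{\{j\}}\beta_j$ (resp. $\alpha_j-\varepsilon_{\{j\}}\beta_j$).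 For $T=\{t_1<\dots<t_s\}\subset\{1,\dots,n\}$, $(\overline{x})_T=\overline{x}_{t_1}\cdots\overline{x}_{t_s}$. For $G=\{g_1<\dots<g_s\}$ and $T=(t_1,\dots,t_s)$, $|x_G|^{2T}=|x_{g_1}|^{2t_1}\cdots|x_{g_s}|^{2t_s}$. $\Delta_{m+1,g}$ is the Laplacian in the $m+1$ real coordinates of $x_g$. The notation $\mathcal{E}^{H,G}_{K,T}(f)$ refers to the functions produced from $\mathcal{S}^H_K(f)$ by applying, successively in the variables $x_g$, $g\in G$, the classical Almansi decomposition of a polyharmonic function $u$ with $\Delta^pu=0$ on a star-like domain as $u=\sum_{j=0}^{p-1}|x|^{2j}h_j$ with $h_j$ harmonic (here $p=\frac{m-1}{2}$). *)

theory Defs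
  imports "HOL-Analysis.Analysis"
begin

section \<open>Classes of differentiability and the Laplacian\<close>

text \<open>Class $C^k$ on an open set; meaningful only when the set is open.\<close>

fun C_k_on :: "nat \<Rightarrow> ('a::euclidean_space \<Rightarrow> 'b::real_normed_vector) \<Rightarrow> 'a set \<Rightarrow> bool" where
  "C_k_on 0 f U \<longleftrightarrow> continuous_on U f"
| "C_k_on (Suc k) f U \<longleftrightarrow>
     (\<forall>x\<in>U. f differentiable (at x)) \<and>
     (\<forall>b\<in>Basis. C_k_on k (\<lambda>x. frechet_derivative f (at x) b) U)"

definition laplacian :: "('a::euclidean_space \<Rightarrow> 'b::real_normed_vector) \<Rightarrow> 'a \<Rightarrow> 'b" where
  "laplacian u x =
     (\<Sum>b\<in>Basis. frechet_derivative (\<lambda>y. frechet_derivative u (at y) b) (at x) b)"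


section \<open>The Clifford algebra and the paravectors\<close>

text \<open>An element of $\mathbb{R}_m$, \<open>m = CARD('m)\<close>, is its vector of coordinates in the basis
  $e_A = e_{a_1}\cdots e_{a_k}$, $A = \{a_1 < \dots < a_k\}$. The componentwise \<open>*\<close> and the constant
  \<open>1\<close> that the library defines on vectors are not the Clifford product and its unit.\<close>

type_synonym 'm clifford = "real ^ ('m set)"

text \<open>$e_A e_B = \pm e_{A \Delta B}$: one sign change for each pair $a > b$ that has to be
  interchanged, and one for each $e_i^2 = -1$, $i \in A \cap B$.\<close>

definition clifford_sign :: "'m::{finite,linorder} set \<Rightarrow> 'm set \<Rightarrow> real" where
  "clifford_sign A B = (-1) ^ (card {(a, b) \<in> A \<times> B. b < a} + card (A \<inter> B))"

definition clifford_mult ::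
    "'m::{finite,linorder} clifford \<Rightarrow> 'm clifford \<Rightarrow> 'm clifford" (infixr "\<star>" 70) where
  "a \<star> b = (\<Sum>A\<in>UNIV. \<Sum>B\<in>UNIV. (clifford_sign A B * a $ A * b $ B) *\<^sub>R axis (sym_diff A B) 1)"

definition clifford_one :: "'m::{finite,linorder} clifford" where
  "clifford_one = axis {} 1"

definition clifford_gen :: "'m::{finite,linorder} \<Rightarrow> 'm clifford" where
  "clifford_gen i = axis {i} 1"

lemma clifford_mult_axis:
  "axis A 1 \<star> axis B 1 = clifford_sign A B *\<^sub>R axis (sym_diff A B) 1"
proof -
  have "axis A 1 \<star> axis B 1 =
      (\<Sum>A'\<in>UNIV. \<Sum>B'\<in>UNIV. if B' = B then (if A' = A
          then clifford_sign A B *\<^sub>R axis (sym_diff A B) (1::real) else 0) else 0)"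
    unfolding clifford_mult_def by (intro sum.cong refl) (auto simp: axis_def)
  then show ?thesis by simp
qed

lemma clifford_one_mult:
  fixes a :: "'m::{finite,linorder} clifford"
  shows "clifford_one \<star> a = a"
proof -
  have "clifford_one \<star> a = (\<Sum>A\<in>(UNIV::'m set set). \<Sum>B\<in>UNIV. if A = {} then a $ B *\<^sub>R axis B 1 else 0)"
    unfolding clifford_mult_def clifford_one_def
    by (intro sum.cong refl) (auto simp: axis_def clifford_sign_def)
  also have "\<dots> = (\<Sum>A\<in>(UNIV::'m set set). if A = {} then (\<Sum>B\<in>UNIV. a $ B *\<^sub>R axis B 1) else 0)"
    by (intro sum.cong refl) auto
  also have "\<dots> = (\<Sum>B\<in>UNIV. a $ B *\<^sub>R axis B 1)"
    by simp
  also have "\<dots> = a"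
    by (simp add: vec_eq_iff axis_def if_distrib cong: if_cong)
  finally show ?thesis .
qed

lemma clifford_relations:
  "clifford_gen i \<star> clifford_gen j + clifford_gen j \<star> clifford_gen i
     = (if i = j then - 2 else 0) *\<^sub>R clifford_one"
proof -
  have sgn: "clifford_sign {i} {j} = (if i = j \<or> j < i then -1 else 1)" for i j :: 'a
  proof -
    have "{(a, b) \<in> {i} \<times> {j}. b < a} = (if j < i then {(i, j)} else {})"
      by auto
    then show ?thesis
      by (auto simp: clifford_sign_def)
  qed
  have swap: "sym_diff {j} {i} = sym_diff {i} {j}"
    by auto
  show ?thesis
  proof (cases "i = j")
    case True
    then have "clifford_gen i \<star> clifford_gen j = - clifford_one"
      by (simp add: clifford_gen_def clifford_one_def clifford_mult_axis sgn)
    with True show ?thesis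
      by (simp add: scaleR_2[symmetric])
  next
    case False
    then have "clifford_sign {i} {j} + clifford_sign {j} {i} = 0"
      by (auto simp: sgn)
    then have "clifford_sign {i} {j} *\<^sub>R axis (sym_diff {i} {j}) (1::real) +
        clifford_sign {j} {i} *\<^sub>R axis (sym_diff {i} {j}) 1 = 0"
      by (simp only: scaleR_add_left[symmetric]) simp
    with False show ?thesis
      unfolding clifford_gen_def clifford_mult_axis swap by simp
  qed
qed

text \<open>\<open>(x0, v)\<close> stands for $x_0 + \sum_i v_i e_i$; the norm of the product type is the Euclidean norm
  of $\mathbb{R}^{m+1}$ and its \<open>Basis\<close> consists of the $m + 1$ coordinate directions.\<close>

type_synonym 'm paravector = "real \<times> (real ^ 'm)"

definition of_paravector :: "'m::{finite,linorder} paravector \<Rightarrow> 'm clifford" where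
  "of_paravector x = fst x *\<^sub>R clifford_one + (\<Sum>i\<in>UNIV. (snd x $ i) *\<^sub>R clifford_gen i)"

text \<open>Points of $(\mathbb{R}^{m+1})^n$, and functions of \<open>n\<close> paravector variables.\<close>

type_synonym ('m, 'n) points = "('m paravector, 'n) vec"
type_synonym ('m, 'n) pv_fun = "('m, 'n) points \<Rightarrow> 'm clifford"

definition imag_sphere :: "'m::{finite,linorder} paravector set" where
  "imag_sphere = {x. fst x = 0 \<and> (\<Sum>i\<in>UNIV. (snd x $ i)\<^sup>2) = 1}"


section \<open>Domains\<close>

definition conj_var :: "'n \<Rightarrow> complex ^ 'n \<Rightarrow> complex ^ 'n" where
  "conj_var h z = (\<chi> l. if l = h then cnj (z $ l) else z $ l)"

definition symmetric_domain :: "(complex ^ 'n) set \<Rightarrow> bool" where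
  "symmetric_domain D \<longleftrightarrow> (\<forall>h. \<forall>z\<in>D. conj_var h z \<in> D)"

definition circular :: "(complex ^ 'n) set \<Rightarrow> ('m::{finite,linorder}, 'n) points set" where
  "circular D = {x. \<exists>z\<in>D. \<exists>J. \<forall>l. J l \<in> imag_sphere \<and>
                     x $ l = (Re (z $ l), 0) + Im (z $ l) *\<^sub>R J l}"

definition upd_var :: "'a ^ 'n \<Rightarrow> 'n \<Rightarrow> 'a \<Rightarrow> 'a ^ 'n" where
  "upd_var y h w = (\<chi> l. if l = h then w else y $ l)"

definition var_section :: "('a ^ 'n) set \<Rightarrow> 'n \<Rightarrow> 'a ^ 'n \<Rightarrow> 'a set" where
  "var_section \<Omega> h y = {w. upd_var y h w \<in> \<Omega>}"

definition starlike_every_variable :: "('a::real_vector ^ 'n) set \<Rightarrow> bool" where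
  "starlike_every_variable \<Omega> \<longleftrightarrow>
     (\<forall>h. \<forall>y\<in>\<Omega>. 0 \<in> var_section \<Omega> h y \<and>
        (\<forall>w\<in>var_section \<Omega> h y. closed_segment 0 w \<subseteq> var_section \<Omega> h y))"


section \<open>Stem functions and slice functions\<close>

text \<open>\<open>F z $ K\<close> is the component $F_K(z)$ of $F(z) \in \mathbb{R}_m \otimes \mathbb{R}^{2^n}$.\<close>

type_synonym ('m, 'n) stem_fun = "complex ^ 'n \<Rightarrow> ('m clifford) ^ ('n set)"

definition stem_function :: "(complex ^ 'n::finite) set \<Rightarrow> ('m::finite, 'n) stem_fun \<Rightarrow> bool" where
  "stem_function D F \<longleftrightarrow>
     (\<forall>z\<in>D. \<forall>h K. F (conj_var h z) $ K = (if h \<in> K then - (F z $ K) else F z $ K))"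

text \<open>$[J_K, a] = J_{k_1} \cdots J_{k_p} a$ for $K = \{k_1 < \dots < k_p\}$.\<close>

definition bracket ::
    "('n::{finite,linorder} \<Rightarrow> 'm::{finite,linorder} paravector) \<Rightarrow> 'n set \<Rightarrow> 'm clifford \<Rightarrow> 'm clifford"
  where "bracket J K a = foldr (\<lambda>k b. of_paravector (J k) \<star> b) (sorted_list_of_set K) a"

text \<open>Every $x_l$ is written as $\alpha_l + J_l \beta_l$ with $\beta_l \ge 0$. If $x_l$ is real,
  \<open>imag_unit\<close> returns 0 instead of an arbitrary element of the sphere; this does not matter for a
  stem function $F$, because then $\beta_l = 0$ and $F_K(z) = 0$ for all $K \ni l$.\<close>

definition imag_unit :: "'m::finite paravector \<Rightarrow> 'm paravector" where
  "imag_unit w = (0, sgn (snd w))"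

definition slice_coords :: "('m::finite, 'n) points \<Rightarrow> complex ^ 'n" where
  "slice_coords x = (\<chi> l. Complex (fst (x $ l)) (norm (snd (x $ l))))"

definition induced ::
    "('m::{finite,linorder}, 'n::{finite,linorder}) stem_fun \<Rightarrow> ('m, 'n) pv_fun" where
  "induced F x = (\<Sum>K\<in>UNIV. bracket (\<lambda>l. imag_unit (x $ l)) K (F (slice_coords x) $ K))"

definition stem_of ::
    "(complex ^ 'n::{finite,linorder}) set \<Rightarrow>
     ('m::{finite,linorder}, 'n) pv_fun \<Rightarrow> ('m, 'n) stem_fun \<Rightarrow> bool" where
  "stem_of D f F \<longleftrightarrow> stem_function D F \<and> (\<forall>x\<in>circular D. f x = induced F x)"

definition slice_function ::
    "(complex ^ 'n::{finite,linorder}) set \<Rightarrow>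
     ('m::{finite,linorder}, 'n) pv_fun \<Rightarrow> bool" where
  "slice_function D f \<longleftrightarrow> (\<exists>F. stem_of D f F)"

text \<open>The stem function of a slice function is unique on \<open>D\<close>; the choice made outside \<open>D\<close> does not
  affect any value on \<open>circular D\<close>.\<close>

definition the_stem ::
    "(complex ^ 'n::{finite,linorder}) set \<Rightarrow>
     ('m::{finite,linorder}, 'n) pv_fun \<Rightarrow> ('m, 'n) stem_fun" where
  "the_stem D f = (SOME F. stem_of D f F)"

text \<open>$\partial_{\alpha_h}$ and $\partial_{\beta_h}$ are the derivatives in the directions \<open>axis h 1\<close>
  and \<open>axis h \<i>\<close> of \<open>complex ^ 'n\<close>.\<close>

definition slice_regular ::
    "(complex ^ 'n::{finite,linorder}) set \<Rightarrow>
     ('m::{finite,linorder}, 'n) pv_fun \<Rightarrow> bool" where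
  "slice_regular D f \<longleftrightarrow>
     (\<exists>F. stem_of D f F \<and> C_k_on 1 F D \<and>
        (\<forall>z\<in>D. \<forall>h K. h \<notin> K \<longrightarrow>
           frechet_derivative (\<lambda>w. F w $ K) (at z) (axis h 1)
             = frechet_derivative (\<lambda>w. F w $ (insert h K)) (at z) (axis h \<i>) \<and>
           frechet_derivative (\<lambda>w. F w $ K) (at z) (axis h \<i>)
             = - frechet_derivative (\<lambda>w. F w $ (insert h K)) (at z) (axis h 1)))"

definition stem_mult ::
    "('m::{finite,linorder}, 'n::finite) stem_fun \<Rightarrow> ('m, 'n) stem_fun \<Rightarrow> ('m, 'n) stem_fun" where
  "stem_mult F G z =
     (\<Sum>H\<in>UNIV. \<Sum>K\<in>UNIV. axis (sym_diff H K) ((-1) ^ card (H \<inter> K) *\<^sub>R (F z $ H \<star> G z $ K)))"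

definition slice_mult ::
    "(complex ^ 'n::{finite,linorder}) set \<Rightarrow>
     ('m::{finite,linorder}, 'n) pv_fun \<Rightarrow>
     ('m, 'n) pv_fun \<Rightarrow> ('m, 'n) pv_fun" where
  "slice_mult D f g = induced (stem_mult (the_stem D f) (the_stem D g))"

definition coord_fun ::
    "'n::{finite,linorder} \<Rightarrow> ('m::{finite,linorder}, 'n) pv_fun" where
  "coord_fun j = induced (\<lambda>z. axis {} (Re (z $ j) *\<^sub>R clifford_one) +
                               axis {j} (Im (z $ j) *\<^sub>R clifford_one))"

definition conj_coord_fun ::
    "'n::{finite,linorder} \<Rightarrow> ('m::{finite,linorder}, 'n) pv_fun" where
  "conj_coord_fun j = induced (\<lambda>z. axis {} (Re (z $ j) *\<^sub>R clifford_one) -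
                                    axis {j} (Im (z $ j) *\<^sub>R clifford_one))"

text \<open>$(\overline{x})_T = \overline{x}_{t_1} \cdots \overline{x}_{t_s}$ for
  $T = \{t_1 < \dots < t_s\}$.\<close>

definition conj_coord_prod ::
    "'n::{finite,linorder} set \<Rightarrow> ('m::{finite,linorder}, 'n) pv_fun" where
  "conj_coord_prod T x =
     foldr (\<lambda>t b. conj_coord_fun t x \<star> b) (sorted_list_of_set T) clifford_one"


section \<open>Spherical derivatives and the functions $\mathcal{S}^H_K(f)$\<close>

definition stem_sph_deriv ::
    "'n::finite set \<Rightarrow> ('m::finite, 'n) stem_fun \<Rightarrow> ('m, 'n) stem_fun" where
  "stem_sph_deriv H F z =
     (\<chi> K. if K \<inter> H = {} then inverse (\<Prod>h\<in>H. Im (z $ h)) *\<^sub>R (F z $ (K \<union> H)) else 0)"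

definition nonreal_points :: "'n::finite set \<Rightarrow> ('m::finite, 'n) points set" where
  "nonreal_points H = {x. \<forall>h\<in>H. snd (x $ h) \<noteq> 0}"

text \<open>The spherical derivative is given by its stem function at the points with $x_h$ not real for
  all $h \in H$. For slice regular functions it has a continuous extension to the whole of
  $\Omega_D$, which is the function that enters the decompositions on $\Omega_D$; at the points of
  continuity the limit below is the value itself.\<close>

definition sph_deriv ::
    "(complex ^ 'n::{finite,linorder}) set \<Rightarrow> 'n set \<Rightarrow>
     ('m::{finite,linorder}, 'n) pv_fun \<Rightarrow> ('m, 'n) pv_fun" where
  "sph_deriv D H f x =
     Lim (at x within (circular D \<inter> nonreal_points H)) (induced (stem_sph_deriv H (the_stem D f)))"

definition S_fun ::
    "(complex ^ 'n::{finite,linorder}) set \<Rightarrow> 'n set \<Rightarrow> 'n set \<Rightarrow>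
     ('m::{finite,linorder}, 'n) pv_fun \<Rightarrow> ('m, 'n) pv_fun" where
  "S_fun D H K f =
     sph_deriv D H (foldr (\<lambda>k g. slice_mult D (coord_fun k) g) (sorted_list_of_set K) f)"


section \<open>Polyharmonicity and the Almansi components\<close>

text \<open>The operator $\Delta_{m+1,g}$ on functions of \<open>n\<close> paravector variables.\<close>

definition var_laplacian ::
    "'n \<Rightarrow> ('a::euclidean_space ^ 'n \<Rightarrow> 'b::real_normed_vector) \<Rightarrow> 'a ^ 'n \<Rightarrow> 'b" where
  "var_laplacian g u x = laplacian (\<lambda>w. u (upd_var x g w)) (x $ g)"

text \<open>Of class $C^{2p}$ in the variable $x_g$, with $\Delta_{m+1,g}^p u = 0$ on the (open) set.\<close>

definition polyharmonic_in ::
    "nat \<Rightarrow> 'n \<Rightarrow> ('a::euclidean_space ^ 'n) set \<Rightarrow> ('a ^ 'n \<Rightarrow> 'b::real_normed_vector) \<Rightarrow> bool" where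
  "polyharmonic_in p g \<Omega> u \<longleftrightarrow>
     (\<forall>y\<in>\<Omega>. C_k_on (2 * p) (\<lambda>w. u (upd_var y g w)) (var_section \<Omega> g y) \<and>
             (var_laplacian g ^^ p) u y = 0)"

text \<open>The multi-indices $T = (t_g)_{g \in G}$ with $0 \le t_g \le \frac{m-3}{2}$; for $m = 1$ there
  are none unless $G = \emptyset$.\<close>

definition multi_indices :: "nat \<Rightarrow> 'n set \<Rightarrow> ('n \<Rightarrow> nat) set" where
  "multi_indices m G = G \<rightarrow>\<^sub>E {t. real t \<le> (real m - 3) / 2}"

definition norm_power :: "'n set \<Rightarrow> ('n \<Rightarrow> nat) \<Rightarrow> 'a::real_normed_vector ^ 'n \<Rightarrow> real" where
  "norm_power G T x = (\<Prod>g\<in>G. norm (x $ g) ^ (2 * T g))"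

text \<open>\<open>E K T\<close>, for $K \subseteq H$, are the functions $\mathcal{E}^{H,G}_{K,T}(f)$: the expansion
  of $\mathcal{S}^H_K(f)$ resulting from Almansi decompositions in the variables $x_g$, $g \in G$,
  with components harmonic in each of these variables. Grouping the terms by the power of one
  $|x_g|$ shows that this is what successive one-variable decompositions give, in any order; as the
  classical decomposition on a star-like domain is unique, the values on $\Omega_D$ are determined
  by \<open>f\<close>.\<close>

definition almansi_components ::
    "(complex ^ 'n::{finite,linorder}) set \<Rightarrow> 'n set \<Rightarrow> 'n set \<Rightarrow>
     ('m::{finite,linorder}, 'n) pv_fun \<Rightarrow>
     ('n set \<Rightarrow> ('n \<Rightarrow> nat) \<Rightarrow> ('m, 'n) pv_fun) \<Rightarrow> bool" where
  "almansi_components D H G f E \<longleftrightarrow>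
     (\<forall>K. K \<subseteq> H \<longrightarrow>
        (\<forall>x\<in>circular D. S_fun D H K f x =
           (\<Sum>T\<in>multi_indices CARD('m) G. norm_power G T x *\<^sub>R E K T x)) \<and>
        (\<forall>T\<in>multi_indices CARD('m) G. \<forall>g\<in>G. polyharmonic_in 1 g (circular D) (E K T)))"

definition G_fun ::
    "(complex ^ 'n::{finite,linorder}) set \<Rightarrow> 'n set \<Rightarrow>
     ('n set \<Rightarrow> ('n \<Rightarrow> nat) \<Rightarrow> ('m::{finite,linorder}, 'n) pv_fun) \<Rightarrow>
     ('n \<Rightarrow> nat) \<Rightarrow> ('m, 'n) pv_fun" where
  "G_fun D H E T x =
     (\<Sum>K\<in>Pow H. (-1) ^ card (H - K) *\<^sub>R slice_mult D (conj_coord_prod (H - K)) (E K T) x)"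

end

theory Submission
  imports Defs "HOL-Complex_Analysis.Cauchy_Integral_Formula"
begin

text \<open>The Almansi-type decomposition $f = \sum_K (-1)^{|H \setminus K|} (\overline{x})_{H \setminus K} \odot
  \mathcal{S}^H_K(f)$ is a finite identity between the components of the stem function of \<open>f\<close> and
  the quotients $F_{B \cup C} / \beta_C$, which extend to the points with $\beta_C = 0$ by Cauchy's
  formula in each variable. The harmonic components of the Almansi decomposition are unique, since
  the Laplacian of $|x|^{2j} h$ is $|x|^{2j-2}$ times a positive combination of \<open>h\<close> and of its Euler
  derivative. The derivatives of \<open>h\<close> needed here exist because a harmonic function of class $C^2$
  equals its convolutions with radial kernels. Uniqueness transfers the slice structure of $\mathcal{S}^H_K(f)$ to its components,
  and the components of their stem functions are again harmonic in each $x_g$. The product with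
  $(\overline{x})_{H \setminus K}$ introduces at most one factor $\overline{x}_g$ for every \<open>g\<close>, and a
  coordinate function times a harmonic function is biharmonic.\<close>

section \<open>Directional derivatives and functions of class $C^k$\<close>

text \<open>The obstacle is that the \<open>E K T\<close> are given only by an expansion and by
  harmonicity in single variables, whereas \<open>slice_mult\<close> reads the stem functions of its
  arguments. Nothing can be computed about \<open>G_fun\<close> before each \<open>E K T\<close> is
  known to have a stem function. No joint continuity of \<open>E K T\<close> is known either, so
  every analytic argument about it runs in one variable with the others frozen. Harmonicity is given
  in class $C^2$, but the Euler derivative has to be of class $C^2$ again and biharmonicity asks for
  class $C^4$; this is why smoothness is proved. The mean value property is used with a weight on a
  cube instead of on spheres, so that only integrals over boxes occur. \<open>S_fun\<close> is a
  \<open>Lim\<close>, whose value carries information only where the limit exists. At a point with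
  several real coordinates this means dividing by several imaginary parts at once; Cauchy's formula
  divides by one of them while keeping continuity in all the variables, so it can be
  iterated.\<close>

definition dirderiv :: "'a::real_normed_vector \<Rightarrow> ('a \<Rightarrow> 'b::real_normed_vector) \<Rightarrow> 'a \<Rightarrow> 'b"
  where "dirderiv b f = (\<lambda>x. frechet_derivative f (at x) b)"

lemma dirderiv_eq: "(f has_derivative f') (at x) \<Longrightarrow> dirderiv b f x = f' b"
  unfolding dirderiv_def using frechet_derivative_at by metis

text \<open>Differentiability is not assumed: \<open>frechet_derivative\<close> is a choice among
  the maps satisfying \<open>has_derivative\<close>, and functions that agree near \<open>x\<close>
  have the same such maps.\<close>

lemma dirderiv_cong:
  assumes "open U" "x \<in> U" "\<And>y. y \<in> U \<Longrightarrow> f y = g y"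
  shows "dirderiv b f x = dirderiv b g x"
proof -
  have "(f has_derivative f') (at x) \<longleftrightarrow> (g has_derivative f') (at x)" for f'
    using assms by (metis has_derivative_transform_within_open)
  then show ?thesis
    unfolding dirderiv_def frechet_derivative_def by simp
qed

lemma laplacian_dirderiv: "laplacian u = (\<lambda>x. \<Sum>b\<in>Basis. dirderiv b (dirderiv b u) x)"
  by (simp add: fun_eq_iff laplacian_def dirderiv_def)

lemma laplacian_cong:
  assumes "open U" "x \<in> U" "\<And>y. y \<in> U \<Longrightarrow> f y = g y"
  shows "laplacian f x = laplacian g x"
proof -
  have "dirderiv b f y = dirderiv b g y" if "y \<in> U" for y b
    using dirderiv_cong[OF assms(1) that] assms(3) by blast
  then show ?thesis
    unfolding laplacian_dirderiv
    by (intro sum.cong refl dirderiv_cong[OF assms(1,2)])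
qed

lemma C_k_on_Suc_iff:
  "C_k_on (Suc k) f U \<longleftrightarrow> (\<forall>x\<in>U. f differentiable (at x)) \<and> (\<forall>b\<in>Basis. C_k_on k (dirderiv b f) U)"
  by (simp add: dirderiv_def)

declare C_k_on.simps(2)[simp del]

lemma C_k_on_SucI:
  assumes "\<And>x. x \<in> U \<Longrightarrow> f differentiable (at x)" "\<And>b. b \<in> Basis \<Longrightarrow> C_k_on k (dirderiv b f) U"
  shows "C_k_on (Suc k) f U"
  using assms by (simp add: C_k_on_Suc_iff)

lemma C_k_on_cong:
  assumes "open U" "\<And>y. y \<in> U \<Longrightarrow> f y = g y" "C_k_on k f U"
  shows "C_k_on k g U"
  using assms(2,3)
proof (induction k arbitrary: f g)
  case 0
  then show ?case by (simp cong: continuous_on_cong)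
next
  case (Suc k)
  have "g differentiable (at x)" if "x \<in> U" for x
    using Suc.prems assms(1) that unfolding C_k_on_Suc_iff differentiable_def
    by (metis has_derivative_transform_within_open)
  moreover have "C_k_on k (dirderiv b g) U" if "b \<in> Basis" for b
    by (rule Suc.IH[of "dirderiv b f"])
      (use Suc.prems that dirderiv_cong[OF assms(1), of _ f g] in \<open>auto simp: C_k_on_Suc_iff\<close>)
  ultimately show ?case by (simp add: C_k_on_Suc_iff)
qed

lemma C_k_on_Suc_imp: "C_k_on (Suc k) f U \<Longrightarrow> C_k_on k f U"
proof (induction k arbitrary: f)
  case 0
  then show ?case
    by (auto simp: C_k_on_Suc_iff intro!: continuous_at_imp_continuous_on differentiable_imp_continuous_within)
next
  case (Suc k)
  then show ?case by (metis C_k_on_Suc_iff)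
qed

lemma C_k_on_le: "C_k_on k f U \<Longrightarrow> j \<le> k \<Longrightarrow> C_k_on j f U"
  by (induction k) (auto simp: le_Suc_eq dest: C_k_on_Suc_imp)

lemma C_k_on_subset: "C_k_on k f U \<Longrightarrow> V \<subseteq> U \<Longrightarrow> C_k_on k f V"
  by (induction k arbitrary: f) (auto simp: C_k_on_Suc_iff intro: continuous_on_subset)

lemma C_k_on_imp_continuous: "C_k_on k f U \<Longrightarrow> continuous_on U f"
  using C_k_on_le[of k f U 0] by simp

text \<open>Serves for functions glued from different formulas, as a kernel extended by 0, and for
  regularity that is proved near each point separately.\<close>

lemma C_k_on_local:
  assumes "\<And>x. x \<in> U \<Longrightarrow> \<exists>V. open V \<and> x \<in> V \<and> C_k_on k f V"
  shows "C_k_on k f U"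
  using assms
proof (induction k arbitrary: f)
  case 0
  then have "isCont f x" if "x \<in> U" for x
    using 0 that by (force simp: continuous_on_eq_continuous_at)
  then show ?case by (simp add: continuous_at_imp_continuous_on)
next
  case (Suc k)
  show ?case
  proof (rule C_k_on_SucI)
    show "f differentiable at x" if "x \<in> U" for x
      using Suc.prems[OF that] by (auto simp: C_k_on_Suc_iff)
    show "C_k_on k (dirderiv b f) U" if "b \<in> Basis" for b
      using Suc.prems that by (intro Suc.IH) (force simp: C_k_on_Suc_iff)
  qed
qed

lemma C_k_on_differentiable: "C_k_on k f U \<Longrightarrow> 0 < k \<Longrightarrow> x \<in> U \<Longrightarrow> f differentiable (at x)"
  by (cases k) (auto simp: C_k_on_Suc_iff)

lemma C_k_on_dirderiv: "C_k_on (Suc k) f U \<Longrightarrow> b \<in> Basis \<Longrightarrow> C_k_on k (dirderiv b f) U"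
  by (simp add: C_k_on_Suc_iff)

lemma dirderiv_const [simp]: "dirderiv b (\<lambda>x. c) = (\<lambda>x. 0)"
  by (auto simp: dirderiv_eq[OF has_derivative_const])

lemma C_k_on_const: "C_k_on k (\<lambda>x. c) U"
  by (induction k arbitrary: c) (auto simp: C_k_on_Suc_iff)

lemma dirderiv_bounded_linear:
  "bounded_linear L \<Longrightarrow> dirderiv b L = (\<lambda>x. L b)"
  by (rule ext, rule dirderiv_eq) (rule bounded_linear_imp_has_derivative)

lemma C_k_on_bounded_linear: "bounded_linear L \<Longrightarrow> C_k_on k L U"
  by (cases k)
    (auto simp: C_k_on_Suc_iff dirderiv_bounded_linear C_k_on_const linear_continuous_on bounded_linear_imp_differentiable)

lemma dirderiv_add:
  "f differentiable (at x) \<Longrightarrow> g differentiable (at x) \<Longrightarrow>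
    dirderiv b (\<lambda>x. f x + g x) x = dirderiv b f x + dirderiv b g x"
  unfolding frechet_derivative_works by (subst dirderiv_eq, rule has_derivative_add) (auto simp: dirderiv_def)

lemma dirderiv_compose_linear:
  "bounded_linear L \<Longrightarrow> f differentiable (at x) \<Longrightarrow>
    dirderiv b (\<lambda>x. L (f x)) x = L (dirderiv b f x)"
  unfolding frechet_derivative_works
  by (subst dirderiv_eq, rule bounded_linear.has_derivative) (auto simp: dirderiv_def)

lemma dirderiv_scaleR:
  "f differentiable (at x) \<Longrightarrow> g differentiable (at x) \<Longrightarrow>
    dirderiv b (\<lambda>x. f x *\<^sub>R g x) x = dirderiv b f x *\<^sub>R g x + f x *\<^sub>R dirderiv b g x"
  unfolding frechet_derivative_works
  by (subst dirderiv_eq, rule has_derivative_scaleR) (auto simp: dirderiv_def)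

lemma C_k_on_add:
  assumes "open U" "C_k_on k f U" "C_k_on k g U"
  shows "C_k_on k (\<lambda>x. f x + g x) U"
  using assms(2,3)
proof (induction k arbitrary: f g)
  case 0
  then show ?case by (auto intro: continuous_intros)
next
  case (Suc k)
  show ?case
  proof (rule C_k_on_SucI)
    fix b :: 'a assume b: "b \<in> Basis"
    show "C_k_on k (dirderiv b (\<lambda>x. f x + g x)) U"
      by (rule C_k_on_cong[OF assms(1) _ Suc.IH[of "dirderiv b f" "dirderiv b g"]])
        (use Suc.prems b in \<open>auto simp: C_k_on_Suc_iff dirderiv_add\<close>)
  qed (use Suc.prems in \<open>auto simp: C_k_on_Suc_iff\<close>)
qed

lemma C_k_on_scaleR:
  assumes "open U" "C_k_on k f U" "C_k_on k g U"
  shows "C_k_on k (\<lambda>x. f x *\<^sub>R g x) U"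
  using assms(2,3)
proof (induction k arbitrary: f g)
  case 0
  then show ?case by (auto intro: continuous_intros)
next
  case (Suc k)
  show ?case
  proof (rule C_k_on_SucI)
    fix b :: 'a assume b: "b \<in> Basis"
    have "C_k_on k (\<lambda>x. dirderiv b f x *\<^sub>R g x + f x *\<^sub>R dirderiv b g x) U"
      using Suc.prems b C_k_on_Suc_imp[OF Suc.prems(1)] C_k_on_Suc_imp[OF Suc.prems(2)]
      by (intro C_k_on_add Suc.IH assms) (auto simp: C_k_on_Suc_iff)
    then show "C_k_on k (dirderiv b (\<lambda>x. f x *\<^sub>R g x)) U"
      by (rule C_k_on_cong[OF assms(1), rotated])
        (use Suc.prems b in \<open>auto simp: C_k_on_Suc_iff dirderiv_scaleR\<close>)
  qed (use Suc.prems in \<open>auto simp: C_k_on_Suc_iff\<close>)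
qed

lemma C_k_on_mult:
  fixes f g :: "'a::euclidean_space \<Rightarrow> real"
  assumes "open U" "C_k_on k f U" "C_k_on k g U"
  shows "C_k_on k (\<lambda>x. f x * g x) U"
  using C_k_on_scaleR[OF assms] by simp

lemma C_k_on_compose_linear:
  assumes "open U" "bounded_linear L" "C_k_on k f U"
  shows "C_k_on k (\<lambda>x. L (f x)) U"
  using assms(3)
proof (induction k arbitrary: f)
  case 0
  then show ?case using assms(2) by (auto intro: bounded_linear.continuous_on)
next
  case (Suc k)
  show ?case
  proof (rule C_k_on_SucI)
    fix b :: 'a assume b: "b \<in> Basis"
    show "C_k_on k (dirderiv b (\<lambda>x. L (f x))) U"
      by (rule C_k_on_cong[OF assms(1) _ Suc.IH[of "dirderiv b f"]])
        (use Suc.prems b in \<open>auto simp: C_k_on_Suc_iff dirderiv_compose_linear[OF assms(2)]\<close>)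
  next
    fix x assume "x \<in> U"
    then show "(\<lambda>x. L (f x)) differentiable at x"
      using Suc.prems assms(2) unfolding C_k_on_Suc_iff differentiable_def
      by (blast intro: bounded_linear.has_derivative)
  qed
qed

lemma C_k_on_sum:
  assumes "open U" "\<And>i. i \<in> I \<Longrightarrow> C_k_on k (f i) U"
  shows "C_k_on k (\<lambda>x. \<Sum>i\<in>I. f i x) U"
  using assms(2)
  by (induction I rule: infinite_finite_induct) (auto intro: C_k_on_const C_k_on_add assms(1))

lemma C_k_on_power:
  fixes f :: "'a::euclidean_space \<Rightarrow> real"
  assumes "open U" "C_k_on k f U"
  shows "C_k_on k (\<lambda>x. f x ^ n) U"
  by (induction n) (auto intro: C_k_on_const C_k_on_mult assms)

lemma C_k_on_inner_left: "C_k_on k (\<lambda>x. x \<bullet> b) U"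
  by (intro C_k_on_bounded_linear bounded_linear_inner_left)

lemma C_k_on_inner_self:
  fixes U :: "'a::euclidean_space set"
  assumes "open U"
  shows "C_k_on k (\<lambda>x. x \<bullet> x) U"
  by (subst euclidean_inner) (intro C_k_on_sum C_k_on_mult C_k_on_inner_left assms)

lemma has_derivative_dirderiv_sum:
  fixes f :: "'a::euclidean_space \<Rightarrow> 'b::real_normed_vector"
  assumes "f differentiable (at x)"
  shows "(f has_derivative (\<lambda>h. \<Sum>b\<in>Basis. (h \<bullet> b) *\<^sub>R dirderiv b f x)) (at x)"
proof -
  have D: "(f has_derivative frechet_derivative f (at x)) (at x)"
    using assms frechet_derivative_works by blast
  then interpret bounded_linear "frechet_derivative f (at x)"
    by (rule has_derivative_bounded_linear)
  have "frechet_derivative f (at x) h = (\<Sum>b\<in>Basis. (h \<bullet> b) *\<^sub>R dirderiv b f x)" for h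
    using sum[of "\<lambda>b. (h \<bullet> b) *\<^sub>R b" Basis] by (simp add: euclidean_representation scaleR dirderiv_def)
  then have "frechet_derivative f (at x) = (\<lambda>h. \<Sum>b\<in>Basis. (h \<bullet> b) *\<^sub>R dirderiv b f x)"
    by blast
  with D show ?thesis by simp
qed

lemma has_derivative_compose_dirderiv:
  fixes f :: "'a::euclidean_space \<Rightarrow> 'b::real_normed_vector"
  assumes "(g has_derivative g') (at x)" "f differentiable (at (g x))"
  shows "((\<lambda>x. f (g x)) has_derivative (\<lambda>h. \<Sum>b\<in>Basis. (g' h \<bullet> b) *\<^sub>R dirderiv b f (g x))) (at x)"
  using has_derivative_compose[OF assms(1) has_derivative_dirderiv_sum[OF assms(2)]] .

section \<open>Derivatives along lines and the symmetry of second derivatives\<close>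

lemma has_vector_derivative_line:
  assumes "u differentiable (at (x + s *\<^sub>R a))"
  shows "((\<lambda>s. u (x + s *\<^sub>R a)) has_vector_derivative dirderiv a u (x + s *\<^sub>R a)) (at s within S)"
proof -
  have D: "(u has_derivative frechet_derivative u (at (x + s *\<^sub>R a))) (at (x + s *\<^sub>R a))"
    using assms frechet_derivative_works by blast
  have "((\<lambda>s. x + s *\<^sub>R a) has_derivative (\<lambda>h. h *\<^sub>R a)) (at s within S)"
    by (auto intro!: derivative_eq_intros)
  from has_derivative_compose[OF this D] show ?thesis
    unfolding has_vector_derivative_def dirderiv_def
    by (simp add: linear_scale[OF has_derivative_linear[OF D]])
qed

text \<open>Over a segment in direction \<open>b\<close>, both mixed derivatives integrate to the
  increment of \<open>dirderiv a u\<close>: one by differentiating under the integral the formula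
  for the increment of \<open>u\<close>, the other by the fundamental theorem. Differentiating the
  two integrals in the length of the segment gives the integrands at \<open>x\<close>.\<close>

lemma dirderiv_commute:
  fixes u :: "'a::euclidean_space \<Rightarrow> 'b::banach"
  assumes U: "open U" and C2: "C_k_on 2 u U" and x: "x \<in> U" and a: "a \<in> Basis" and b: "b \<in> Basis"
  shows "dirderiv a (dirderiv b u) x = dirderiv b (dirderiv a u) x"
proof -
  obtain r where r: "r > 0" "ball x r \<subseteq> U"
    using U x open_contains_ball by blast
  define e where "e = r / 2"
  have e: "e > 0" using r by (simp add: e_def)
  have inU: "x + s *\<^sub>R a + t *\<^sub>R b \<in> U" if "\<bar>s\<bar> < e" "\<bar>t\<bar> < e" for s t
  proof -
    have "norm (s *\<^sub>R a + t *\<^sub>R b) \<le> \<bar>s\<bar> + \<bar>t\<bar>"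
      using norm_triangle_ineq[of "s *\<^sub>R a" "t *\<^sub>R b"] a b by simp
    also have "\<dots> < r" using that by (simp add: e_def)
    finally have "dist x (x + s *\<^sub>R a + t *\<^sub>R b) < r"
      by (metis add.assoc dist_norm norm_minus_commute add_diff_cancel_left')
    then show ?thesis using r by auto
  qed
  have C2': "C_k_on (Suc (Suc 0)) u U" using C2 by (simp add: numeral_2_eq_2)
  have d1: "u differentiable (at y)" if "y \<in> U" for y
    using C_k_on_differentiable[OF C2 _ that] by simp
  have d2: "dirderiv c u differentiable (at y)" if "y \<in> U" "c \<in> Basis" for y c
    using C_k_on_differentiable[OF C_k_on_dirderiv[OF C2' that(2)] _ that(1)] by simp
  have cont2: "continuous_on U (dirderiv c (dirderiv c' u))" if "c \<in> Basis" "c' \<in> Basis" for c c'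
    using C2' that by (simp add: C_k_on_Suc_iff)
  have cont1: "continuous_on U (dirderiv c u)" if "c \<in> Basis" for c
    using d2[OF _ that] by (intro differentiable_imp_continuous_on differentiable_at_imp_differentiable_on) auto
  have FTC: "((\<lambda>t. dirderiv c g (x + s *\<^sub>R a + t *\<^sub>R c)) has_integral
      g (x + s *\<^sub>R a + t *\<^sub>R c) - g (x + s *\<^sub>R a)) {0..t}"
    if "\<And>y. y \<in> U \<Longrightarrow> g differentiable (at y)" "0 \<le> t" "t < e" "\<bar>s\<bar> < e" "c = b"
    for g :: "'a \<Rightarrow> 'b" and c s t
  proof -
    have "((\<lambda>t. dirderiv c g (x + s *\<^sub>R a + t *\<^sub>R c)) has_integral
        g (x + s *\<^sub>R a + t *\<^sub>R c) - g (x + s *\<^sub>R a + 0 *\<^sub>R c)) {0..t}"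
      by (intro fundamental_theorem_of_calculus has_vector_derivative_line that) (use that inU in auto)
    then show ?thesis by simp
  qed
  have eq: "integral {0..t} (\<lambda>\<tau>. dirderiv a (dirderiv b u) (x + \<tau> *\<^sub>R b)) =
      integral {0..t} (\<lambda>\<tau>. dirderiv b (dirderiv a u) (x + \<tau> *\<^sub>R b))" if t: "0 \<le> t" "t < e" for t
  proof -
    have "((\<lambda>s. integral (cbox 0 t) (\<lambda>\<tau>. dirderiv b u (x + s *\<^sub>R a + \<tau> *\<^sub>R b))) has_vector_derivative
        integral (cbox 0 t) (\<lambda>\<tau>. dirderiv a (dirderiv b u) (x + 0 *\<^sub>R a + \<tau> *\<^sub>R b))) (at 0 within {-e<..<e})"
    proof (rule leibniz_rule_vector_derivative[where fx = "\<lambda>s \<tau>. dirderiv a (dirderiv b u) (x + s *\<^sub>R a + \<tau> *\<^sub>R b)"])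
      fix s \<tau> assume s: "s \<in> {-e<..<e}" "\<tau> \<in> cbox 0 t"
      then have "x + s *\<^sub>R a + \<tau> *\<^sub>R b \<in> U" using t by (intro inU) auto
      then have "dirderiv b u differentiable (at ((x + \<tau> *\<^sub>R b) + s *\<^sub>R a))"
        using d2 b by (simp add: algebra_simps)
      from has_vector_derivative_line[OF this]
      show "((\<lambda>s. dirderiv b u (x + s *\<^sub>R a + \<tau> *\<^sub>R b)) has_vector_derivative
          dirderiv a (dirderiv b u) (x + s *\<^sub>R a + \<tau> *\<^sub>R b)) (at s within {-e<..<e})"
        by (simp add: algebra_simps)
    next
      fix s assume s: "s \<in> {-e<..<e}"
      show "(\<lambda>\<tau>. dirderiv b u (x + s *\<^sub>R a + \<tau> *\<^sub>R b)) integrable_on cbox 0 t"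
        by (intro integrable_continuous continuous_on_compose2[OF cont1[OF b]] continuous_intros)
          (use s t inU in auto)
    next
      show "continuous_on ({-e<..<e} \<times> cbox 0 t)
          (\<lambda>(s, \<tau>). dirderiv a (dirderiv b u) (x + s *\<^sub>R a + \<tau> *\<^sub>R b))"
        unfolding split_beta
        by (intro continuous_on_compose2[OF cont2[OF a b]] continuous_intros) (use t inU in auto)
    qed (use e in auto)
    then have 1: "((\<lambda>s. integral {0..t} (\<lambda>\<tau>. dirderiv b u (x + s *\<^sub>R a + \<tau> *\<^sub>R b))) has_vector_derivative
        integral {0..t} (\<lambda>\<tau>. dirderiv a (dirderiv b u) (x + \<tau> *\<^sub>R b))) (at 0 within {-e<..<e})"
      by simp
    have 2: "((\<lambda>s. u (x + t *\<^sub>R b + s *\<^sub>R a) - u (x + s *\<^sub>R a)) has_vector_derivative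
        dirderiv a u (x + t *\<^sub>R b + 0 *\<^sub>R a) - dirderiv a u (x + 0 *\<^sub>R a)) (at 0 within {-e<..<e})"
      using inU[of 0 t] inU[of 0 0] e t
      by (intro has_vector_derivative_diff has_vector_derivative_line d1) auto
    have 3: "((\<lambda>s. integral {0..t} (\<lambda>\<tau>. dirderiv b u (x + s *\<^sub>R a + \<tau> *\<^sub>R b))) has_vector_derivative
        dirderiv a u (x + t *\<^sub>R b) - dirderiv a u x) (at 0 within {-e<..<e})"
    proof (rule has_vector_derivative_transform[OF _ _ 2[simplified]])
      show "0 \<in> {-e<..<e}" using e by simp
      fix s assume "s \<in> {-e<..<e}"
      then show "integral {0..t} (\<lambda>\<tau>. dirderiv b u (x + s *\<^sub>R a + \<tau> *\<^sub>R b)) =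
          u (x + t *\<^sub>R b + s *\<^sub>R a) - u (x + s *\<^sub>R a)"
        using integral_unique[OF FTC[OF d1 t, of s b]] by (auto simp add: algebra_simps)
    qed
    have "integral {0..t} (\<lambda>\<tau>. dirderiv a (dirderiv b u) (x + \<tau> *\<^sub>R b)) =
        dirderiv a u (x + t *\<^sub>R b) - dirderiv a u x"
      by (rule vector_derivative_unique_within[OF _ 1 3])
         (use e in \<open>simp add: at_within_open[of 0 "{-e<..<e}"]\<close>)
    also have "\<dots> = integral {0..t} (\<lambda>\<tau>. dirderiv b (dirderiv a u) (x + \<tau> *\<^sub>R b))"
      using integral_unique[OF FTC[OF d2[OF _ a] t, of 0 b]] e by simp
    finally show ?thesis .
  qed
  \<comment> \<open>The integrals were compared for nonnegative \<open>t\<close> only, so their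
    derivatives at 0 are taken from one side.\<close>
  define T where "T = {0..e / 2}"
  have D: "((\<lambda>t. integral {0..t} (\<lambda>\<tau>. dirderiv c (dirderiv c' u) (x + \<tau> *\<^sub>R b))) has_vector_derivative
      dirderiv c (dirderiv c' u) (x + 0 *\<^sub>R b)) (at 0 within T)" if "c \<in> Basis" "c' \<in> Basis" for c c'
    unfolding T_def
    by (intro integral_has_vector_derivative continuous_on_compose2[OF cont2[OF that]] continuous_intros)
       (use e inU[of 0] in auto)
  have D': "((\<lambda>t. integral {0..t} (\<lambda>\<tau>. dirderiv a (dirderiv b u) (x + \<tau> *\<^sub>R b))) has_vector_derivative
      dirderiv b (dirderiv a u) (x + 0 *\<^sub>R b)) (at 0 within T)"
    by (rule has_vector_derivative_transform[OF _ _ D[OF b a]]) (use eq e in \<open>auto simp: T_def\<close>)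
  have "at 0 within T \<noteq> bot"
    using e by (auto simp: T_def at_within_Icc_at_right)
  from vector_derivative_unique_within[OF this D[OF a b] D'] show ?thesis by simp
qed

section \<open>Convolution with a smooth kernel\<close>

lemma dirderiv_eq_sum:
  fixes f :: "'a::euclidean_space \<Rightarrow> 'b::real_normed_vector"
  shows "f differentiable (at x) \<Longrightarrow> dirderiv h f x = (\<Sum>b\<in>Basis. (h \<bullet> b) *\<^sub>R dirderiv b f x)"
  by (rule dirderiv_eq[OF has_derivative_dirderiv_sum])

lemma dirderiv_compose_affine:
  fixes f :: "'b::euclidean_space \<Rightarrow> 'c::real_normed_vector"
  assumes "bounded_linear L" "f differentiable (at (a + L x))"
  shows "(\<lambda>x. f (a + L x)) differentiable (at x)"
    and "dirderiv b (\<lambda>x. f (a + L x)) x = (\<Sum>c\<in>Basis. (L b \<bullet> c) *\<^sub>R dirderiv c f (a + L x))"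
proof -
  have "((\<lambda>x. a + L x) has_derivative L) (at x)"
    using bounded_linear_imp_has_derivative[OF assms(1)] by (auto intro!: derivative_eq_intros)
  note D = has_derivative_compose_dirderiv[OF this assms(2)]
  show "(\<lambda>x. f (a + L x)) differentiable (at x)"
    using D differentiableI by blast
  show "dirderiv b (\<lambda>x. f (a + L x)) x = (\<Sum>c\<in>Basis. (L b \<bullet> c) *\<^sub>R dirderiv c f (a + L x))"
    by (rule dirderiv_eq[OF D])
qed

lemma C_k_on_compose_affine:
  fixes f :: "'b::euclidean_space \<Rightarrow> 'c::real_normed_vector" and L :: "'a::euclidean_space \<Rightarrow> 'b"
  assumes L: "bounded_linear L" and U: "open U" and V: "(\<lambda>x. a + L x) ` U \<subseteq> V" and f: "C_k_on k f V"
  shows "C_k_on k (\<lambda>x. f (a + L x)) U"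
  using f
proof (induction k arbitrary: f)
  case 0
  have "continuous_on U (\<lambda>x. a + L x)"
    by (intro continuous_intros linear_continuous_on L)
  with 0 V show ?case by (auto intro: continuous_on_compose2)
next
  case (Suc k)
  have d: "f differentiable (at (a + L x))" if "x \<in> U" for x
    using Suc.prems V that by (auto simp: C_k_on_Suc_iff)
  show ?case
  proof (rule C_k_on_SucI)
    show "(\<lambda>x. f (a + L x)) differentiable at x" if "x \<in> U" for x
      using dirderiv_compose_affine(1)[OF L d[OF that]] .
    show "C_k_on k (dirderiv b (\<lambda>x. f (a + L x))) U" for b
    proof (rule C_k_on_cong[OF U])
      show "C_k_on k (\<lambda>x. \<Sum>c\<in>Basis. (L b \<bullet> c) *\<^sub>R dirderiv c f (a + L x)) U"
        using Suc.prems
        by (intro C_k_on_sum C_k_on_scaleR C_k_on_const U Suc.IH) (auto simp: C_k_on_Suc_iff)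
    qed (use dirderiv_compose_affine(2)[OF L d] in auto)
  qed
qed

text \<open>All derivatives fall on the kernel, so continuity of \<open>v\<close> is enough. This is
  the source of every gain in regularity below.\<close>

lemma C_k_on_convolution:
  fixes \<kappa> :: "'a::euclidean_space \<Rightarrow> real" and v :: "'a \<Rightarrow> 'b::banach"
  assumes v: "continuous_on (cbox p q) v" and \<kappa>: "C_k_on k \<kappa> UNIV"
  shows "C_k_on k (\<lambda>x. integral (cbox p q) (\<lambda>w. \<kappa> (x - w) *\<^sub>R v w)) UNIV"
  using \<kappa>
proof (induction k arbitrary: \<kappa>)
  case 0
  then have c0: "continuous_on UNIV \<kappa>" by simp
  have "continuous_on (UNIV \<times> cbox p q) (\<lambda>(x, w). \<kappa> (x - w) *\<^sub>R v w)"
    unfolding split_beta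
    by (intro continuous_intros continuous_on_compose2[OF c0] continuous_on_compose2[OF v]) auto
  then show ?case
    by (simp add: integral_continuous_on_param)
next
  case (Suc k)
  have d: "\<kappa> differentiable (at x)" for x
    using Suc.prems by (simp add: C_k_on_Suc_iff)
  have c: "continuous_on UNIV (dirderiv b \<kappa>)" if "b \<in> Basis" for b
    using C_k_on_imp_continuous[OF C_k_on_dirderiv[OF Suc.prems that]] .
  have c0: "continuous_on UNIV \<kappa>"
    using C_k_on_imp_continuous[OF Suc.prems] .
  \<comment> \<open>The derivative of the integrand in \<open>x\<close>, packed as a
    \<open>blinfun\<close> for \<open>leibniz_rule\<close>; its continuity is then checked on basis
    vectors.\<close>
  define L where "L = (\<lambda>x w. Blinfun (\<lambda>h. (\<Sum>b\<in>Basis. (h \<bullet> b) * dirderiv b \<kappa> (x - w)) *\<^sub>R v w))"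
  have bl: "bounded_linear (\<lambda>h. (\<Sum>b\<in>Basis. (h \<bullet> b) * dirderiv b \<kappa> (x - w)) *\<^sub>R v w)" for x w
    by (intro bounded_linear_scaleR_const bounded_linear_sum bounded_linear_mult_const bounded_linear_inner_left)
  have L: "blinfun_apply (L x w) = (\<lambda>h. (\<Sum>b\<in>Basis. (h \<bullet> b) * dirderiv b \<kappa> (x - w)) *\<^sub>R v w)" for x w
    unfolding L_def by (rule bounded_linear_Blinfun_apply[OF bl])
  have Lb: "blinfun_apply (L x w) b = dirderiv b \<kappa> (x - w) *\<^sub>R v w" if "b \<in> Basis" for x w b
    using that by (simp add: L inner_Basis if_distrib[of "\<lambda>x. x * _"] cong: if_cong)
  have contL: "continuous_on (UNIV \<times> cbox p q) (\<lambda>(x, w). L x w)"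
  proof (rule continuous_on_blinfun_componentwise)
    fix b :: 'a assume "b \<in> Basis"
    then show "continuous_on (UNIV \<times> cbox p q) (\<lambda>xa. blinfun_apply (case xa of (x, w) \<Rightarrow> L x w) b)"
      by (auto simp: split_beta Lb intro!: continuous_intros continuous_on_compose2[OF c] continuous_on_compose2[OF v])
  qed
  have D: "((\<lambda>x. integral (cbox p q) (\<lambda>w. \<kappa> (x - w) *\<^sub>R v w)) has_derivative
      blinfun_apply (integral (cbox p q) (L x))) (at x within UNIV)" for x
  proof (rule leibniz_rule[OF _ _ contL])
    fix x w :: 'a
    have "((\<lambda>x. x - w) has_derivative (\<lambda>h. h)) (at x)"
      by (auto intro!: derivative_eq_intros)
    from has_derivative_compose_dirderiv[OF this d]
    show "((\<lambda>x. \<kappa> (x - w) *\<^sub>R v w) has_derivative blinfun_apply (L x w)) (at x within UNIV)"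
      unfolding L by (auto intro!: derivative_eq_intros)
  next
    fix x
    show "(\<lambda>w. \<kappa> (x - w) *\<^sub>R v w) integrable_on cbox p q"
      by (auto intro!: integrable_continuous continuous_intros continuous_on_compose2[OF c0] v)
  qed auto
  have int: "L x integrable_on cbox p q" for x
  proof -
    have "continuous_on (cbox p q) (\<lambda>w. (\<lambda>(x, w). L x w) (x, w))"
      by (rule continuous_on_compose2[OF contL]) (auto intro!: continuous_intros)
    then show ?thesis by (simp add: integrable_continuous)
  qed
  show ?case
  proof (rule C_k_on_SucI)
    show "(\<lambda>x. integral (cbox p q) (\<lambda>w. \<kappa> (x - w) *\<^sub>R v w)) differentiable at x" for x
      using D[of x] differentiableI by auto
    fix b :: 'a assume b: "b \<in> Basis"
    have "dirderiv b (\<lambda>x. integral (cbox p q) (\<lambda>w. \<kappa> (x - w) *\<^sub>R v w)) =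
        (\<lambda>x. integral (cbox p q) (\<lambda>w. dirderiv b \<kappa> (x - w) *\<^sub>R v w))"
      using dirderiv_eq[OF D] blinfun_apply_integral[OF int] by (auto simp: Lb[OF b])
    with Suc.IH[OF C_k_on_dirderiv[OF Suc.prems b]]
    show "C_k_on k (dirderiv b (\<lambda>x. integral (cbox p q) (\<lambda>w. \<kappa> (x - w) *\<^sub>R v w))) UNIV"
      by simp
  qed
qed

text \<open>Only finitely many derivatives are needed at a time, so a power takes the place of a
  smooth cutoff: \<open>bump N\<close> is of class $C^k$ for \<open>k < N\<close>. The power also
  makes the gradient explicit: up to a constant, that of \<open>bump (Suc N)\<close> is
  \<open>y\<close> times \<open>bump N\<close>, which is what integration by parts against a radial
  derivative requires.\<close>

definition bump :: "nat \<Rightarrow> 'a::real_inner \<Rightarrow> real"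
  where "bump N y = max 0 (1 - y \<bullet> y) ^ N"

lemma bump_eq_0: "norm y \<ge> 1 \<Longrightarrow> 0 < N \<Longrightarrow> bump N y = 0"
  using power_mono[of 1 "norm y" 2] by (simp add: bump_def power2_norm_eq_inner max_def)

lemma has_derivative_max_power:
  fixes s :: real
  assumes "0 < N"
  shows "((\<lambda>s. max 0 s ^ Suc N) has_real_derivative (Suc N * max 0 s ^ N)) (at s)"
proof -
  consider "s > 0" | "s < 0" | "s = 0" by linarith
  then show ?thesis
  proof cases
    case 1
    have "((\<lambda>s. s ^ Suc N) has_real_derivative (Suc N * s ^ N)) (at s)"
      using DERIV_pow[of "Suc N" s UNIV] by simp
    then have "((\<lambda>s. max 0 s ^ Suc N) has_real_derivative (Suc N * s ^ N)) (at s)"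
      by (rule has_field_derivative_transform_within_open[where S = "{0<..}"]) (use 1 in auto)
    with 1 show ?thesis by simp
  next
    case 2
    have "((\<lambda>s. 0) has_real_derivative 0) (at s)" by simp
    then have "((\<lambda>s. max 0 s ^ Suc N) has_real_derivative 0) (at s)"
      by (rule has_field_derivative_transform_within_open[where S = "{..<0}"]) (use 2 in auto)
    with 2 assms show ?thesis by (simp add: power_0_left del: power_Suc)
  next
    case 3
    have "((\<lambda>h::real. max 0 h ^ Suc N / h) \<longlongrightarrow> 0) (at 0)"
    proof (rule Lim_null_comparison)
      show "\<forall>\<^sub>F h in at 0. norm (max 0 h ^ Suc N / h) \<le> \<bar>h\<bar> ^ N"
        by (rule always_eventually) (auto simp: max_def)
      show "((\<lambda>h::real. \<bar>h\<bar> ^ N) \<longlongrightarrow> 0) (at 0)"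
        using assms by (auto intro!: tendsto_eq_intros)
    qed
    with 3 assms show ?thesis by (simp add: DERIV_def power_0_left del: power_Suc)
  qed
qed

lemma bump_derivative:
  fixes y :: "'a::euclidean_space"
  assumes "0 < N"
  shows "bump (Suc N) differentiable (at y)"
    and "dirderiv b (bump (Suc N)) y = - 2 * real (Suc N) * (y \<bullet> b) * bump N y"
proof -
  have "((\<lambda>y. 1 - y \<bullet> y) has_derivative (\<lambda>h. - 2 * (y \<bullet> h))) (at y)"
    by (auto intro!: derivative_eq_intros simp: inner_commute)
  from has_derivative_compose[OF this has_field_derivative_imp_has_derivative[OF has_derivative_max_power[OF assms]]]
  have D: "(bump (Suc N) has_derivative (\<lambda>h. (- 2 * (y \<bullet> h)) * (Suc N * max 0 (1 - y \<bullet> y) ^ N))) (at y)"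
    by (simp add: bump_def[abs_def] mult.commute)
  show "bump (Suc N) differentiable (at y)"
    using D differentiableI by blast
  show "dirderiv b (bump (Suc N)) y = - 2 * real (Suc N) * (y \<bullet> b) * bump N y"
    using dirderiv_eq[OF D, of b] by (simp add: bump_def algebra_simps)
qed

lemma C_k_on_bump: "k < N \<Longrightarrow> C_k_on k (bump N) (UNIV :: 'a::euclidean_space set)"
proof (induction k arbitrary: N)
  case 0
  then show ?case by (auto simp: bump_def[abs_def] intro!: continuous_intros)
next
  case (Suc k)
  then obtain M where N: "N = Suc M" "k < M" by (cases N) auto
  have "dirderiv b (bump N) = (\<lambda>y::'a. (- 2 * real N) * (y \<bullet> b) * bump M y)" for b
    using bump_derivative(2)[of M] N by auto
  moreover have "C_k_on k (\<lambda>y. (- 2 * real N) * (y \<bullet> b) * bump M y) (UNIV :: 'a set)" for b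
    by (intro C_k_on_mult C_k_on_const C_k_on_inner_left Suc.IH N open_UNIV)
  ultimately show ?case
    using bump_derivative(1)[of M] N by (auto intro!: C_k_on_SucI)
qed

lemma has_integral_change_support:
  fixes f :: "'a::euclidean_space \<Rightarrow> 'b::banach"
  assumes "(f has_integral i) S" "\<And>x. x \<notin> S \<Longrightarrow> f x = 0" "\<And>x. x \<notin> T \<Longrightarrow> f x = 0"
  shows "(f has_integral i) T"
proof -
  have "(f has_integral i) UNIV"
    by (rule has_integral_on_superset[OF assms(1,2)]) auto
  also have "f = (\<lambda>x. if x \<in> T then f x else 0)"
    using assms(3) by auto
  finally show ?thesis by (simp add: has_integral_restrict_UNIV)
qed

abbreviation cube :: "real \<Rightarrow> 'a::euclidean_space set"
  where "cube r \<equiv> cbox (- (r *\<^sub>R One)) (r *\<^sub>R One)"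

lemma mem_cubeI: "norm (y - c) \<le> r \<Longrightarrow> y \<in> cbox (c - r *\<^sub>R One) (c + r *\<^sub>R One)"
  using Basis_le_norm[of _ "y - c"]
  by (force simp: mem_box inner_diff_left inner_add_left abs_le_iff)

lemma norm_le_of_mem_cube: 
  fixes y :: "'a::euclidean_space"
  assumes "y \<in> cbox (c - r *\<^sub>R One) (c + r *\<^sub>R One)"
  shows "norm (y - c) \<le> r * DIM('a)"
proof -
  have "norm (y - c) \<le> (\<Sum>b\<in>Basis. \<bar>(y - c) \<bullet> b\<bar>)" by (rule norm_le_l1)
  also have "\<dots> \<le> (\<Sum>b\<in>(Basis::'a set). r)"
    using assms by (intro sum_mono) (auto simp: mem_box inner_diff_left inner_add_left abs_le_iff algebra_simps)
  finally show ?thesis by (simp add: mult.commute)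
qed

text \<open>The integral of \<open>v (y + t *\<^sub>R b)\<close> over the cube does not change for
  small \<open>t\<close>, because the translated support stays inside; its derivative at
  \<open>t = 0\<close> is the integral in question.\<close>

lemma integral_dirderiv_compact_support:
  fixes v :: "'a::euclidean_space \<Rightarrow> 'b::banach"
  assumes C1: "C_k_on 1 v UNIV" and supp: "\<And>y. norm y \<ge> 1 \<Longrightarrow> v y = 0" and b: "b \<in> Basis"
  shows "integral (cube 2) (dirderiv b v) = 0"
proof -
  have d: "v differentiable (at x)" for x
    using C_k_on_differentiable[OF C1] by simp
  have c: "continuous_on UNIV (dirderiv b v)"
    using C1 b by (simp add: C_k_on_Suc_iff)
  have c0: "continuous_on UNIV v"
    using C_k_on_imp_continuous[OF C1] .
  have mem: "y \<in> cube 2" if "norm y \<le> 2" for y :: 'a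
    using mem_cubeI[of y 0 2] that by simp
  have const: "integral (cube 2) (\<lambda>y. v (y + t *\<^sub>R b)) = integral (cube 2) v" if t: "t \<in> {-1<..<1}" for t
  proof -
    have "(v has_integral integral (cube 2) v) (cube 2)"
      using integrable_continuous[OF continuous_on_subset[OF c0]] by blast
    from has_integral_affinity'[OF this, of 1 "t *\<^sub>R b"]
    have I: "((\<lambda>y. v (y + t *\<^sub>R b)) has_integral integral (cube 2) v)
        (cbox (- (2 *\<^sub>R One) - t *\<^sub>R b) (2 *\<^sub>R One - t *\<^sub>R b))" by simp
    show ?thesis
    proof (rule integral_unique, rule has_integral_change_support[OF I])
      fix y
      have *: "y \<in> cbox (- (2 *\<^sub>R One) - t *\<^sub>R b) (2 *\<^sub>R One - t *\<^sub>R b) \<and> y \<in> cube 2"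
        if "v (y + t *\<^sub>R b) \<noteq> 0"
      proof -
        have n: "norm (y + t *\<^sub>R b) < 1" using that supp by (meson not_less)
        have "norm y \<le> norm (y + t *\<^sub>R b) + norm (t *\<^sub>R b)"
          by (metis add_diff_cancel norm_triangle_ineq4)
        then have "y \<in> cube 2" using n t b by (intro mem) auto
        moreover have "y + t *\<^sub>R b \<in> cube 2" using n by (intro mem) simp
        then have "y \<in> cbox (- (2 *\<^sub>R One) - t *\<^sub>R b) (2 *\<^sub>R One - t *\<^sub>R b)"
          by (simp add: mem_box inner_diff_left inner_add_left algebra_simps)
        ultimately show ?thesis by blast
      qed
      show "v (y + t *\<^sub>R b) = 0" if "y \<notin> cbox (- (2 *\<^sub>R One) - t *\<^sub>R b) (2 *\<^sub>R One - t *\<^sub>R b)"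
        using * that by blast
      show "v (y + t *\<^sub>R b) = 0" if "y \<notin> cube 2"
        using * that by blast
    qed
  qed
  have "((\<lambda>t. integral (cube 2) (\<lambda>y. v (y + t *\<^sub>R b))) has_vector_derivative
      integral (cube 2) (\<lambda>y. dirderiv b v (y + 0 *\<^sub>R b))) (at 0 within {-1<..<1})"
    by (rule leibniz_rule_vector_derivative[where fx = "\<lambda>t y. dirderiv b v (y + t *\<^sub>R b)"])
      (auto simp: split_beta intro!: has_vector_derivative_line d integrable_continuous continuous_intros
        continuous_on_compose2[OF c] continuous_on_compose2[OF c0])
  then have 1: "((\<lambda>t. integral (cube 2) (\<lambda>y. v (y + t *\<^sub>R b))) has_vector_derivative
      integral (cube 2) (dirderiv b v)) (at 0 within {-1<..<1})" by simp
  have 2: "((\<lambda>t. integral (cube 2) (\<lambda>y. v (y + t *\<^sub>R b))) has_vector_derivative 0) (at 0 within {-1<..<1})"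
    by (rule has_vector_derivative_transform[OF _ _ has_vector_derivative_const]) (auto simp: const)
  show ?thesis
    by (rule vector_derivative_unique_within[OF _ 1 2]) (simp add: at_within_open[of 0 "{-1<..<1::real}"])
qed

section \<open>Harmonic functions are smooth\<close>

definition harmonic_on :: "('a::euclidean_space \<Rightarrow> 'b::real_normed_vector) \<Rightarrow> 'a set \<Rightarrow> bool"
  where "harmonic_on u U \<longleftrightarrow> C_k_on 2 u U \<and> (\<forall>x\<in>U. laplacian u x = 0)"

lemma harmonic_on_subset: "harmonic_on u U \<Longrightarrow> V \<subseteq> U \<Longrightarrow> harmonic_on u V"
  unfolding harmonic_on_def using C_k_on_subset by blast

lemma C_k_on_2D:
  assumes "C_k_on 2 u U"
  shows "x \<in> U \<Longrightarrow> u differentiable (at x)"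
    and "b \<in> Basis \<Longrightarrow> C_k_on 1 (dirderiv b u) U"
    and "b \<in> Basis \<Longrightarrow> x \<in> U \<Longrightarrow> dirderiv b u differentiable (at x)"
proof -
  have "C_k_on (Suc 1) u U" using assms by (simp add: numeral_2_eq_2)
  from C_k_on_dirderiv[OF this] show "b \<in> Basis \<Longrightarrow> C_k_on 1 (dirderiv b u) U" .
  then show "b \<in> Basis \<Longrightarrow> x \<in> U \<Longrightarrow> dirderiv b u differentiable (at x)"
    using C_k_on_differentiable by (metis zero_less_one)
qed (use C_k_on_differentiable[OF assms] in simp)

text \<open>The derivative of the mean in the radius contains \<open>bump (Suc N) y\<close> times
  \<open>y\<close>, which is a multiple of the gradient of \<open>bump (Suc (Suc N))\<close>.
  Integration by parts moves that gradient to \<open>u\<close> and leaves the Laplacian of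
  \<open>u\<close>, which is 0. So the mean at radius \<open>r\<close> equals the mean at radius
  0.\<close>

lemma harmonic_scaled_mean:
  fixes u :: "'a::euclidean_space \<Rightarrow> 'b::banach" and R r :: real
  assumes u: "harmonic_on u (ball x R)" and r: "\<bar>r\<bar> * (2 * DIM('a)) < R"
  shows "integral (cube 2) (\<lambda>y. bump (Suc N) y *\<^sub>R u (x + r *\<^sub>R y)) =
    integral (cube 2) (bump (Suc N) :: 'a \<Rightarrow> real) *\<^sub>R u x"
proof -
  \<comment> \<open>A bound for the norm on \<open>cube 2\<close>, so that
    \<open>x + t *\<^sub>R y\<close> stays in the ball for
    \<open>\<bar>t\<bar> < R / d\<close>.\<close>
  define d where "d = 2 * real DIM('a)"
  define e where "e = R / d"
  have "real DIM('a) \<ge> 1" by (simp add: Suc_leI)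
  then have d: "d \<ge> 1" unfolding d_def by linarith
  then have d0: "d > 0" by linarith
  have C2: "C_k_on 2 u (ball x R)" and lap: "\<And>y. y \<in> ball x R \<Longrightarrow> laplacian u y = 0"
    using u by (auto simp: harmonic_on_def)
  note d1 = C_k_on_2D(1)[OF C2] and C1 = C_k_on_2D(2)[OF C2] and d2 = C_k_on_2D(3)[OF C2]
  have c1: "continuous_on (ball x R) (dirderiv b u)" if "b \<in> Basis" for b
    using C_k_on_imp_continuous[OF C1[OF that]] .
  have c0: "continuous_on (ball x R) u"
    using C_k_on_imp_continuous[OF C2] .
  have cb: "continuous_on A (bump (Suc M))" for M and A :: "'a set"
    by (rule continuous_on_subset[OF C_k_on_imp_continuous[OF C_k_on_bump[of 0]]]) auto
  have inB: "x + t *\<^sub>R y \<in> ball x R" if "t \<in> {-e<..<e}" "norm y \<le> d" for t and y :: 'a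
  proof -
    have "\<bar>t\<bar> * norm y \<le> \<bar>t\<bar> * d"
      using that by (intro mult_left_mono) auto
    also have "\<dots> < R"
      using that(1) d0 pos_less_divide_eq[of d "\<bar>t\<bar>" R] by (auto simp: e_def abs_less_iff)
    finally show ?thesis by (simp add: dist_norm)
  qed
  have inB': "x + t *\<^sub>R y \<in> ball x R" if "t \<in> {-e<..<e}" "y \<in> cube 2" for t y
    using inB[OF that(1), of y] norm_le_of_mem_cube[of y 0 2] that(2) by (simp add: d_def)
  define M where "M = (\<lambda>t. integral (cube 2) (\<lambda>y. bump (Suc N) y *\<^sub>R u (x + t *\<^sub>R y)))"
  define M' where "M' = (\<lambda>t y. bump (Suc N) y *\<^sub>R (\<Sum>b\<in>Basis. (y \<bullet> b) *\<^sub>R dirderiv b u (x + t *\<^sub>R y)))"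
  have D: "(M has_vector_derivative integral (cube 2) (M' t)) (at t within {-e<..<e})" if t: "t \<in> {-e<..<e}" for t
    unfolding M_def
  proof (rule leibniz_rule_vector_derivative[OF _ _ _ t])
    fix s y assume s: "s \<in> {-e<..<e}" "y \<in> (cube 2 :: 'a set)"
    note du = d1[OF inB'[OF s]]
    show "((\<lambda>s. bump (Suc N) y *\<^sub>R u (x + s *\<^sub>R y)) has_vector_derivative M' s y) (at s within {-e<..<e})"
      using has_vector_derivative_scaleR[OF DERIV_const has_vector_derivative_line[OF du]]
      by (simp add: M'_def dirderiv_eq_sum[OF du, of y])
  next
    fix s assume s: "s \<in> {-e<..<e}"
    show "(\<lambda>y. bump (Suc N) y *\<^sub>R u (x + s *\<^sub>R y)) integrable_on cube 2"
      by (intro integrable_continuous continuous_intros cb continuous_on_compose2[OF c0])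
        (use inB'[OF s] in auto)
  next
    show "continuous_on ({-e<..<e} \<times> cube 2) (\<lambda>(t, y). M' t y)"
      unfolding M'_def split_beta
      by (intro continuous_intros continuous_on_compose2[OF c1] continuous_on_compose2[OF cb[of UNIV]])
        (use inB' in auto)
  qed simp
  have M'0: "integral (cube 2) (M' t) = 0" if t: "t \<in> {-e<..<e}" for t
  proof -
    define Y where "Y = (\<lambda>y. x + t *\<^sub>R y) -` ball x R"
    have Y: "open Y" unfolding Y_def
      by (intro open_vimage open_ball continuous_intros)
    have YI: "y \<in> Y" if "norm y \<le> d" for y
      using inB[OF t that] by (simp add: Y_def)
    have YI': "y \<in> Y" if "y \<in> cube 2" for y
      using inB'[OF t that] by (simp add: Y_def)
    have bl: "bounded_linear (\<lambda>y::'a. t *\<^sub>R y)" by (rule bounded_linear_scaleR_right)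
    \<comment> \<open>The vector field of the integration by parts, extended by 0 to points where
      \<open>u\<close> would be evaluated outside its ball. It is of class $C^1$ everywhere, because
      the kernel vanishes outside the unit ball and \<open>Y\<close> contains the ball of radius
      \<open>d\<close>, which is at least 1.\<close>
    define v where "v = (\<lambda>b y. if y \<in> Y then bump (Suc (Suc N)) y *\<^sub>R dirderiv b u (x + t *\<^sub>R y) else 0)"
    have C1v: "C_k_on 1 (v b) UNIV" if b: "b \<in> Basis" for b
    proof (rule C_k_on_local)
      fix y :: 'a
      show "\<exists>V. open V \<and> y \<in> V \<and> C_k_on 1 (v b) V"
      proof (cases "norm y > 1")
        case True
        have "open {y::'a. norm y > 1}"
          by (intro open_Collect_less continuous_intros)
        moreover from this have "C_k_on 1 (v b) {y. norm y > 1}"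
          by (rule C_k_on_cong[OF _ _ C_k_on_const[of _ 0]]) (auto simp: v_def bump_eq_0)
        ultimately show ?thesis using True by blast
      next
        case False
        have "C_k_on 1 (\<lambda>y. bump (Suc (Suc N)) y *\<^sub>R dirderiv b u (x + t *\<^sub>R y)) Y"
          by (intro C_k_on_scaleR Y C_k_on_compose_affine[OF bl Y _ C1[OF b]]
              C_k_on_subset[OF C_k_on_bump]) (auto simp: Y_def)
        then have "C_k_on 1 (v b) Y"
          by (rule C_k_on_cong[OF Y, rotated]) (auto simp: v_def)
        moreover have "y \<in> Y" using False d by (intro YI) linarith
        ultimately show ?thesis using Y by blast
      qed
    qed
    have dv: "dirderiv b (v b) y = (- 2 * real (Suc (Suc N))) *\<^sub>R (bump (Suc N) y *\<^sub>R ((y \<bullet> b) *\<^sub>R dirderiv b u (x + t *\<^sub>R y)))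
        + bump (Suc (Suc N)) y *\<^sub>R (t *\<^sub>R dirderiv b (dirderiv b u) (x + t *\<^sub>R y))"
      if b: "b \<in> Basis" and y: "y \<in> cube 2" for b y
    proof -
      have yB: "x + t *\<^sub>R y \<in> ball x R" using inB'[OF t y] .
      note A = dirderiv_compose_affine[OF bl d2[OF b yB]]
      have "dirderiv b (v b) y = dirderiv b (\<lambda>y. bump (Suc (Suc N)) y *\<^sub>R dirderiv b u (x + t *\<^sub>R y)) y"
        by (rule dirderiv_cong[OF Y YI'[OF y]]) (simp add: v_def)
      also have "\<dots> = dirderiv b (bump (Suc (Suc N))) y *\<^sub>R dirderiv b u (x + t *\<^sub>R y)
          + bump (Suc (Suc N)) y *\<^sub>R dirderiv b (\<lambda>y. dirderiv b u (x + t *\<^sub>R y)) y"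
        by (rule dirderiv_scaleR[OF bump_derivative(1) A(1)]) simp
      also have "dirderiv b (\<lambda>y. dirderiv b u (x + t *\<^sub>R y)) y = t *\<^sub>R dirderiv b (dirderiv b u) (x + t *\<^sub>R y)"
        using b by (simp add: A(2) inner_Basis if_distrib[of "\<lambda>x. x *\<^sub>R _"] if_distrib[of "\<lambda>x. _ * x"] cong: if_cong)
      finally show ?thesis by (simp add: bump_derivative(2) mult.commute mult.left_commute)
    qed
    have "(\<Sum>b\<in>Basis. integral (cube 2) (dirderiv b (v b))) = 0"
      using integral_dirderiv_compact_support[OF C1v] by (simp add: v_def bump_eq_0)
    also have "(\<Sum>b\<in>Basis. integral (cube 2) (dirderiv b (v b))) = integral (cube 2) (\<lambda>y. \<Sum>b\<in>Basis. dirderiv b (v b) y)"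
    proof (rule integral_sum[symmetric])
      fix b :: 'a assume b: "b \<in> Basis"
      have "continuous_on UNIV (dirderiv b (v b))"
        using C1v[OF b] b by (simp add: C_k_on_Suc_iff)
      then show "dirderiv b (v b) integrable_on cube 2"
        by (meson continuous_on_subset integrable_continuous subset_UNIV)
    qed simp
    also have "\<dots> = integral (cube 2) (\<lambda>y. (- 2 * real (Suc (Suc N))) *\<^sub>R M' t y)"
    proof (rule integral_cong)
      fix y :: 'a assume y: "y \<in> cube 2"
      have "(\<Sum>b\<in>Basis. dirderiv b (v b) y) = (- 2 * real (Suc (Suc N))) *\<^sub>R M' t y
          + (bump (Suc (Suc N)) y * t) *\<^sub>R laplacian u (x + t *\<^sub>R y)"
        using y by (simp add: dv sum.distrib M'_def scaleR_sum_right laplacian_dirderiv)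
      then show "(\<Sum>b\<in>Basis. dirderiv b (v b) y) = (- 2 * real (Suc (Suc N))) *\<^sub>R M' t y"
        using lap[OF inB'[OF t y]] by simp
    qed
    finally show ?thesis by simp
  qed
  have "convex {-e<..<e}" by simp
  moreover have "(M has_vector_derivative 0) (at t within {-e<..<e})" if "t \<in> {-e<..<e}" for t
    using D[OF that] M'0[OF that] by simp
  ultimately obtain c where c: "\<And>t. t \<in> {-e<..<e} \<Longrightarrow> M t = c"
    using has_vector_derivative_zero_constant by metis
  have "\<bar>r\<bar> < e" using r d0 by (simp add: e_def d_def pos_less_divide_eq)
  then have "M r = M 0" using c[of r] c[of 0] by (auto simp: abs_less_iff)
  have "(bump (Suc N) :: 'a \<Rightarrow> real) integrable_on cube 2"
    by (intro integrable_continuous cb)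
  note integral_unique[OF has_integral_scaleR_left[OF integrable_integral[OF this]], of "u x"]
  with \<open>M r = M 0\<close> show ?thesis by (simp add: M_def)
qed

text \<open>After the substitution \<open>w = x + e *\<^sub>R y\<close> the mean value formula
  writes \<open>u x\<close>, for all \<open>x\<close> near \<open>x0\<close>, as the integral of
  \<open>u\<close> over one fixed cube against a kernel of class $C^k$ in \<open>x - w\<close>. The
  exponent of the bump function is chosen according to \<open>k\<close>.\<close>

lemma harmonic_on_smooth:
  fixes u :: "'a::euclidean_space \<Rightarrow> 'b::banach"
  assumes u: "harmonic_on u U" and U: "open U"
  shows "C_k_on k u U"
proof (rule C_k_on_local)
  fix x0 assume "x0 \<in> U"
  then obtain R where R: "R > 0" "ball x0 R \<subseteq> U"
    using U open_contains_ball by blast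
  define d where "d = real DIM('a)"
  \<comment> \<open>Cubes of half side \<open>2 * e\<close> about \<open>x\<close> and
    \<open>3 * e\<close> about \<open>x0\<close> have to fit into balls of radius
    \<open>R / 2\<close> and \<open>R\<close>; a cube of half side \<open>s\<close> only fits into a
    ball of radius \<open>s * d\<close>.\<close>
  define e where "e = R / (8 * d)"
  have d: "d \<ge> 1" by (simp add: d_def Suc_leI)
  have e: "e > 0" "8 * e * d = R" using R d by (auto simp: e_def)
  have eR: "8 * e \<le> R" using e d mult_left_mono[of 1 d e] by linarith
  define c where "c = integral (cube 2) (bump (Suc k) :: 'a \<Rightarrow> real)"
  have cb: "continuous_on A (bump (Suc k))" for A :: "'a set"
    using C_k_on_imp_continuous[OF C_k_on_bump[of 0 "Suc k"]] continuous_on_subset by auto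
  have c0: "continuous_on U u"
    using u C_k_on_imp_continuous by (auto simp: harmonic_on_def)
  have "c \<noteq> 0"
  proof
    assume "c = 0"
    moreover have "(\<forall>i\<in>Basis. - (2 *\<^sub>R One) \<bullet> i < (2 *\<^sub>R One) \<bullet> (i::'a))"
      by simp
    ultimately have "\<forall>y\<in>cube 2. (bump (Suc k) :: 'a \<Rightarrow> real) y = 0"
      unfolding c_def by (subst (asm) integral_cbox_eq_0_iff[OF cb]) (auto simp: bump_def box_ne_empty)
    then have "(bump (Suc k) :: 'a \<Rightarrow> real) 0 = 0"
      using mem_cubeI[of 0 0 2] by auto
    then show False by (simp add: bump_def)
  qed
  define \<kappa> where "\<kappa> = (\<lambda>z::'a. bump (Suc k) (0 + (1 / e) *\<^sub>R z))"
  \<comment> \<open>The domain of integration must not depend on \<open>x\<close>. The kernel lives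
    within distance \<open>e\<close> of \<open>x\<close>, and \<open>x\<close> within
    \<open>e\<close> of \<open>x0\<close>, so \<open>V\<close> contains its support for every such
    \<open>x\<close>.\<close>
  define V where "V = cbox (x0 - (3 * e) *\<^sub>R One) (x0 + (3 * e) *\<^sub>R One)"
  define I where "I = (\<lambda>x. integral V (\<lambda>w. \<kappa> (x - w) *\<^sub>R u w))"
  have \<kappa>0: "\<kappa> z = 0" if "norm z \<ge> e" for z
    unfolding \<kappa>_def using that e by (intro bump_eq_0) auto
  have \<kappa>neg: "\<kappa> (- z) = \<kappa> z" for z
    by (simp add: \<kappa>_def bump_def)
  have C\<kappa>: "C_k_on k \<kappa> UNIV"
    unfolding \<kappa>_def
    by (rule C_k_on_compose_affine[OF bounded_linear_scaleR_right open_UNIV _ C_k_on_bump]) auto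
  have VU: "V \<subseteq> U"
  proof
    fix w assume "w \<in> V"
    then have "norm (w - x0) \<le> 3 * e * d"
      unfolding V_def using norm_le_of_mem_cube by (auto simp: d_def)
    then have "w \<in> ball x0 R" using e R by (simp add: dist_norm norm_minus_commute)
    then show "w \<in> U" using R by blast
  qed
  have I: "C_k_on k I UNIV"
    unfolding I_def V_def
    by (rule C_k_on_convolution[OF continuous_on_subset[OF c0] C\<kappa>]) (use VU in \<open>simp add: V_def\<close>)
  have repr: "u x = (1 / (c * e ^ DIM('a))) *\<^sub>R I x" if x: "x \<in> ball x0 e" for x
  proof -
    have xR: "ball x (R / 2) \<subseteq> ball x0 R"
    proof
      fix w assume "w \<in> ball x (R / 2)"
      then show "w \<in> ball x0 R"
        using x eR e dist_triangle[of x0 w x] by simp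
    qed
    \<comment> \<open>The image of \<open>cube 2\<close> under the substitution, where the mean
      value formula integrates.\<close>
    define W where "W = cbox (x - (2 * e) *\<^sub>R One) (x + (2 * e) *\<^sub>R One)"
    have WU: "W \<subseteq> U"
    proof
      fix w assume "w \<in> W"
      then have "norm (w - x) \<le> 2 * e * d"
        unfolding W_def using norm_le_of_mem_cube by (auto simp: d_def)
      then have "w \<in> ball x (R / 2)" using e R by (simp add: dist_norm norm_minus_commute)
      then show "w \<in> U" using xR R by blast
    qed
    define f where "f = (\<lambda>w. \<kappa> (x - w) *\<^sub>R u w)"
    have f0: "f w = 0" if "norm (w - x) \<ge> e" for w
      using \<kappa>0[of "x - w"] that by (simp add: f_def norm_minus_commute)
    have "continuous_on W f"
      unfolding f_def
      by (intro continuous_intros continuous_on_compose2[OF C_k_on_imp_continuous[OF C\<kappa>]]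
          continuous_on_subset[OF c0 WU]) auto
    then have fW: "(f has_integral integral W f) W"
      unfolding W_def by (intro integrable_integral integrable_continuous)
    have "(f has_integral integral W f) V"
    proof (rule has_integral_change_support[OF fW])
      fix w
      show "f w = 0" if "w \<notin> W"
        using mem_cubeI[of w x "2 * e"] that e f0[of w] by (force simp: W_def)
      show "f w = 0" if "w \<notin> V"
      proof (rule f0, rule ccontr)
        assume "\<not> e \<le> norm (w - x)"
        then have "norm (w - x0) \<le> 3 * e"
          using x e norm_triangle_ineq[of "w - x" "x - x0"] by (simp add: dist_norm norm_minus_commute)
        then show False using mem_cubeI that by (auto simp: V_def)
      qed
    qed
    then have If: "I x = integral W f" by (simp add: I_def f_def integral_unique)
    have "((\<lambda>y. f (e *\<^sub>R y + x)) has_integral (integral W f /\<^sub>R e ^ DIM('a)))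
        (cbox ((x - (2 * e) *\<^sub>R One - x) /\<^sub>R e) ((x + (2 * e) *\<^sub>R One - x) /\<^sub>R e))"
      using has_integral_affinity'[OF fW[unfolded W_def] e(1), of x] by (simp only: W_def)
    moreover have "cbox ((x - (2 * e) *\<^sub>R One - x) /\<^sub>R e) ((x + (2 * e) *\<^sub>R One - x) /\<^sub>R e) = cube 2"
      using e by (simp add: field_simps)
    moreover have "(\<lambda>y. f (e *\<^sub>R y + x)) = (\<lambda>y. bump (Suc k) y *\<^sub>R u (x + e *\<^sub>R y))"
    proof
      fix y
      have "\<kappa> (x - (e *\<^sub>R y + x)) = bump (Suc k) y"
        using \<kappa>neg[of "e *\<^sub>R y"] e by (simp add: \<kappa>_def)
      then show "f (e *\<^sub>R y + x) = bump (Suc k) y *\<^sub>R u (x + e *\<^sub>R y)"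
        by (simp add: f_def add.commute)
    qed
    ultimately have "integral (cube 2) (\<lambda>y. bump (Suc k) y *\<^sub>R u (x + e *\<^sub>R y)) = integral W f /\<^sub>R e ^ DIM('a)"
      by (simp add: integral_unique)
    moreover have "integral (cube 2) (\<lambda>y. bump (Suc k) y *\<^sub>R u (x + e *\<^sub>R y)) = c *\<^sub>R u x"
      unfolding c_def
    proof (rule harmonic_scaled_mean)
      show "harmonic_on u (ball x (R / 2))"
        using harmonic_on_subset[OF u] xR R by blast
      show "\<bar>e\<bar> * real (2 * DIM('a)) < R / 2"
        using R e by (simp add: d_def)
    qed
    ultimately have "c *\<^sub>R u x = I x /\<^sub>R e ^ DIM('a)" by (simp add: If)
    then have "(1 / c) *\<^sub>R c *\<^sub>R u x = (1 / c) *\<^sub>R (I x /\<^sub>R e ^ DIM('a))" by simp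
    with \<open>c \<noteq> 0\<close> show ?thesis by (simp add: divide_simps)
  qed
  have "C_k_on k (\<lambda>x. (1 / (c * e ^ DIM('a))) *\<^sub>R I x) (ball x0 e)"
    by (intro C_k_on_scaleR C_k_on_const open_ball C_k_on_subset[OF I]) auto
  then have "C_k_on k u (ball x0 e)"
    by (rule C_k_on_cong[OF open_ball, rotated]) (simp add: repr)
  then show "\<exists>V. open V \<and> x0 \<in> V \<and> C_k_on k u V"
    using e by (meson centre_in_ball open_ball)
qed

section \<open>Uniqueness of the Almansi decomposition\<close>

lemma harmonic_onD:
  assumes "harmonic_on u U"
  shows "C_k_on 2 u U" "x \<in> U \<Longrightarrow> laplacian u x = 0"
  using assms by (auto simp: harmonic_on_def)

lemma harmonic_on_cong:
  assumes "open U" "\<And>x. x \<in> U \<Longrightarrow> f x = g x" "harmonic_on f U"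
  shows "harmonic_on g U"
  using assms C_k_on_cong[of U f g] laplacian_cong[of U _ f g] by (auto simp: harmonic_on_def)

lemma laplacian_add:
  assumes "open U" "C_k_on 2 f U" "C_k_on 2 g U" "x \<in> U"
  shows "laplacian (\<lambda>x. f x + g x) x = laplacian f x + laplacian g x"
proof -
  have "dirderiv b (dirderiv b (\<lambda>x. f x + g x)) x = dirderiv b (dirderiv b f) x + dirderiv b (dirderiv b g) x"
    if b: "b \<in> Basis" for b
  proof -
    have "dirderiv b (dirderiv b (\<lambda>x. f x + g x)) x = dirderiv b (\<lambda>x. dirderiv b f x + dirderiv b g x) x"
      by (rule dirderiv_cong[OF assms(1,4)]) (simp add: dirderiv_add C_k_on_2D(1)[OF assms(2)] C_k_on_2D(1)[OF assms(3)])
    also have "\<dots> = dirderiv b (dirderiv b f) x + dirderiv b (dirderiv b g) x"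
      by (intro dirderiv_add C_k_on_2D(3)[OF assms(2)] C_k_on_2D(3)[OF assms(3)] b assms(4))
    finally show ?thesis .
  qed
  then show ?thesis by (simp add: laplacian_dirderiv sum.distrib)
qed

lemma laplacian_const [simp]: "laplacian (\<lambda>x. c) = (\<lambda>x. 0)"
  by (auto simp: laplacian_dirderiv)

lemma laplacian_sum:
  assumes "open U" "\<And>i. i \<in> I \<Longrightarrow> C_k_on 2 (f i) U" "x \<in> U"
  shows "laplacian (\<lambda>x. \<Sum>i\<in>I. f i x) x = (\<Sum>i\<in>I. laplacian (f i) x)"
  using assms(2)
proof (induction I rule: infinite_finite_induct)
  case (insert i I)
  have "laplacian (\<lambda>x. f i x + (\<Sum>i\<in>I. f i x)) x = laplacian (f i) x + laplacian (\<lambda>x. \<Sum>i\<in>I. f i x) x"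
    using insert.prems by (intro laplacian_add[OF assms(1) _ _ assms(3)] C_k_on_sum assms(1)) auto
  with insert show ?case by simp
qed auto

lemma laplacian_compose_linear:
  assumes L: "bounded_linear L" and U: "open U" and f: "C_k_on 2 f U" and x: "x \<in> U"
  shows "laplacian (\<lambda>x. L (f x)) x = L (laplacian f x)"
proof -
  have "dirderiv b (dirderiv b (\<lambda>x. L (f x))) x = L (dirderiv b (dirderiv b f) x)"
    if b: "b \<in> Basis" for b
  proof -
    have "dirderiv b (dirderiv b (\<lambda>x. L (f x))) x = dirderiv b (\<lambda>x. L (dirderiv b f x)) x"
      by (rule dirderiv_cong[OF U x]) (simp add: dirderiv_compose_linear[OF L] C_k_on_2D(1)[OF f])
    also have "\<dots> = L (dirderiv b (dirderiv b f) x)"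
      by (intro dirderiv_compose_linear[OF L] C_k_on_2D(3)[OF f] b x)
    finally show ?thesis .
  qed
  then show ?thesis
    by (simp add: laplacian_dirderiv linear_sum[OF bounded_linear.linear[OF L]])
qed

lemma laplacian_scaleR_fun:
  assumes U: "open U" and p: "C_k_on 2 p U" and f: "C_k_on 2 f U" and x: "x \<in> U"
  shows "laplacian (\<lambda>x. p x *\<^sub>R f x) x =
    laplacian p x *\<^sub>R f x + 2 *\<^sub>R (\<Sum>b\<in>Basis. dirderiv b p x *\<^sub>R dirderiv b f x) + p x *\<^sub>R laplacian f x"
proof -
  note p1 = C_k_on_2D(1)[OF p] and p2 = C_k_on_2D(3)[OF p]
  note f1 = C_k_on_2D(1)[OF f] and f2 = C_k_on_2D(3)[OF f]
  have "dirderiv b (dirderiv b (\<lambda>x. p x *\<^sub>R f x)) x =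
      dirderiv b (dirderiv b p) x *\<^sub>R f x + 2 *\<^sub>R (dirderiv b p x *\<^sub>R dirderiv b f x) + p x *\<^sub>R dirderiv b (dirderiv b f) x"
    if b: "b \<in> Basis" for b
  proof -
    have "dirderiv b (dirderiv b (\<lambda>x. p x *\<^sub>R f x)) x =
        dirderiv b (\<lambda>x. dirderiv b p x *\<^sub>R f x + p x *\<^sub>R dirderiv b f x) x"
      by (rule dirderiv_cong[OF U x]) (simp add: dirderiv_scaleR p1 f1)
    also have "\<dots> = dirderiv b (\<lambda>x. dirderiv b p x *\<^sub>R f x) x + dirderiv b (\<lambda>x. p x *\<^sub>R dirderiv b f x) x"
      by (intro dirderiv_add differentiable_scaleR p1 f1 p2 f2 x b)
    finally show ?thesis
      by (simp add: dirderiv_scaleR p1 f1 p2 f2 x b flip: scaleR_2)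
  qed
  then show ?thesis
    by (simp add: laplacian_dirderiv sum.distrib scaleR_sum_left scaleR_sum_right)
qed

lemma harmonic_on_const: "harmonic_on (\<lambda>x. c) U"
  by (simp add: harmonic_on_def C_k_on_const)

lemma harmonic_on_sum:
  assumes "open U" "\<And>i. i \<in> I \<Longrightarrow> harmonic_on (f i) U"
  shows "harmonic_on (\<lambda>x. \<Sum>i\<in>I. f i x) U"
  using assms(2) laplacian_sum[OF assms(1), of I f] C_k_on_sum[OF assms(1), of I 2 f]
  by (simp add: harmonic_on_def)

lemma harmonic_on_add:
  assumes "open U" "harmonic_on f U" "harmonic_on g U"
  shows "harmonic_on (\<lambda>x. f x + g x) U"
  using assms(2,3) laplacian_add[OF assms(1), of f g] C_k_on_add[OF assms(1), of 2 f g]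
  by (simp add: harmonic_on_def)

lemma harmonic_on_compose_linear:
  assumes "open U" "bounded_linear L" "harmonic_on f U"
  shows "harmonic_on (\<lambda>x. L (f x)) U"
  using assms(3) laplacian_compose_linear[OF assms(2,1), of f] C_k_on_compose_linear[OF assms(1,2), of 2 f]
  by (simp add: harmonic_on_def linear_0[OF bounded_linear.linear[OF assms(2)]])

lemma harmonic_on_diff:
  assumes "open U" "harmonic_on f U" "harmonic_on g U"
  shows "harmonic_on (\<lambda>x. f x - g x) U"
  using harmonic_on_add[OF assms(1,2) harmonic_on_compose_linear[OF assms(1) bounded_linear_minus[OF bounded_linear_ident] assms(3)]]
  by simp

text \<open>Derivatives commute, so that of the Laplacian can be taken last, and it is the
  derivative of 0. That \<open>dirderiv b u\<close> has class $C^2$ at all is where smoothness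
  enters.\<close>

lemma harmonic_on_dirderiv:
  fixes u :: "'a::euclidean_space \<Rightarrow> 'b::banach"
  assumes U: "open U" and u: "harmonic_on u U" and b: "b \<in> Basis"
  shows "harmonic_on (dirderiv b u) U"
proof -
  have C3: "C_k_on (Suc 2) u U" by (rule harmonic_on_smooth[OF u U])
  have C2: "C_k_on 2 u U" using u by (simp add: harmonic_on_def)
  note D = C_k_on_dirderiv[OF C3]
  have "laplacian (dirderiv b u) x = 0" if x: "x \<in> U" for x
  proof -
    have "dirderiv a (dirderiv a (dirderiv b u)) x = dirderiv b (dirderiv a (dirderiv a u)) x"
      if a: "a \<in> Basis" for a
    proof -
      have "dirderiv a (dirderiv a (dirderiv b u)) x = dirderiv a (dirderiv b (dirderiv a u)) x"
        by (rule dirderiv_cong[OF U x]) (rule dirderiv_commute[OF U C2 _ a b])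
      also have "\<dots> = dirderiv b (dirderiv a (dirderiv a u)) x"
        by (rule dirderiv_commute[OF U D[OF a] x a b])
      finally show ?thesis .
    qed
    then have "laplacian (dirderiv b u) x = (\<Sum>a\<in>Basis. dirderiv b (dirderiv a (dirderiv a u)) x)"
      by (simp add: laplacian_dirderiv)
    also have "\<dots> = (\<Sum>a\<in>Basis. frechet_derivative (dirderiv a (dirderiv a u)) (at x) b)"
      by (simp add: dirderiv_def)
    also have "\<dots> = dirderiv b (laplacian u) x"
      unfolding laplacian_dirderiv
      by (subst dirderiv_eq[OF has_derivative_sum])
         (use C_k_on_2D(2)[OF D] x in \<open>auto simp: C_k_on_Suc_iff frechet_derivative_works[symmetric]\<close>)
    also have "\<dots> = dirderiv b (\<lambda>x. 0) x"
      by (rule dirderiv_cong[OF U x]) (use u in \<open>simp add: harmonic_on_def\<close>)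
    finally show ?thesis by simp
  qed
  with D[OF b] show ?thesis by (simp add: harmonic_on_def)
qed

lemma dirderiv_inner_left [simp]: "dirderiv c (\<lambda>x. x \<bullet> b) = (\<lambda>x. c \<bullet> b)"
  by (rule dirderiv_bounded_linear[OF bounded_linear_inner_left])

lemma laplacian_inner_left [simp]: "laplacian (\<lambda>x. x \<bullet> b) = (\<lambda>x. 0)"
  by (simp add: laplacian_dirderiv)

lemma sum_Basis_inner_scaleR:
  fixes b :: "'a::euclidean_space" and g :: "'a \<Rightarrow> 'b::real_vector"
  assumes "b \<in> Basis"
  shows "(\<Sum>c\<in>Basis. (c \<bullet> b) *\<^sub>R g c) = g b" "(\<Sum>c\<in>Basis. (b \<bullet> c) *\<^sub>R g c) = g b"
proof -
  have "(\<Sum>c\<in>Basis. (c \<bullet> b) *\<^sub>R g c) = (\<Sum>c\<in>Basis. if c = b then g c else 0)"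
    using assms by (intro sum.cong) (auto simp: inner_Basis)
  also have "\<dots> = g b" using assms by simp
  finally show "(\<Sum>c\<in>Basis. (c \<bullet> b) *\<^sub>R g c) = g b" .
  then show "(\<Sum>c\<in>Basis. (b \<bullet> c) *\<^sub>R g c) = g b" by (simp add: inner_commute)
qed

lemma laplacian_inner_scaleR:
  assumes U: "open U" and u: "harmonic_on u U" and b: "b \<in> Basis" and x: "x \<in> U"
  shows "laplacian (\<lambda>x. (x \<bullet> b) *\<^sub>R u x) x = 2 *\<^sub>R dirderiv b u x"
  using laplacian_scaleR_fun[OF U C_k_on_inner_left harmonic_onD(1)[OF u] x, of b] harmonic_onD(2)[OF u x] b
  by (simp add: sum_Basis_inner_scaleR)

text \<open>Each summand \<open>(x \<bullet> b) *\<^sub>R dirderiv b u x\<close> has Laplacian twice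
  the second derivative in direction \<open>b\<close>, and these add up to twice the Laplacian of
  \<open>u\<close>.\<close>

lemma harmonic_on_euler:
  fixes u :: "'a::euclidean_space \<Rightarrow> 'b::banach"
  assumes U: "open U" and u: "harmonic_on u U"
  shows "harmonic_on (\<lambda>x. \<Sum>b\<in>Basis. (x \<bullet> b) *\<^sub>R dirderiv b u x) U"
proof -
  have C: "C_k_on 2 (\<lambda>x. (x \<bullet> b) *\<^sub>R dirderiv b u x) U" if "b \<in> Basis" for b
    using harmonic_onD(1)[OF harmonic_on_dirderiv[OF U u that]]
    by (intro C_k_on_scaleR U C_k_on_inner_left)
  have "laplacian (\<lambda>x. \<Sum>b\<in>Basis. (x \<bullet> b) *\<^sub>R dirderiv b u x) x = 0" if x: "x \<in> U" for x
  proof -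
    have "laplacian (\<lambda>x. \<Sum>b\<in>Basis. (x \<bullet> b) *\<^sub>R dirderiv b u x) x = (\<Sum>b\<in>Basis. 2 *\<^sub>R dirderiv b (dirderiv b u) x)"
      by (subst laplacian_sum[OF U C x])
        (auto intro!: sum.cong laplacian_inner_scaleR[OF U] harmonic_on_dirderiv U u x)
    also have "\<dots> = 2 *\<^sub>R laplacian u x"
      by (simp add: laplacian_dirderiv scaleR_sum_right)
    finally show ?thesis using harmonic_onD(2)[OF u x] by simp
  qed
  with C show ?thesis by (auto simp: harmonic_on_def intro!: C_k_on_sum U)
qed

lemma dirderiv_inner_self_power:
  "dirderiv b (\<lambda>x. (x \<bullet> x) ^ n) x = 2 * real n * (x \<bullet> x) ^ (n - 1) * (x \<bullet> b)"
proof -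
  have "((\<lambda>x. (x \<bullet> x) ^ n) has_derivative (\<lambda>h. real n * (2 * (x \<bullet> h)) * (x \<bullet> x) ^ (n - 1))) (at x)"
    by (auto intro!: derivative_eq_intros simp: inner_commute)
  from dirderiv_eq[OF this, of b] show ?thesis by (simp add: mult_ac)
qed

lemma laplacian_inner_self_power:
  fixes x :: "'a::euclidean_space"
  shows "laplacian (\<lambda>x. (x \<bullet> x) ^ Suc n) x = 2 * real (Suc n) * (real DIM('a) + 2 * real n) * (x \<bullet> x) ^ n"
proof -
  have sq: "(\<Sum>b\<in>Basis. (x \<bullet> b) * (x \<bullet> b)) = x \<bullet> x"
    by (rule euclidean_inner[symmetric])
  have "dirderiv b (dirderiv b (\<lambda>x. (x \<bullet> x) ^ Suc n)) x =
      2 * real (Suc n) * ((x \<bullet> x) ^ n + 2 * real n * (x \<bullet> x) ^ (n - 1) * ((x \<bullet> b) * (x \<bullet> b)))"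
    if b: "b \<in> Basis" for b
  proof -
    have "dirderiv b (dirderiv b (\<lambda>x. (x \<bullet> x) ^ Suc n)) x =
        dirderiv b (\<lambda>x. ((2 * real (Suc n)) * (x \<bullet> b)) *\<^sub>R (x \<bullet> x) ^ n) x"
      by (rule dirderiv_cong[OF open_UNIV UNIV_I]) (simp add: dirderiv_inner_self_power del: power_Suc)
    also have "\<dots> = dirderiv b (\<lambda>x. (2 * real (Suc n)) * (x \<bullet> b)) x *\<^sub>R (x \<bullet> x) ^ n
        + ((2 * real (Suc n)) * (x \<bullet> b)) *\<^sub>R dirderiv b (\<lambda>x. (x \<bullet> x) ^ n) x"
      by (intro dirderiv_scaleR C_k_on_differentiable[of 1 _ UNIV] C_k_on_mult C_k_on_const C_k_on_inner_left
          C_k_on_power C_k_on_inner_self) auto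
    also have "dirderiv b (\<lambda>x. (2 * real (Suc n)) * (x \<bullet> b)) x = 2 * real (Suc n)"
      using b dirderiv_bounded_linear[OF bounded_linear_compose[OF bounded_linear_mult_right bounded_linear_inner_left], of b "2 * real (Suc n)" b]
      by simp
    finally show ?thesis by (simp add: dirderiv_inner_self_power algebra_simps)
  qed
  then have "laplacian (\<lambda>x. (x \<bullet> x) ^ Suc n) x = (\<Sum>b\<in>Basis. 
      2 * real (Suc n) * ((x \<bullet> x) ^ n + 2 * real n * (x \<bullet> x) ^ (n - 1) * ((x \<bullet> b) * (x \<bullet> b))))"
    unfolding laplacian_dirderiv by (intro sum.cong) auto
  also have "\<dots> = 2 * real (Suc n) * (real DIM('a) * (x \<bullet> x) ^ n + 2 * real n * (x \<bullet> x) ^ (n - 1) * (x \<bullet> x))"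
    by (simp only: sum_distrib_left[symmetric] sum.distrib sq sum_constant)
  \<comment> \<open>For \<open>n = 0\<close> the exponent \<open>n - 1\<close> is truncated, but the
    factor \<open>real n\<close> makes both sides 0.\<close>
  also have "real n * (x \<bullet> x) ^ (n - 1) * (x \<bullet> x) = real n * (x \<bullet> x) ^ n"
    by (cases n) auto
  then have "2 * real n * (x \<bullet> x) ^ (n - 1) * (x \<bullet> x) = 2 * real n * (x \<bullet> x) ^ n" by simp
  finally show ?thesis by (simp add: algebra_simps)
qed

lemma laplacian_power_scaleR_harmonic:
  fixes u :: "'a::euclidean_space \<Rightarrow> 'b::real_normed_vector"
  assumes U: "open U" and u: "harmonic_on u U" and x: "x \<in> U"
  shows "laplacian (\<lambda>x. (x \<bullet> x) ^ Suc n *\<^sub>R u x) x = (x \<bullet> x) ^ n *\<^sub>R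
    ((4 * real (Suc n)) *\<^sub>R (\<Sum>b\<in>Basis. (x \<bullet> b) *\<^sub>R dirderiv b u x)
      + (2 * real (Suc n) * (real DIM('a) + 2 * real n)) *\<^sub>R u x)"
proof -
  have C: "C_k_on 2 (\<lambda>x::'a. (x \<bullet> x) ^ Suc n) U"
    by (intro C_k_on_power C_k_on_inner_self U)
  have "2 *\<^sub>R (\<Sum>b\<in>Basis. dirderiv b (\<lambda>x. (x \<bullet> x) ^ Suc n) x *\<^sub>R dirderiv b u x) =
      (x \<bullet> x) ^ n *\<^sub>R (4 * real (Suc n)) *\<^sub>R (\<Sum>b\<in>Basis. (x \<bullet> b) *\<^sub>R dirderiv b u x)"
    by (simp add: dirderiv_inner_self_power scaleR_sum_right mult_ac del: power_Suc of_nat_Suc)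
  then show ?thesis
    using laplacian_scaleR_fun[OF U C harmonic_onD(1)[OF u] x] harmonic_onD(2)[OF u x]
    by (simp add: laplacian_inner_self_power scaleR_right_distrib mult_ac del: power_Suc of_nat_Suc)
qed

text \<open>A homogeneous function of negative degree cannot be bounded near the origin.\<close>

lemma euler_eigenfunction_eq_0:
  fixes u :: "'a::euclidean_space \<Rightarrow> 'b::banach"
  assumes d: "\<And>x. x \<in> U \<Longrightarrow> u differentiable (at x)" and star: "\<And>x. x \<in> U \<Longrightarrow> closed_segment 0 x \<subseteq> U"
    and c: "c > 0" and eu: "\<And>x. x \<in> U \<Longrightarrow> (\<Sum>b\<in>Basis. (x \<bullet> b) *\<^sub>R dirderiv b u x) = - (c *\<^sub>R u x)"
    and x: "x \<in> U"
  shows "u x = 0"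
proof -
  \<comment> \<open>Along a ray \<open>u\<close> is homogeneous of degree \<open>- c\<close>, so
    this product is constant for positive \<open>t\<close>; by continuity it equals its value at 0,
    which is 0.\<close>
  define \<phi> where "\<phi> = (\<lambda>t. (t powr c) *\<^sub>R u (t *\<^sub>R x))"
  have tU: "t *\<^sub>R x \<in> U" if "t \<in> {0..1}" for t
    using star[OF x] that by (auto simp: closed_segment_def)
  have uc: "continuous_on {0..1} (\<lambda>t. u (t *\<^sub>R x))"
  proof (rule continuous_on_compose2[of U u])
    show "continuous_on U u"
      using d by (auto intro!: continuous_at_imp_continuous_on differentiable_imp_continuous_within)
  qed (use tU in \<open>auto intro!: continuous_intros\<close>)
  have cont: "continuous_on {0..1} \<phi>"
    unfolding \<phi>_def
    by (intro continuous_on_scaleR uc continuous_on_powr' continuous_intros) (use c in auto)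
  have der: "(\<phi> has_derivative (\<lambda>h. 0)) (at t within {0..1})" if t: "t \<in> {0..1} - {0}" for t
  proof -
    have t': "t > 0" using t by auto
    have du: "u differentiable (at (0 + t *\<^sub>R x))" using d tU t by simp
    have 1: "((\<lambda>t. t powr c) has_real_derivative c * t powr (c - 1)) (at t within {0..1})"
      using has_real_derivative_powr[OF t', of c] by (rule has_field_derivative_at_within)
    have 2: "((\<lambda>t. u (0 + t *\<^sub>R x)) has_vector_derivative dirderiv x u (0 + t *\<^sub>R x)) (at t within {0..1})"
      by (rule has_vector_derivative_line[OF du])
    have "t *\<^sub>R dirderiv x u (t *\<^sub>R x) = - (c *\<^sub>R u (t *\<^sub>R x))"
      using eu[OF tU[of t]] t dirderiv_eq_sum[OF du, of x] by (simp add: scaleR_sum_right)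
    then have "t powr (c - 1) *\<^sub>R t *\<^sub>R dirderiv x u (t *\<^sub>R x) = - ((c * t powr (c - 1)) *\<^sub>R u (t *\<^sub>R x))"
      by simp
    moreover have "t powr (c - 1) * t = t powr c"
      using t' by (simp add: powr_diff)
    ultimately have "t powr c *\<^sub>R dirderiv x u (0 + t *\<^sub>R x) + (c * t powr (c - 1)) *\<^sub>R u (0 + t *\<^sub>R x) = 0"
      by simp
    then have "(\<phi> has_vector_derivative 0) (at t within {0..1})"
      using has_vector_derivative_scaleR[OF 1 2] by (simp add: \<phi>_def)
    then show ?thesis by (simp add: has_vector_derivative_def)
  qed
  have "\<phi> 1 = \<phi> 0"
    by (rule has_derivative_zero_unique_strong_interval[where k = "{0}", OF _ cont refl der]) auto
  then show ?thesis using c by (simp add: \<phi>_def)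
qed

text \<open>Induction on the number of terms. The Laplacian kills \<open>h 0\<close> and lowers
  every other power of \<open>x \<bullet> x\<close> by one; the new coefficients \<open>g j\<close>
  are harmonic because Euler derivatives are, so they vanish by induction. Their vanishing is an
  Euler equation that forces \<open>h (Suc j) = 0\<close>, and then only \<open>h 0\<close> is left
  in the sum.\<close>

lemma almansi_unique_aux:
  fixes h :: "nat \<Rightarrow> 'a::euclidean_space \<Rightarrow> 'b::banach"
  assumes U: "open U" and star: "\<And>x. x \<in> U \<Longrightarrow> closed_segment 0 x \<subseteq> U"
    and h: "\<And>j. j < p \<Longrightarrow> harmonic_on (h j) U"
    and eq: "\<And>x. x \<in> U \<Longrightarrow> (\<Sum>j<p. (x \<bullet> x) ^ j *\<^sub>R h j x) = 0"
    and j: "j < p" and x: "x \<in> U"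
  shows "h j x = 0"
  using h eq j x
proof (induction p arbitrary: h j x)
  case (Suc p)
  define g where "g = (\<lambda>j x. (4 * real (Suc j)) *\<^sub>R (\<Sum>b\<in>Basis. (x \<bullet> b) *\<^sub>R dirderiv b (h (Suc j)) x)
      + (2 * real (Suc j) * (real DIM('a) + 2 * real j)) *\<^sub>R h (Suc j) x)"
  have hS: "harmonic_on (h (Suc j)) U" if "j < p" for j using Suc.prems(1) that by simp
  have g: "harmonic_on (g j) U" if "j < p" for j
    unfolding g_def
    by (intro harmonic_on_add harmonic_on_compose_linear[OF U bounded_linear_scaleR_right] U harmonic_on_euler hS that)
  have geq: "(\<Sum>j<p. (x \<bullet> x) ^ j *\<^sub>R g j x) = 0" if x: "x \<in> U" for x
  proof -
    have C: "C_k_on 2 (\<lambda>x. (x \<bullet> x) ^ Suc j *\<^sub>R h (Suc j) x) U" if "j < p" for j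
      by (intro C_k_on_scaleR U C_k_on_power C_k_on_inner_self harmonic_onD(1) hS that)
    have "(\<Sum>j<p. (x \<bullet> x) ^ j *\<^sub>R g j x) = (\<Sum>j<p. laplacian (\<lambda>x. (x \<bullet> x) ^ Suc j *\<^sub>R h (Suc j) x) x)"
      unfolding g_def by (intro sum.cong refl laplacian_power_scaleR_harmonic[symmetric, OF U hS x]) simp
    also have "\<dots> = laplacian (\<lambda>x. \<Sum>j<p. (x \<bullet> x) ^ Suc j *\<^sub>R h (Suc j) x) x"
      by (rule laplacian_sum[symmetric, OF U C x]) simp
    also have "\<dots> = laplacian (h 0) x + laplacian (\<lambda>x. \<Sum>j<p. (x \<bullet> x) ^ Suc j *\<^sub>R h (Suc j) x) x"
      using harmonic_onD(2)[OF Suc.prems(1)[of 0] x] by simp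
    also have "\<dots> = laplacian (\<lambda>x. h 0 x + (\<Sum>j<p. (x \<bullet> x) ^ Suc j *\<^sub>R h (Suc j) x)) x"
      by (rule laplacian_add[symmetric, OF U _ _ x])
        (use C harmonic_onD(1)[OF Suc.prems(1)[of 0]] in \<open>auto intro: C_k_on_sum U\<close>)
    also have "\<dots> = laplacian (\<lambda>x. 0) x"
      by (rule laplacian_cong[OF U x])
        (use Suc.prems(2) in \<open>simp add: sum.lessThan_Suc_shift del: power_Suc sum.lessThan_Suc\<close>)
    finally show ?thesis by simp
  qed
  have g0: "g j x = 0" if "j < p" "x \<in> U" for j x
    using Suc.IH[OF g geq that] .
  \<comment> \<open>The constant \<open>c\<close> is the ratio of the two coefficients in
    \<open>g j\<close>, where the common factor \<open>2 * real (Suc j)\<close> cancels. It is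
    positive because the dimension is.\<close>
  have hS0: "h (Suc j) x = 0" if j: "j < p" and x: "x \<in> U" for j x
  proof (rule euler_eigenfunction_eq_0[OF _ star _ _ x, where c = "(real DIM('a) + 2 * real j) / 2"])
    show "(h (Suc j)) differentiable (at y)" if "y \<in> U" for y
      using C_k_on_2D(1)[OF harmonic_onD(1)[OF hS[OF j]] that] .
    show "(real DIM('a) + 2 * real j) / 2 > 0"
      by (simp add: add_pos_nonneg)
    fix y assume y: "y \<in> U"
    let ?S = "\<Sum>b\<in>Basis. (y \<bullet> b) *\<^sub>R dirderiv b (h (Suc j)) y"
    have "(4 * real (Suc j)) *\<^sub>R (?S + ((real DIM('a) + 2 * real j) / 2) *\<^sub>R h (Suc j) y) = 0"
      using g0[OF j y] by (simp add: g_def scaleR_right_distrib mult.assoc del: of_nat_Suc)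
    then show "?S = - (((real DIM('a) + 2 * real j) / 2) *\<^sub>R h (Suc j) y)"
      by (simp add: eq_neg_iff_add_eq_0 del: of_nat_Suc)
  qed auto
  show ?case
  proof (cases j)
    case 0
    have "h 0 x + (\<Sum>j<p. (x \<bullet> x) ^ Suc j *\<^sub>R h (Suc j) x) = 0"
      using Suc.prems(2)[OF Suc.prems(4)] by (simp add: sum.lessThan_Suc_shift del: power_Suc sum.lessThan_Suc)
    with 0 show ?thesis by (simp add: hS0[OF _ Suc.prems(4)])
  next
    case (Suc i)
    with Suc.prems(3,4) show ?thesis by (simp add: hS0)
  qed
qed simp

lemma almansi_unique:
  fixes h :: "nat \<Rightarrow> 'a::euclidean_space \<Rightarrow> 'b::banach"
  assumes U: "open U" and star: "\<And>x. x \<in> U \<Longrightarrow> closed_segment 0 x \<subseteq> U" and J: "finite J"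
    and h: "\<And>j. j \<in> J \<Longrightarrow> harmonic_on (h j) U"
    and eq: "\<And>x. x \<in> U \<Longrightarrow> (\<Sum>j\<in>J. norm x ^ (2 * j) *\<^sub>R h j x) = 0"
    and j: "j \<in> J" and x: "x \<in> U"
  shows "h j x = 0"
proof -
  obtain p where p: "J \<subseteq> {..<p}" using J finite_nat_bounded by blast
  define h' where "h' = (\<lambda>j. if j \<in> J then h j else (\<lambda>x. 0))"
  have "h' j x = 0"
  proof (rule almansi_unique_aux[OF U star, of p h'])
    fix x assume "x \<in> U"
    have "(\<Sum>j<p. (x \<bullet> x) ^ j *\<^sub>R h' j x) = (\<Sum>j\<in>J. (x \<bullet> x) ^ j *\<^sub>R h' j x)"
      by (rule sum.mono_neutral_right) (use p in \<open>auto simp: h'_def\<close>)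
    also have "\<dots> = (\<Sum>j\<in>J. norm x ^ (2 * j) *\<^sub>R h j x)"
      by (simp add: h'_def power_mult power2_norm_eq_inner)
    finally show "(\<Sum>j<p. (x \<bullet> x) ^ j *\<^sub>R h' j x) = 0" using eq[OF \<open>x \<in> U\<close>] by simp
  qed (use p j x h in \<open>auto simp: h'_def harmonic_on_const\<close>)
  with j show ?thesis by (simp add: h'_def)
qed

section \<open>Invariance of harmonicity under orthogonal transformations\<close>

lemma sum_orthogonal_transformation_Basis:
  fixes \<rho> :: "'a::euclidean_space \<Rightarrow> 'a"
  assumes "orthogonal_transformation \<rho>"
  shows "(\<Sum>b\<in>Basis. (\<rho> b \<bullet> c) * (\<rho> b \<bullet> e)) = c \<bullet> e"
proof -
  have lin: "linear \<rho>" using assms by (rule orthogonal_transformation_linear)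
  obtain c' where c: "c = \<rho> c'"
    using orthogonal_transformation_surj[OF assms] by (metis surj_def)
  have "c \<bullet> e = \<rho> (\<Sum>b\<in>Basis. (c' \<bullet> b) *\<^sub>R b) \<bullet> e"
    by (simp add: c euclidean_representation)
  also have "\<dots> = (\<Sum>b\<in>Basis. (c' \<bullet> b) * (\<rho> b \<bullet> e))"
    by (simp add: linear_sum[OF lin] linear_cmul[OF lin] inner_sum_left)
  also have "\<dots> = (\<Sum>b\<in>Basis. (\<rho> b \<bullet> c) * (\<rho> b \<bullet> e))"
    using assms by (simp add: c orthogonal_transformation_def inner_commute)
  finally show ?thesis by simp
qed

text \<open>The Hessian is contracted with the orthonormal basis of the images
  \<open>\<rho> b\<close> instead of the standard one, which does not change its trace. Exchanging
  the imaginary unit of a variable for another one will be such a rotation.\<close>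

lemma harmonic_on_orthogonal:
  fixes u :: "'a::euclidean_space \<Rightarrow> 'b::real_normed_vector" and \<rho> :: "'a \<Rightarrow> 'a"
  assumes \<rho>: "orthogonal_transformation \<rho>" and U: "open U" and V: "\<rho> ` U \<subseteq> V" and u: "harmonic_on u V"
  shows "harmonic_on (\<lambda>x. u (\<rho> x)) U"
proof -
  have bl: "bounded_linear \<rho>"
    using orthogonal_transformation_linear[OF \<rho>] by (rule linear_conv_bounded_linear[THEN iffD1])
  note C2 = harmonic_onD(1)[OF u]
  note A = dirderiv_compose_affine[OF bl, where a = 0, simplified]
  have "laplacian (\<lambda>x. u (\<rho> x)) x = 0" if x: "x \<in> U" for x
  proof -
    have \<rho>x: "\<rho> y \<in> V" if "y \<in> U" for y using V that by blast
    have "dirderiv b (dirderiv b (\<lambda>x. u (\<rho> x))) x =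
        (\<Sum>c\<in>Basis. \<Sum>e\<in>Basis. ((\<rho> b \<bullet> c) * (\<rho> b \<bullet> e)) *\<^sub>R dirderiv e (dirderiv c u) (\<rho> x))" for b
    proof -
      have "dirderiv b (dirderiv b (\<lambda>x. u (\<rho> x))) x = dirderiv b (\<lambda>x. \<Sum>c\<in>Basis. (\<rho> b \<bullet> c) *\<^sub>R dirderiv c u (\<rho> x)) x"
        by (rule dirderiv_cong[OF U x]) (simp add: A(2) C_k_on_2D(1)[OF C2] \<rho>x)
      also have "\<dots> = (\<Sum>c\<in>Basis. (\<rho> b \<bullet> c) *\<^sub>R dirderiv b (\<lambda>x. dirderiv c u (\<rho> x)) x)"
      proof (subst dirderiv_eq[OF has_derivative_sum])
        fix c :: 'a assume c: "c \<in> Basis"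
        show "((\<lambda>x. (\<rho> b \<bullet> c) *\<^sub>R dirderiv c u (\<rho> x)) has_derivative
            (\<lambda>h. (\<rho> b \<bullet> c) *\<^sub>R dirderiv h (\<lambda>x. dirderiv c u (\<rho> x)) x)) (at x)"
          using A(1)[OF C_k_on_2D(3)[OF C2 c \<rho>x[OF x]]] unfolding frechet_derivative_works
          by (auto simp: dirderiv_def intro!: derivative_eq_intros)
      qed simp
      finally show ?thesis
        by (simp add: A(2) C_k_on_2D(3)[OF C2] \<rho>x x scaleR_sum_right)
    qed
    then have "laplacian (\<lambda>x. u (\<rho> x)) x =
        (\<Sum>b\<in>Basis. \<Sum>c\<in>Basis. \<Sum>e\<in>Basis. ((\<rho> b \<bullet> c) * (\<rho> b \<bullet> e)) *\<^sub>R dirderiv e (dirderiv c u) (\<rho> x))"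
      by (simp add: laplacian_dirderiv)
    also have "\<dots> = (\<Sum>c\<in>Basis. \<Sum>b\<in>Basis. \<Sum>e\<in>Basis. ((\<rho> b \<bullet> c) * (\<rho> b \<bullet> e)) *\<^sub>R dirderiv e (dirderiv c u) (\<rho> x))"
      by (rule sum.swap)
    also have "\<dots> = (\<Sum>c\<in>Basis. \<Sum>e\<in>Basis. \<Sum>b\<in>Basis. ((\<rho> b \<bullet> c) * (\<rho> b \<bullet> e)) *\<^sub>R dirderiv e (dirderiv c u) (\<rho> x))"
      by (intro sum.cong refl sum.swap)
    also have "\<dots> = (\<Sum>c\<in>Basis. \<Sum>e\<in>Basis. (c \<bullet> e) *\<^sub>R dirderiv e (dirderiv c u) (\<rho> x))"
      by (simp add: sum_orthogonal_transformation_Basis[OF \<rho>] flip: scaleR_sum_left)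
    also have "\<dots> = laplacian u (\<rho> x)"
      by (simp add: laplacian_dirderiv sum_Basis_inner_scaleR)
    finally show ?thesis using harmonic_onD(2)[OF u \<rho>x[OF x]] by simp
  qed
  moreover have "C_k_on 2 (\<lambda>x. u (0 + \<rho> x)) U"
    by (rule C_k_on_compose_affine[OF bl U _ C2]) (use V in auto)
  ultimately show ?thesis by (simp add: harmonic_on_def)
qed

section \<open>Biharmonic functions\<close>

definition biharmonic_on :: "('a::euclidean_space \<Rightarrow> 'b::real_normed_vector) \<Rightarrow> 'a set \<Rightarrow> bool"
  where "biharmonic_on u U \<longleftrightarrow> C_k_on 4 u U \<and> (\<forall>x\<in>U. laplacian (laplacian u) x = 0)"

lemma biharmonic_on_cong:
  assumes "open U" "\<And>x. x \<in> U \<Longrightarrow> f x = g x" "biharmonic_on f U"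
  shows "biharmonic_on g U"
proof -
  have "laplacian f x = laplacian g x" if "x \<in> U" for x
    using laplacian_cong[of U x f g] assms that by blast
  then have "laplacian (laplacian f) x = laplacian (laplacian g) x" if "x \<in> U" for x
    using laplacian_cong[of U x "laplacian f" "laplacian g"] assms that by blast
  then show ?thesis
    using assms C_k_on_cong[of U f g] by (simp add: biharmonic_on_def)
qed

lemma biharmonic_on_sum:
  assumes U: "open U" and f: "\<And>i. i \<in> I \<Longrightarrow> biharmonic_on (f i) U"
  shows "biharmonic_on (\<lambda>x. \<Sum>i\<in>I. f i x) U"
proof -
  have C4: "C_k_on 4 (f i) U" if "i \<in> I" for i using f that by (simp add: biharmonic_on_def)
  have C2: "C_k_on 2 (f i) U" if "i \<in> I" for i using C_k_on_le[OF C4[OF that]] by simp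
  have Cl: "C_k_on 2 (laplacian (f i)) U" if "i \<in> I" for i
    using C4[OF that] unfolding laplacian_dirderiv
    by (intro C_k_on_sum U C_k_on_dirderiv) (simp_all add: eval_nat_numeral)
  have "laplacian (laplacian (\<lambda>x. \<Sum>i\<in>I. f i x)) x = laplacian (\<lambda>x. \<Sum>i\<in>I. laplacian (f i) x) x" if "x \<in> U" for x
    by (rule laplacian_cong[OF U that]) (rule laplacian_sum[OF U C2])
  then have "laplacian (laplacian (\<lambda>x. \<Sum>i\<in>I. f i x)) x = 0" if "x \<in> U" for x
    using that laplacian_sum[OF U, of I "\<lambda>i. laplacian (f i)", OF Cl that] f by (simp add: biharmonic_on_def)
  then show ?thesis
    using C4 by (auto simp: biharmonic_on_def intro: C_k_on_sum U)
qed

lemma biharmonic_on_harmonic: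
  fixes u :: "'a::euclidean_space \<Rightarrow> 'b::banach"
  assumes "open U" "harmonic_on u U"
  shows "biharmonic_on u U"
proof -
  have "laplacian (laplacian u) x = 0" if "x \<in> U" for x
    using laplacian_cong[OF assms(1) that, of "laplacian u" "\<lambda>x. 0"] harmonic_onD(2)[OF assms(2)] by simp
  then show ?thesis
    using harmonic_on_smooth[OF assms(2,1)] by (simp add: biharmonic_on_def)
qed

text \<open>The Laplacian of the product is twice \<open>dirderiv b u\<close>, a harmonic
  function.\<close>

lemma biharmonic_on_inner_scaleR:
  fixes u :: "'a::euclidean_space \<Rightarrow> 'b::banach"
  assumes U: "open U" and u: "harmonic_on u U" and b: "b \<in> Basis"
  shows "biharmonic_on (\<lambda>x. (x \<bullet> b) *\<^sub>R u x) U"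
proof -
  have d: "harmonic_on (\<lambda>x. 2 *\<^sub>R dirderiv b u x) U"
    by (intro harmonic_on_compose_linear[OF U bounded_linear_scaleR_right] harmonic_on_dirderiv U u b)
  have "laplacian (laplacian (\<lambda>x. (x \<bullet> b) *\<^sub>R u x)) x = 0" if x: "x \<in> U" for x
    using laplacian_cong[OF U x laplacian_inner_scaleR[OF U u b]] harmonic_onD(2)[OF d x] by simp
  moreover have "C_k_on 4 (\<lambda>x. (x \<bullet> b) *\<^sub>R u x) U"
    by (intro C_k_on_scaleR C_k_on_inner_left U harmonic_on_smooth[OF u U])
  ultimately show ?thesis by (simp add: biharmonic_on_def)
qed

section \<open>The Clifford algebra\<close>

lemma prod_sign_eq:
  assumes "finite S"
  shows "(\<Prod>x\<in>S. if P x then -1 else 1 :: real) = (-1) ^ card {x \<in> S. P x}"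
proof -
  have "(\<Prod>x\<in>S. if P x then -1 else 1 :: real) = (\<Prod>x\<in>{x\<in>S. P x}. -1)"
    using assms by (intro prod.mono_neutral_cong_right) auto
  then show ?thesis by simp
qed

text \<open>Common elements contribute squares of signs. Both the Clifford signs and the characters
  \<open>chr\<close> are multiplicative for this reason.\<close>

lemma prod_sym_diff_sign:
  fixes g :: "'a \<Rightarrow> real"
  assumes "finite A" "finite B" "\<And>x. g x * g x = 1"
  shows "prod g (sym_diff A B) = prod g A * prod g B"
proof -
  have "prod g A = prod g (A - B) * prod g (A \<inter> B)" "prod g B = prod g (B - A) * prod g (A \<inter> B)"
    using prod.Int_Diff[OF assms(1), of g B] prod.Int_Diff[OF assms(2), of g A]
    by (simp_all add: Int_commute mult.commute)
  moreover have "prod g (A \<inter> B) * prod g (A \<inter> B) = 1"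
    by (simp add: assms(3) flip: prod.distrib)
  moreover have "prod g (sym_diff A B) = prod g (A - B) * prod g (B - A)"
    using assms by (intro prod.union_disjoint) auto
  ultimately show ?thesis by (simp add: mult_ac)
qed

text \<open>The inversions \<open>b < a\<close> and the repeated generators \<open>b = a\<close>
  together are the pairs with \<open>b \<le> a\<close>. In this form the sign is visibly a product
  over all pairs, hence multiplicative in each argument separately.\<close>

lemma clifford_sign_prod:
  "clifford_sign A B = (\<Prod>a\<in>A. \<Prod>b\<in>B. if b \<le> a then -1 else 1)"
proof -
  have "{(a, b) \<in> A \<times> B. b \<le> a} = {(a, b) \<in> A \<times> B. b < a} \<union> (\<lambda>a. (a, a)) ` (A \<inter> B)"
    by auto
  moreover have "card ({(a, b) \<in> A \<times> B. b < a} \<union> (\<lambda>a. (a, a)) ` (A \<inter> B)) =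
      card {(a, b) \<in> A \<times> B. b < a} + card (A \<inter> B)"
    by (subst card_Un_disjoint) (auto simp: card_image inj_on_def)
  moreover have "{p \<in> A \<times> B. snd p \<le> fst p} = {(a, b) \<in> A \<times> B. b \<le> a}"
    by auto
  ultimately have "clifford_sign A B = (-1) ^ card {p \<in> A \<times> B. snd p \<le> fst p}"
    by (simp only: clifford_sign_def)
  also have "\<dots> = (\<Prod>p\<in>A \<times> B. if snd p \<le> fst p then -1 else 1)"
    by (rule prod_sign_eq[symmetric]) simp
  finally show ?thesis
    by (simp add: prod.cartesian_product case_prod_beta)
qed

lemma clifford_sign_sym_diff:
  "clifford_sign (sym_diff A B) C = clifford_sign A C * clifford_sign B C"
  "clifford_sign A (sym_diff B C) = clifford_sign A B * clifford_sign A C"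
proof -
  show "clifford_sign (sym_diff A B) C = clifford_sign A C * clifford_sign B C"
    unfolding clifford_sign_prod by (rule prod_sym_diff_sign) (auto simp flip: prod.distrib intro!: prod.neutral)
  have "(\<Prod>b\<in>sym_diff B C. if b \<le> a then -1 else 1 :: real) =
      (\<Prod>b\<in>B. if b \<le> a then -1 else 1) * (\<Prod>b\<in>C. if b \<le> a then -1 else 1)" for a
    by (rule prod_sym_diff_sign) auto
  then show "clifford_sign A (sym_diff B C) = clifford_sign A B * clifford_sign A C"
    unfolding clifford_sign_prod by (simp add: prod.distrib)
qed

lemma bounded_bilinear_clifford: "bounded_bilinear ((\<star>) :: 'm::{finite,linorder} clifford \<Rightarrow> _)"
proof -
  have "bilinear ((\<star>) :: 'm clifford \<Rightarrow> _)"
    unfolding bilinear_def clifford_mult_def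
    by (intro conjI allI linearI)
      (simp_all add: sum.distrib scaleR_sum_right algebra_simps)
  then show ?thesis by (simp add: bilinear_conv_bounded_bilinear)
qed

interpretation clifford: bounded_bilinear "(\<star>) :: 'm::{finite,linorder} clifford \<Rightarrow> _"
  by (rule bounded_bilinear_clifford)

lemma clifford_expand: "a = (\<Sum>A\<in>UNIV. (a $ A) *\<^sub>R axis A 1)" for a :: "'m::finite clifford"
  by (simp add: vec_eq_iff axis_def if_distrib cong: if_cong)

text \<open>On basis elements the sign is a bicharacter for the symmetric difference, so both
  bracketings carry the product of the signs of the three pairs (A,B), (A,C), (B,C).\<close>

lemma clifford_mult_assoc: "(a \<star> b) \<star> c = a \<star> (b \<star> c)"
proof -
  have axes: "(axis A 1 \<star> axis B 1) \<star> axis C 1 = axis A 1 \<star> (axis B 1 \<star> axis C 1)" for A B C :: "'a set"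
  proof -
    have "sym_diff (sym_diff A B) C = sym_diff A (sym_diff B C)" by auto
    then show ?thesis
      by (simp add: clifford_mult_axis clifford.scaleR_left clifford.scaleR_right
          clifford_sign_sym_diff mult_ac del: Un_iff)
  qed
  show ?thesis
    by (subst (1 2) clifford_expand[of a], subst (1 2) clifford_expand[of b], subst (1 2) clifford_expand[of c])
      (simp add: clifford.sum_left clifford.sum_right clifford.scaleR_left clifford.scaleR_right axes)
qed

lemma clifford_mult_one: "a \<star> clifford_one = a"
proof -
  have "axis A 1 \<star> clifford_one = axis A 1" for A :: "'a set"
    by (simp add: clifford_one_def clifford_mult_axis clifford_sign_prod)
  then show ?thesis
    by (subst (1 2) clifford_expand[of a]) (simp add: clifford.sum_left clifford.scaleR_left)
qed

lemma linear_of_paravector: "linear of_paravector"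
  unfolding of_paravector_def
  by (intro linearI) (simp_all add: algebra_simps sum.distrib scaleR_sum_right)

lemma bounded_linear_of_paravector: "bounded_linear of_paravector"
  using linear_of_paravector linear_conv_bounded_linear by blast

lemmas of_paravector_simps = linear_0[OF linear_of_paravector] linear_cmul[OF linear_of_paravector]
  linear_neg[OF linear_of_paravector]

text \<open>Symmetrising the double sum leaves only anticommutators of generators, and these vanish
  off the diagonal.\<close>

lemma of_paravector_square:
  assumes "fst v = 0"
  shows "of_paravector v \<star> of_paravector v = - ((\<Sum>i\<in>UNIV. (snd v $ i)\<^sup>2) *\<^sub>R clifford_one)"
proof -
  define X where "X = of_paravector v \<star> of_paravector v"
  have X: "X = (\<Sum>i\<in>UNIV. \<Sum>j\<in>UNIV. (snd v $ i * snd v $ j) *\<^sub>R (clifford_gen j \<star> clifford_gen i))"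
    unfolding X_def of_paravector_def
    by (simp add: assms clifford.sum_left clifford.sum_right clifford.scaleR_left clifford.scaleR_right scaleR_sum_right)
  also have "\<dots> = (\<Sum>i\<in>UNIV. \<Sum>j\<in>UNIV. (snd v $ i * snd v $ j) *\<^sub>R (clifford_gen i \<star> clifford_gen j))"
    by (subst sum.swap) (simp add: mult.commute)
  finally have "2 *\<^sub>R X = (\<Sum>i\<in>UNIV. \<Sum>j\<in>UNIV. (snd v $ i * snd v $ j) *\<^sub>R
      (clifford_gen j \<star> clifford_gen i + clifford_gen i \<star> clifford_gen j))"
    using X by (simp add: scaleR_2 scaleR_right_distrib sum.distrib)
  also have "\<dots> = (\<Sum>i\<in>UNIV. \<Sum>j\<in>UNIV. if i = j then (- 2 * (snd v $ i)\<^sup>2) *\<^sub>R clifford_one else 0)"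
    unfolding clifford_relations by (intro sum.cong refl) (simp add: power2_eq_square)
  also have "\<dots> = 2 *\<^sub>R (- ((\<Sum>i\<in>UNIV. (snd v $ i)\<^sup>2) *\<^sub>R clifford_one))"
    by (simp add: scaleR_sum_left scaleR_sum_right sum_negf)
  finally show ?thesis
    unfolding X_def by (rule scaleR_left_imp_eq[rotated]) simp
qed

lemma imag_sphere_mult_mult:
  "J \<in> imag_sphere \<Longrightarrow> of_paravector J \<star> (of_paravector J \<star> a) = - a"
  using of_paravector_square[of J]
  by (simp add: imag_sphere_def clifford_mult_assoc[symmetric] clifford.minus_left clifford_one_mult)

lemma imag_sphere_iff: "J \<in> imag_sphere \<longleftrightarrow> fst J = 0 \<and> norm (snd J) = 1"
  by (simp add: imag_sphere_def norm_vec_def L2_set_def)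

lemma imag_sphere_nonempty: "(imag_sphere :: 'm::{finite,linorder} paravector set) \<noteq> {}"
proof -
  have "(0, axis undefined 1) \<in> (imag_sphere :: 'm paravector set)"
    by (simp add: imag_sphere_iff norm_axis_1)
  then show ?thesis by blast
qed

section \<open>Iterated left multiplication by imaginary units\<close>

lemma bracket_empty [simp]: "bracket J {} a = a"
  by (simp add: bracket_def)

lemma bracket_cong: "(\<And>l. l \<in> K \<Longrightarrow> J l = J' l) \<Longrightarrow> bracket J K a = bracket J' K a"
  unfolding bracket_def by (rule foldr_cong) auto

lemma bracket_insert_less:
  "(\<And>l. l \<in> K \<Longrightarrow> k < l) \<Longrightarrow> bracket J (insert k K) a = of_paravector (J k) \<star> bracket J K a"
proof -
  assume *: "\<And>l. l \<in> K \<Longrightarrow> k < l"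
  then have "k \<notin> K" by blast
  then have "sorted_list_of_set (insert k K) = k # sorted_list_of_set K"
    using * by (subst sorted_list_of_set_insert_remove) (auto simp: less_imp_le intro!: insort_is_Cons)
  then show ?thesis by (simp add: bracket_def)
qed

lemma linear_bracket: "linear (bracket J K)"
proof -
  have "linear (\<lambda>a. foldr (\<lambda>k b. of_paravector (J k) \<star> b) ks a)" for ks
  proof (induction ks)
    case (Cons k ks)
    then show ?case
      using linear_compose[OF Cons bounded_linear.linear[OF clifford.bounded_linear_right[of "of_paravector (J k)"]]]
      by (simp add: o_def)
  qed (simp add: linear_id[unfolded id_def] linear_ident)
  then show ?thesis by (simp add: bracket_def[abs_def])
qed

lemma bounded_linear_bracket: "bounded_linear (bracket J K)"
  using linear_bracket linear_conv_bounded_linear by blast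

lemmas bracket_simps = linear_0[OF linear_bracket] linear_cmul[OF linear_bracket]
  linear_add[OF linear_bracket] linear_diff[OF linear_bracket] linear_sum[OF linear_bracket]

lemma foldr_clifford_scaleR:
  "foldr (\<lambda>k b. of_paravector (c k *\<^sub>R J k) \<star> b) ks a =
    prod_list (map c ks) *\<^sub>R foldr (\<lambda>k b. of_paravector (J k) \<star> b) ks a"
  by (induction ks) (simp_all add: of_paravector_simps clifford.scaleR_left clifford.scaleR_right)

lemma bracket_scaleR:
  "bracket (\<lambda>l. c l *\<^sub>R J l) K a = (\<Prod>l\<in>K. c l) *\<^sub>R bracket J K a"
proof -
  have "prod_list (map c (sorted_list_of_set K)) = (\<Prod>l\<in>K. c l)"
    by (subst prod.distinct_set_conv_list[symmetric]) auto
  then show ?thesis by (simp add: bracket_def foldr_clifford_scaleR)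
qed

text \<open>Every index of \<open>K\<close> occurs exactly once in the iterated product. The
  linearity will turn the unit of one variable into real coordinates of that variable.\<close>

lemma linear_bracket_update:
  assumes "g \<in> K"
  shows "linear (\<lambda>w. bracket (J(g := w)) K a)"
proof -
  have "linear (\<lambda>w. foldr (\<lambda>k b. of_paravector ((J(g := w)) k) \<star> b) ks a)"
    if "distinct ks" "g \<in> set ks" for ks
    using that
  proof (induction ks)
    case (Cons k ks)
    show ?case
    proof (cases "k = g")
      case True
      with Cons.prems have "g \<notin> set ks" by simp
      then have *: "foldr (\<lambda>k b. of_paravector ((J(g := w)) k) \<star> b) ks a =
          foldr (\<lambda>k b. of_paravector (J k) \<star> b) ks a" for w
        by (intro foldr_cong) auto
      have "linear (\<lambda>w. of_paravector w \<star> foldr (\<lambda>k b. of_paravector (J k) \<star> b) ks a)"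
        by (rule linear_compose[OF linear_of_paravector bounded_linear.linear[OF clifford.bounded_linear_left], unfolded o_def])
      with True show ?thesis by (simp only: foldr.simps o_def * fun_upd_same)
    next
      case False
      with Cons have "linear (\<lambda>w. foldr (\<lambda>k b. of_paravector ((J(g := w)) k) \<star> b) ks a)" by simp
      from linear_compose[OF this bounded_linear.linear[OF clifford.bounded_linear_right[of "of_paravector (J k)"]]]
      show ?thesis using False by (simp add: o_def)
    qed
  qed simp
  from this[of "sorted_list_of_set K"] assms show ?thesis by (simp add: bracket_def)
qed

text \<open>The point is that \<open>M\<close> does not depend on \<open>J\<close>: near real points
  the imaginary units do not converge, and only a uniform bound is available.\<close>

lemma norm_bracket_le:
  "\<exists>M. \<forall>(J :: 'n::{finite,linorder} \<Rightarrow> 'm::{finite,linorder} paravector) a. (\<forall>l. norm (J l) \<le> 1) \<longrightarrow> norm (bracket J K a) \<le> M * norm a"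
proof -
  obtain C where C: "\<And>w::'m paravector. norm (of_paravector w) \<le> norm w * C" "C \<ge> 0"
    using bounded_linear.nonneg_bounded[OF bounded_linear_of_paravector] by blast
  obtain D where D: "\<And>a b::'m clifford. norm (a \<star> b) \<le> norm a * norm b * D" "D \<ge> 0"
    using clifford.nonneg_bounded by blast
  have "norm (foldr (\<lambda>k b. of_paravector (J k) \<star> b) ks a) \<le> (C * D) ^ length ks * norm a"
    if J: "\<forall>l. norm (J l) \<le> 1" for J :: "'n \<Rightarrow> 'm paravector" and a ks
  proof (induction ks)
    case (Cons k ks)
    let ?b = "foldr (\<lambda>k b. of_paravector (J k) \<star> b) ks a"
    have "norm (of_paravector (J k) \<star> ?b) \<le> norm (of_paravector (J k)) * norm ?b * D" by (rule D)
    also have "\<dots> \<le> C * ((C * D) ^ length ks * norm a) * D"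
    proof (intro mult_right_mono mult_mono Cons.IH)
      show "norm (of_paravector (J k)) \<le> C"
        using C(1)[of "J k"] mult_right_mono[OF spec[OF J, of k] C(2)] by simp
    qed (use C D in auto)
    finally show ?case by (simp add: mult_ac)
  qed simp
  then show ?thesis unfolding bracket_def by blast
qed

text \<open>Since \<open>J k\<close> squares to -1, each factor is undone by multiplication with
  \<open>- J k\<close>; \<open>foldl\<close> strips the outermost factor first. The map is linear
  whatever \<open>J\<close> is, so it preserves harmonicity.\<close>

definition inverse_bracket ::
    "('n::{finite,linorder} \<Rightarrow> 'm::{finite,linorder} paravector) \<Rightarrow> 'n set \<Rightarrow> 'm clifford \<Rightarrow> 'm clifford"
  where "inverse_bracket J K a = foldl (\<lambda>b k. - (of_paravector (J k) \<star> b)) a (sorted_list_of_set K)"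

lemma linear_inverse_bracket: "linear (inverse_bracket J K)"
proof -
  have "linear (\<lambda>a. foldl (\<lambda>b k. - (of_paravector (J k) \<star> b)) (L a) ks)" if "linear L" for L ks
    using that
  proof (induction ks arbitrary: L)
    case (Cons k ks)
    have "linear (\<lambda>a. - (of_paravector (J k) \<star> L a))"
      using linear_compose[OF Cons.prems bounded_linear.linear[OF bounded_linear_minus[OF clifford.bounded_linear_right[of "of_paravector (J k)"]]]]
      by (simp add: o_def)
    from Cons.IH[OF this] show ?case by simp
  qed simp
  from this[OF linear_ident] show ?thesis by (simp add: inverse_bracket_def[abs_def])
qed

lemma bounded_linear_inverse_bracket: "bounded_linear (inverse_bracket J K)"
  using linear_inverse_bracket linear_conv_bounded_linear by blast

lemma inverse_bracket_bracket:
  assumes "\<And>l. J l \<in> imag_sphere"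
  shows "inverse_bracket J K (bracket J K a) = a"
proof -
  have "foldl (\<lambda>b k. - (of_paravector (J k) \<star> b)) (foldr (\<lambda>k b. of_paravector (J k) \<star> b) ks a) ks = a" for ks
    by (induction ks) (simp_all add: imag_sphere_mult_mult assms)
  then show ?thesis by (simp add: bracket_def inverse_bracket_def)
qed

section \<open>Slice functions and their stem functions\<close>

text \<open>The signs \<open>chr S K\<close>, for \<open>S\<close> ranging over all sets of variables, are the characters of
  $(\mathbb{Z}/2)^n$; averaging against them separates the components of a slice function.\<close>

definition chr :: "'n set \<Rightarrow> 'n set \<Rightarrow> real"
  where "chr S K = (-1) ^ card (S \<inter> K)"

lemma chr_prod: "finite S \<Longrightarrow> chr S K = (\<Prod>l\<in>S. if l \<in> K then -1 else 1)"
  by (simp add: chr_def prod_sign_eq Collect_conj_eq)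

lemma chr_commute: "chr S K = chr K S"
  by (simp add: chr_def Int_commute)

lemma chr_mult_self: "chr S K * chr S K = 1"
  by (simp add: chr_def flip: power_add mult_2)

lemma chr_sym_diff:
  fixes S :: "'n::finite set"
  shows "chr S (sym_diff K L) = chr S K * chr S L"
proof -
  have "chr (sym_diff K L) S = chr K S * chr L S"
    unfolding chr_prod[OF finite] by (rule prod_sym_diff_sign) auto
  then show ?thesis by (metis chr_commute)
qed

lemma chr_singleton: "chr {h} K = (if h \<in> K then -1 else 1)"
  by (simp add: chr_def)

text \<open>Expanding a product over all \<open>l\<close> of 1 plus the product of the two signs at
  \<open>l\<close> gives this sum. A factor is 0 as soon as \<open>K\<close> and \<open>L\<close>
  differ at some \<open>l\<close>; otherwise every factor is 2.\<close>

lemma sum_chr_mult: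
  fixes K L :: "'n::finite set"
  shows "(\<Sum>S\<in>UNIV. chr S L * chr S K) = (if K = L then 2 ^ CARD('n) else 0)"
proof -
  let ?c = "\<lambda>l. (if l \<in> L then -1 else 1 :: real) * (if l \<in> K then -1 else 1)"
  have "(\<Sum>S\<in>UNIV. chr S L * chr S K) = (\<Sum>S\<in>Pow UNIV. (\<Prod>l\<in>S. ?c l) * (\<Prod>l\<in>UNIV - S. 1))"
    by (simp add: chr_prod prod.distrib)
  also have "\<dots> = (\<Prod>l\<in>UNIV. ?c l + 1)"
    by (rule prod_add[symmetric]) simp
  also have "\<dots> = (if K = L then 2 ^ CARD('n) else 0)"
  proof (cases "K = L")
    case True
    then have "(\<Prod>l\<in>UNIV. ?c l + 1) = (\<Prod>l\<in>(UNIV::'n set). 2)"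
      by (intro prod.cong) auto
    with True show ?thesis by simp
  next
    case False
    then obtain l where "l \<in> K \<longleftrightarrow> l \<notin> L" by blast
    then have "\<exists>l\<in>UNIV. ?c l + 1 = 0" by (intro bexI[of _ l]) auto
    then have "(\<Prod>l\<in>UNIV. ?c l + 1) = 0" by (rule prod_zero[OF finite])
    with False show ?thesis by simp
  qed
  finally show ?thesis .
qed

section \<open>Conjugation in several variables and points with prescribed imaginary units\<close>

definition flip :: "'n set \<Rightarrow> complex ^ 'n \<Rightarrow> complex ^ 'n"
  where "flip S z = (\<chi> l. if l \<in> S then cnj (z $ l) else z $ l)"

lemma flip_nth [simp]: "flip S z $ l = (if l \<in> S then cnj (z $ l) else z $ l)"
  by (simp add: flip_def)

lemma flip_empty [simp]: "flip {} z = z"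
  by (simp add: flip_def vec_eq_iff)

lemma flip_insert: "h \<notin> S \<Longrightarrow> flip (insert h S) z = conj_var h (flip S z)"
  by (auto simp: flip_def conj_var_def vec_eq_iff)

lemma conj_var_eq_flip: "conj_var h z = flip {h} z"
  by (auto simp: flip_def conj_var_def vec_eq_iff)

lemma flip_flip: "flip S (flip S z) = z"
  by (auto simp: flip_def vec_eq_iff)

lemma flip_in_domain:
  fixes z :: "complex ^ 'n::finite"
  assumes "symmetric_domain D" "z \<in> D"
  shows "flip S z \<in> D"
  using finite[of S]
  by (induction S rule: finite_induct) (use assms in \<open>auto simp: flip_insert symmetric_domain_def\<close>)

lemma stem_flip:
  fixes z :: "complex ^ 'n::finite"
  assumes "symmetric_domain D" "stem_function D F" "z \<in> D"
  shows "F (flip S z) $ K = chr S K *\<^sub>R (F z $ K)"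
  using finite[of S]
proof (induction S rule: finite_induct)
  case (insert h S)
  have "F (flip (insert h S) z) $ K = (if h \<in> K then - (F (flip S z) $ K) else F (flip S z) $ K)"
    using assms(2) flip_in_domain[OF assms(1,3)] insert.hyps
    unfolding stem_function_def by (simp add: flip_insert)
  with insert show ?case by (simp add: chr_def)
qed (simp add: chr_def)

text \<open>Imaginary parts of either sign are allowed, unlike in the values of
  \<open>slice_coords\<close>. With \<open>J\<close> fixed and \<open>z\<close> flipped in all ways
  this gives the points needed to recover a stem function.\<close>

definition point :: "('n \<Rightarrow> 'm::finite paravector) \<Rightarrow> complex ^ 'n \<Rightarrow> ('m, 'n) points"
  where "point J z = (\<chi> l. (Re (z $ l), 0) + Im (z $ l) *\<^sub>R J l)"

lemma point_nth [simp]: "point J z $ l = (Re (z $ l), 0) + Im (z $ l) *\<^sub>R J l"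
  by (simp add: point_def)

lemma circular_eq_points:
  "circular D = {point J z | J z. z \<in> D \<and> (\<forall>l. J l \<in> imag_sphere)}"
  unfolding circular_def point_def vec_eq_iff by auto

lemma point_in_circular: "z \<in> D \<Longrightarrow> (\<And>l. J l \<in> imag_sphere) \<Longrightarrow> point J z \<in> circular D"
  unfolding circular_eq_points by blast

lemma slice_coords_point:
  assumes "\<And>l. J l \<in> imag_sphere"
  shows "slice_coords (point J z) = flip {l. Im (z $ l) < 0} z"
  using assms by (auto simp: slice_coords_def vec_eq_iff imag_sphere_iff complex_eq_iff)

lemma Im_slice_coords_nonneg: "Im (slice_coords x $ l) \<ge> 0"
  by (simp add: slice_coords_def)

lemma point_slice_coords:
  fixes x :: "('m::{finite,linorder}, 'n::finite) points"
  shows "\<exists>J. (\<forall>l. J l \<in> imag_sphere) \<and> x = point J (slice_coords x)"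
proof -
  obtain J0 :: "'m paravector" where J0: "J0 \<in> imag_sphere" using imag_sphere_nonempty by blast
  \<comment> \<open>At a real coordinate \<open>imag_unit\<close> is 0 and not on the sphere; any
    unit can replace it because its coefficient is 0.\<close>
  define J where "J = (\<lambda>l. if snd (x $ l) = 0 then J0 else imag_unit (x $ l))"
  have "J l \<in> imag_sphere" for l
    using J0 by (auto simp: J_def imag_sphere_iff imag_unit_def norm_sgn)
  moreover have "x = point J (slice_coords x)"
    by (auto simp: vec_eq_iff prod_eq_iff J_def slice_coords_def imag_unit_def sgn_div_norm)
  ultimately show ?thesis by blast
qed

lemma circular_iff:
  assumes "symmetric_domain D"
  shows "x \<in> circular D \<longleftrightarrow> slice_coords x \<in> D"
proof
  assume "x \<in> circular D"
  then obtain J z where "x = point J z" "z \<in> D" "\<And>l. J l \<in> imag_sphere"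
    by (auto simp: circular_eq_points)
  then show "slice_coords x \<in> D"
    by (simp add: slice_coords_point flip_in_domain[OF assms])
next
  assume "slice_coords x \<in> D"
  then show "x \<in> circular D"
    using point_slice_coords[of x] by (metis point_in_circular)
qed

lemma continuous_slice_coords: "continuous_on A slice_coords"
  unfolding slice_coords_def Complex_eq by (intro continuous_intros)

lemma open_circular:
  fixes D :: "(complex ^ 'n::{finite,linorder}) set"
  assumes D: "open D" "symmetric_domain D"
  shows "open (circular D :: ('m::{finite,linorder}, 'n) points set)"
proof -
  have "(circular D :: ('m, 'n) points set) = slice_coords -` D"
    using circular_iff[OF D(2)] by blast
  then show ?thesis
    using open_vimage[OF D(1) continuous_slice_coords] by simp
qed

lemma stem_eq_0_real:
  fixes F :: "('m::finite, 'n::finite) stem_fun"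
  assumes "symmetric_domain D" "stem_function D F" "z \<in> D" "l \<in> K" "Im (z $ l) = 0"
  shows "F z $ K = 0"
proof -
  have "flip {l} z = z" using assms(5) by (auto simp: vec_eq_iff complex_eq_iff)
  then have "F z $ K = - (F z $ K)"
    using stem_flip[OF assms(1-3), of "{l}" K] assms(4) by (simp add: chr_singleton)
  then have "2 *\<^sub>R (F z $ K) = 0" by (metis add.right_inverse scaleR_2)
  then show ?thesis by simp
qed

text \<open>The formula for slice functions holds in every representation of the point. Where the
  imaginary part is negative, \<open>slice_coords\<close> conjugates the variable and
  \<open>imag_unit\<close> is the negative of \<open>J l\<close>; the parity of the stem function
  compensates for this. Where it is 0, the components containing the index vanish.\<close>

lemma induced_point:
  fixes F :: "('m::{finite,linorder}, 'n::{finite,linorder}) stem_fun"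
  assumes D: "symmetric_domain D" and F: "stem_function D F" and z: "z \<in> D" and J: "\<And>l. J l \<in> imag_sphere"
  shows "induced F (point J z) = (\<Sum>K\<in>UNIV. bracket J K (F z $ K))"
  unfolding induced_def
proof (rule sum.cong[OF refl])
  fix K :: "'n set"
  define S where "S = {l. Im (z $ l) < 0}"
  have *: "imag_unit (point J z $ l) = sgn (Im (z $ l)) *\<^sub>R J l" for l
    using J[of l] by (auto simp: imag_unit_def imag_sphere_iff prod_eq_iff sgn_scaleR sgn_div_norm)
  have "bracket (\<lambda>l. imag_unit (point J z $ l)) K (F (slice_coords (point J z)) $ K) =
      ((\<Prod>l\<in>K. sgn (Im (z $ l))) * chr S K) *\<^sub>R bracket J K (F z $ K)"
    by (simp only: * bracket_scaleR slice_coords_point[OF J] S_def[symmetric] stem_flip[OF D F z] bracket_simps scaleR_scaleR)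
  also have "\<dots> = bracket J K (F z $ K)"
  proof (cases "\<exists>l\<in>K. Im (z $ l) = 0")
    case True
    then obtain l where l: "l \<in> K" "Im (z $ l) = 0" by blast
    then have "F z $ K = 0" by (intro stem_eq_0_real[OF D F z])
    then show ?thesis by (simp add: bracket_simps)
  next
    case False
    have "(\<Prod>l\<in>K. sgn (Im (z $ l))) = (\<Prod>l\<in>K. if l \<in> S then -1 else 1)"
      using False by (intro prod.cong) (auto simp: S_def sgn_if)
    then have "(\<Prod>l\<in>K. sgn (Im (z $ l))) * chr S K = 1"
      using chr_mult_self[of S K] by (simp add: chr_commute[of S K] chr_prod)
    then show ?thesis by simp
  qed
  finally show "bracket (\<lambda>l. imag_unit (point J z $ l)) K (F (slice_coords (point J z)) $ K) = bracket J K (F z $ K)" .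
qed

lemma induced_point_flip:
  fixes F :: "('m::{finite,linorder}, 'n::{finite,linorder}) stem_fun"
  assumes "symmetric_domain D" "stem_function D F" "z \<in> D" "\<And>l. J l \<in> imag_sphere"
  shows "induced F (point J (flip S z)) = (\<Sum>K\<in>UNIV. chr S K *\<^sub>R bracket J K (F z $ K))"
  using assms by (simp add: induced_point flip_in_domain stem_flip bracket_simps)

lemma average_chr:
  fixes v :: "'n::finite set \<Rightarrow> 'a::real_vector"
  shows "(1 / 2 ^ CARD('n)) *\<^sub>R (\<Sum>S\<in>UNIV. chr S L *\<^sub>R (\<Sum>K\<in>UNIV. chr S K *\<^sub>R v K)) = v L"
proof -
  have "(\<Sum>S\<in>UNIV. chr S L *\<^sub>R (\<Sum>K\<in>UNIV. chr S K *\<^sub>R v K)) =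
      (\<Sum>K\<in>UNIV. \<Sum>S\<in>UNIV. (chr S L * chr S K) *\<^sub>R v K)"
    by (subst sum.swap) (simp add: scaleR_sum_right)
  also have "\<dots> = (\<Sum>K\<in>UNIV. (if K = L then 2 ^ CARD('n) else 0) *\<^sub>R v K)"
    by (simp add: sum_chr_mult flip: scaleR_sum_left)
  also have "\<dots> = (\<Sum>K\<in>UNIV. if K = L then 2 ^ CARD('n) *\<^sub>R v L else 0)"
    by (intro sum.cong) auto
  finally show ?thesis by simp
qed

text \<open>A representation formula: the characters isolate the term with index \<open>L\<close>,
  and the units are then removed from it. It is meaningful for any \<open>g\<close>, so it supplies
  a candidate stem function before \<open>g\<close> is known to be a slice function.\<close>

definition stem_comp ::
    "('n::{finite,linorder} \<Rightarrow> 'm::{finite,linorder} paravector) \<Rightarrow> 'n set \<Rightarrow> ('m, 'n) pv_fun \<Rightarrow> (complex, 'n) vec \<Rightarrow> 'm clifford"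
  where "stem_comp J L g z =
    inverse_bracket J L ((1 / 2 ^ CARD('n)) *\<^sub>R (\<Sum>S\<in>UNIV. chr S L *\<^sub>R g (point J (flip S z))))"

lemma stem_comp_induced:
  assumes D: "symmetric_domain D" and F: "stem_of D f F" and z: "z \<in> D" and J: "\<And>l. J l \<in> imag_sphere"
  shows "stem_comp J L f z = F z $ L"
proof -
  have "f (point J (flip S z)) = (\<Sum>K\<in>UNIV. chr S K *\<^sub>R bracket J K (F z $ K))" for S
    using F point_in_circular[OF flip_in_domain[OF D z] J] induced_point_flip[OF D _ z J]
    by (simp add: stem_of_def)
  then show ?thesis
    unfolding stem_comp_def by (simp only: average_chr inverse_bracket_bracket[OF J])
qed

lemma stem_of_unique:
  fixes f :: "('m::{finite,linorder}, 'n::{finite,linorder}) pv_fun"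
  assumes "symmetric_domain D" "stem_of D f F" "stem_of D f F'" "z \<in> D"
  shows "F z = F' z"
proof -
  obtain J0 :: "'m paravector" where "J0 \<in> imag_sphere" using imag_sphere_nonempty by blast
  then show ?thesis
    using stem_comp_induced[of D f _ z "\<lambda>_. J0"] assms by (simp add: vec_eq_iff) metis
qed

lemma the_stem_eq:
  assumes "symmetric_domain D" "stem_of D f F" "z \<in> D"
  shows "the_stem D f z = F z"
proof -
  have "stem_of D f (the_stem D f)"
    unfolding the_stem_def by (rule someI[of "stem_of D f", OF assms(2)])
  from stem_of_unique[OF assms(1) this assms(2,3)] show ?thesis .
qed

lemma induced_cong: "F (slice_coords x) = F' (slice_coords x) \<Longrightarrow> induced F x = induced F' x"
  by (simp add: induced_def)

section \<open>The slice product in components\<close>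

lemma stem_mult_nth:
  fixes F G :: "('m::{finite,linorder}, 'n::finite) stem_fun"
  shows "stem_mult F G z $ L = (\<Sum>H\<in>UNIV. (-1) ^ card (H - L) *\<^sub>R (F z $ H \<star> G z $ sym_diff H L))"
proof -
  have ax: "axis (sym_diff H K) v $ L = (if K = sym_diff H L then v else 0)" for H K and v :: "'m clifford"
    by (auto simp: axis_def)
  have "stem_mult F G z $ L = (\<Sum>H\<in>UNIV. \<Sum>K\<in>UNIV. if K = sym_diff H L then (-1) ^ card (H \<inter> K) *\<^sub>R (F z $ H \<star> G z $ K) else 0)"
    by (simp only: stem_mult_def sum_component ax)
  also have "\<dots> = (\<Sum>H\<in>UNIV. (-1) ^ card (H \<inter> sym_diff H L) *\<^sub>R (F z $ H \<star> G z $ sym_diff H L))"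
    by simp
  also have "\<dots> = (\<Sum>H\<in>UNIV. (-1) ^ card (H - L) *\<^sub>R (F z $ H \<star> G z $ sym_diff H L))"
  proof (intro sum.cong refl)
    fix H
    have "H \<inter> sym_diff H L = H - L" by auto
    then show "(-1) ^ card (H \<inter> sym_diff H L) *\<^sub>R (F z $ H \<star> G z $ sym_diff H L) =
        (-1) ^ card (H - L) *\<^sub>R (F z $ H \<star> G z $ sym_diff H L)" by simp
  qed
  finally show ?thesis .
qed

lemma stem_functionI:
  fixes F :: "('m::finite, 'n::finite) stem_fun"
  assumes "\<And>z h K. z \<in> D \<Longrightarrow> F (flip {h} z) $ K = chr {h} K *\<^sub>R (F z $ K)"
  shows "stem_function D F"
  using assms by (simp add: stem_function_def conj_var_eq_flip chr_singleton)

lemma stem_function_mult: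
  fixes F G :: "('m::{finite,linorder}, 'n::finite) stem_fun"
  assumes "symmetric_domain D" "stem_function D F" "stem_function D G"
  shows "stem_function D (stem_mult F G)"
proof (rule stem_functionI)
  fix z h and L :: "'n set" assume z: "z \<in> D"
  have *: "chr {h} (sym_diff H L) * chr {h} H = chr {h} L" for H
    by (simp only: chr_sym_diff mult.assoc mult.commute[of "chr {h} L"]) (simp only: mult.assoc[symmetric] chr_mult_self mult_1)
  show "stem_mult F G (flip {h} z) $ L = chr {h} L *\<^sub>R (stem_mult F G z $ L)"
    by (simp only: stem_mult_nth stem_flip[OF assms(1,2) z] stem_flip[OF assms(1,3) z]
        clifford.scaleR_left clifford.scaleR_right scaleR_scaleR scaleR_sum_right *)
      (simp only: mult.commute)
qed

lemma slice_mult_eq: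
  assumes D: "symmetric_domain D" and F: "stem_of D f F" and G: "stem_of D g G" and x: "x \<in> circular D"
  shows "slice_mult D f g x = induced (stem_mult F G) x"
proof -
  have z: "slice_coords x \<in> D" using x circular_iff[OF D] by blast
  show ?thesis
    unfolding slice_mult_def
    by (rule induced_cong) (simp add: stem_mult_def the_stem_eq[OF D F z] the_stem_eq[OF D G z])
qed

lemma stem_of_mult:
  assumes D: "symmetric_domain D" and F: "stem_of D f F" and G: "stem_of D g G"
  shows "stem_of D (slice_mult D f g) (stem_mult F G)"
  using assms by (simp add: stem_of_def slice_mult_eq stem_function_mult)

section \<open>Inclusion-exclusion over subsets and products of coordinate functions\<close>

lemma sum_Pow_insert:
  assumes "finite S" "k \<notin> S"
  shows "(\<Sum>A\<in>Pow (insert k S). f A) = (\<Sum>A\<in>Pow S. f A + f (insert k A))"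
proof -
  have inj: "inj_on (insert k) (Pow S)" using assms(2) unfolding inj_on_def by (auto simp: insert_ident) 
  have "(\<Sum>A\<in>Pow (insert k S). f A) = (\<Sum>A\<in>Pow S. f A) + (\<Sum>A\<in>insert k ` Pow S. f A)"
    unfolding Pow_insert by (rule sum.union_disjoint) (use assms in auto)
  then show ?thesis by (simp add: sum.reindex[OF inj] sum.distrib)
qed

lemma sum_Pow_minus_one:
  assumes "finite M"
  shows "(\<Sum>X\<in>Pow M. (-1) ^ card X) = (if M = {} then 1 else 0 :: real)"
proof -
  have "(\<Sum>X\<in>Pow M. (-1) ^ card X :: real) = (\<Sum>X\<in>Pow M. (\<Prod>x\<in>X. -1) * (\<Prod>x\<in>M - X. 1))"
    by simp
  also have "\<dots> = (\<Prod>x\<in>M. -1 + 1)"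
    by (rule prod_add[symmetric, OF assms])
  finally show ?thesis using assms by (simp add: power_0_left)
qed

lemma sum_between_minus_one:
  assumes "finite M" "A \<subseteq> M"
  shows "(\<Sum>K | A \<subseteq> K \<and> K \<subseteq> M. (-1) ^ card (M - K)) = (if A = M then 1 else 0 :: real)"
proof -
  have "(\<Sum>K | A \<subseteq> K \<and> K \<subseteq> M. (-1) ^ card (M - K)) = (\<Sum>X\<in>Pow (M - A). (-1) ^ card X :: real)"
    by (rule sum.reindex_bij_witness[of _ "\<lambda>X. M - X" "\<lambda>K. M - K"]) (use assms in \<open>auto simp: double_diff\<close>)
  also have "\<dots> = (if A = M then 1 else 0)"
    using assms by (subst sum_Pow_minus_one) auto
  finally show ?thesis .
qed

text \<open>For \<open>C \<subseteq> T\<close>, the coefficient with index \<open>C\<close> in the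
  product over \<open>T\<close> of the stem functions of the coordinates; conjugated coordinates add
  only the sign \<open>(-1) ^ card C\<close>.\<close>

definition coord_monomial :: "'n::finite set \<Rightarrow> 'n set \<Rightarrow> complex ^ 'n \<Rightarrow> real"
  where "coord_monomial T C z = (\<Prod>l\<in>T - C. Re (z $ l)) * (\<Prod>l\<in>C. Im (z $ l))"

lemma coord_monomial_insert:
  assumes "b \<notin> A" "C \<subseteq> A"
  shows "coord_monomial (insert b A) C z = Re (z $ b) * coord_monomial A C z"
    and "coord_monomial (insert b A) (insert b C) z = Im (z $ b) * coord_monomial A C z"
proof -
  have "insert b A - C = insert b (A - C)" "b \<notin> A - C" using assms by auto
  then show "coord_monomial (insert b A) C z = Re (z $ b) * coord_monomial A C z"
    by (simp add: coord_monomial_def)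
  have "insert b A - insert b C = A - C" "b \<notin> C" using assms by auto
  then show "coord_monomial (insert b A) (insert b C) z = Im (z $ b) * coord_monomial A C z"
    by (simp add: coord_monomial_def)
qed

lemma prod_Im_flip: "(\<Prod>l\<in>C. Im (flip S z $ l)) = chr S C * (\<Prod>l\<in>C. Im (z $ l))"
  for z :: "complex ^ 'n::finite"
proof -
  have "(\<Prod>l\<in>C. Im (flip S z $ l)) = (\<Prod>l\<in>C. (if l \<in> S then -1 else 1) * Im (z $ l))"
    by (intro prod.cong) auto
  also have "\<dots> = chr C S * (\<Prod>l\<in>C. Im (z $ l))"
    by (simp only: prod.distrib chr_prod[OF finite])
  finally show ?thesis by (simp only: chr_commute)
qed

lemma coord_monomial_flip: "coord_monomial T C (flip S z) = chr S C * coord_monomial T C z"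
proof -
  have "(\<Prod>l\<in>T - C. Re (flip S z $ l)) = (\<Prod>l\<in>T - C. Re (z $ l))"
    by (intro prod.cong) auto
  then show ?thesis by (simp only: coord_monomial_def prod_Im_flip mult.left_commute)
qed

definition coord_stem :: "'n::finite \<Rightarrow> ('m::{finite,linorder}, 'n) stem_fun"
  where "coord_stem k z = axis {} (Re (z $ k) *\<^sub>R clifford_one) + axis {k} (Im (z $ k) *\<^sub>R clifford_one)"

lemma stem_of_coord: "stem_of D (coord_fun k) (coord_stem k)"
proof -
  have "stem_function D (coord_stem k :: ('b, 'a) stem_fun)"
    by (rule stem_functionI) (auto simp: coord_stem_def axis_def chr_singleton)
  then show ?thesis
    by (simp add: stem_of_def coord_fun_def coord_stem_def[abs_def])
qed

text \<open>The spherical derivative with respect to \<open>H\<close> reads only components whose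
  index contains \<open>H\<close>, hence \<open>k\<close>. For these no signs occur, since the index
  sets \<open>{}\<close> and \<open>{k}\<close> of the coordinate both lie in
  \<open>L\<close>.\<close>

lemma stem_mult_coord:
  fixes F :: "('m::{finite,linorder}, 'n::finite) stem_fun"
  assumes "k \<in> L"
  shows "stem_mult (coord_stem k) F z $ L = Re (z $ k) *\<^sub>R (F z $ L) + Im (z $ k) *\<^sub>R (F z $ (L - {k}))"
proof -
  have "stem_mult (coord_stem k) F z $ L =
      (\<Sum>H\<in>{{}, {k}}. (-1) ^ card (H - L) *\<^sub>R (coord_stem k z $ H \<star> F z $ sym_diff H L))"
    unfolding stem_mult_nth
    by (rule sum.mono_neutral_right) (auto simp: coord_stem_def axis_def clifford.zero_left)
  also have "\<dots> = Re (z $ k) *\<^sub>R (F z $ L) + Im (z $ k) *\<^sub>R (F z $ (L - {k}))"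
  proof -
    have "sym_diff {k} L = L - {k}" using assms by auto
    with assms show ?thesis
      by (simp add: coord_stem_def axis_def clifford.scaleR_left clifford_one_mult)
  qed
  finally show ?thesis .
qed

text \<open>Each coordinate factor contributes either its real part, keeping the index, or its
  imaginary part, removing \<open>k\<close> from it; \<open>A\<close> is the set of removed
  indices.\<close>

lemma stem_of_coord_mult:
  assumes D: "symmetric_domain D" and F: "stem_of D f F" and "distinct ks"
  shows "\<exists>F'. stem_of D (foldr (\<lambda>k g. slice_mult D (coord_fun k) g) ks f) F' \<and>
    (\<forall>z L. set ks \<subseteq> L \<longrightarrow>
      F' z $ L = (\<Sum>A\<in>Pow (set ks). coord_monomial (set ks) A z *\<^sub>R (F z $ (L - A))))"
  using assms(3)
proof (induction ks)
  case Nil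
  then show ?case using F by (auto simp: coord_monomial_def)
next
  case (Cons k ks)
  then obtain F' where F': "stem_of D (foldr (\<lambda>k g. slice_mult D (coord_fun k) g) ks f) F'"
    and eq: "\<And>z L. set ks \<subseteq> L \<Longrightarrow>
      F' z $ L = (\<Sum>A\<in>Pow (set ks). coord_monomial (set ks) A z *\<^sub>R (F z $ (L - A)))" by auto
  have k: "k \<notin> set ks" using Cons.prems by simp
  have "stem_mult (coord_stem k) F' z $ L =
      (\<Sum>A\<in>Pow (set (k # ks)). coord_monomial (set (k # ks)) A z *\<^sub>R (F z $ (L - A)))"
    if L: "set (k # ks) \<subseteq> L" for z L
  proof -
    have "L - {k} - A = L - insert k A" for A by auto
    moreover have "set ks \<subseteq> L" "set ks \<subseteq> L - {k}" "k \<in> L" using L k by auto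
    ultimately have "stem_mult (coord_stem k) F' z $ L = (\<Sum>A\<in>Pow (set ks).
        (Re (z $ k) * coord_monomial (set ks) A z) *\<^sub>R (F z $ (L - A)) +
        (Im (z $ k) * coord_monomial (set ks) A z) *\<^sub>R (F z $ (L - insert k A)))"
      by (simp add: stem_mult_coord eq scaleR_sum_right sum.distrib)
    also have "\<dots> = (\<Sum>A\<in>Pow (set ks). coord_monomial (set (k # ks)) A z *\<^sub>R (F z $ (L - A)) +
        coord_monomial (set (k # ks)) (insert k A) z *\<^sub>R (F z $ (L - insert k A)))"
      using k by (intro sum.cong refl) (simp add: coord_monomial_insert)
    finally show ?thesis by (simp add: sum_Pow_insert k)
  qed
  moreover have "stem_of D (foldr (\<lambda>k g. slice_mult D (coord_fun k) g) (k # ks) f) (stem_mult (coord_stem k) F')"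
    using stem_of_mult[OF D stem_of_coord F'] by simp
  ultimately show ?case by blast
qed

definition conj_stem :: "'n::finite set \<Rightarrow> ('m::{finite,linorder}, 'n) stem_fun"
  where "conj_stem T z = (\<chi> C. if C \<subseteq> T then ((-1) ^ card C * coord_monomial T C z) *\<^sub>R clifford_one else 0)"

lemma induced_eq_sum_Pow:
  fixes F :: "('m::{finite,linorder}, 'n::{finite,linorder}) stem_fun"
  assumes "\<And>C. \<not> C \<subseteq> T \<Longrightarrow> F (slice_coords x) $ C = 0"
  shows "induced F x = (\<Sum>C\<in>Pow T. bracket (\<lambda>l. imag_unit (x $ l)) C (F (slice_coords x) $ C))"
  unfolding induced_def
  by (rule sum.mono_neutral_right) (use assms in \<open>auto simp: bracket_simps\<close>)

lemma conj_coord_fun_eq: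
  "conj_coord_fun b x =
    Re (slice_coords x $ b) *\<^sub>R clifford_one - Im (slice_coords x $ b) *\<^sub>R of_paravector (imag_unit (x $ b))"
proof -
  have "conj_coord_fun b x = (\<Sum>C\<in>Pow {b}. bracket (\<lambda>l. imag_unit (x $ l)) C
      ((axis {} (Re (slice_coords x $ b) *\<^sub>R clifford_one) - axis {b} (Im (slice_coords x $ b) *\<^sub>R clifford_one)) $ C))"
    unfolding conj_coord_fun_def by (rule induced_eq_sum_Pow) (auto simp: axis_def)
  also have "\<dots> = Re (slice_coords x $ b) *\<^sub>R clifford_one - Im (slice_coords x $ b) *\<^sub>R of_paravector (imag_unit (x $ b))"
    using bracket_insert_less[of "{}" b "\<lambda>l. imag_unit (x $ l)" "- (Im (slice_coords x $ b) *\<^sub>R clifford_one)"]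
    by (simp add: Pow_insert axis_def clifford.scaleR_right clifford.minus_right clifford_mult_one)
  finally show ?thesis .
qed

text \<open>A pointwise product of slice functions is not a slice function in general. Here the
  factors are in increasing order, so a new factor with the smallest index puts its unit in front,
  exactly where \<open>bracket\<close> expects it; hence the induction inserts minima.\<close>

lemma conj_coord_prod_eq: "conj_coord_prod T x = induced (conj_stem T) x"
proof -
  define z where "z = slice_coords x"
  define B where "B = (\<lambda>C. bracket (\<lambda>l. imag_unit (x $ l)) C clifford_one)"
  have ind: "induced (conj_stem T) x = (\<Sum>C\<in>Pow T. ((-1) ^ card C * coord_monomial T C z) *\<^sub>R B C)" for T
    by (subst induced_eq_sum_Pow[of T]) (auto simp: conj_stem_def z_def B_def bracket_simps)
  have "conj_coord_prod T x = (\<Sum>C\<in>Pow T. ((-1) ^ card C * coord_monomial T C z) *\<^sub>R B C)"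
    using finite[of T]
  proof (induction T rule: finite_linorder_min_induct)
    case empty
    then show ?case by (simp add: conj_coord_prod_def coord_monomial_def B_def)
  next
    case (insert b A)
    have b: "b \<notin> A" using insert.hyps by auto
    have "sorted_list_of_set (insert b A) = b # sorted_list_of_set A"
      using insert.hyps b by (subst sorted_list_of_set_insert_remove) (auto simp: less_imp_le intro!: insort_is_Cons)
    then have "conj_coord_prod (insert b A) x = conj_coord_fun b x \<star> conj_coord_prod A x"
      by (simp add: conj_coord_prod_def)
    also have "\<dots> = (\<Sum>C\<in>Pow A. ((-1) ^ card C * coord_monomial A C z) *\<^sub>R (conj_coord_fun b x \<star> B C))"
      by (simp add: insert.IH clifford.sum_right clifford.scaleR_right)
    also have "\<dots> = (\<Sum>C\<in>Pow A. ((-1) ^ card C * coord_monomial (insert b A) C z) *\<^sub>R B C +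
        ((-1) ^ card (insert b C) * coord_monomial (insert b A) (insert b C) z) *\<^sub>R B (insert b C))"
    proof (rule sum.cong[OF refl])
      fix C assume C: "C \<in> Pow A"
      then have "b \<notin> C" using b by auto
      moreover have "B (insert b C) = of_paravector (imag_unit (x $ b)) \<star> B C"
        unfolding B_def by (rule bracket_insert_less) (use C insert.hyps in auto)
      ultimately show "((-1) ^ card C * coord_monomial A C z) *\<^sub>R (conj_coord_fun b x \<star> B C) =
          ((-1) ^ card C * coord_monomial (insert b A) C z) *\<^sub>R B C +
          ((-1) ^ card (insert b C) * coord_monomial (insert b A) (insert b C) z) *\<^sub>R B (insert b C)"
        using b C by (simp add: conj_coord_fun_eq coord_monomial_insert clifford.diff_left clifford.scaleR_left
            clifford_one_mult z_def[symmetric] scaleR_right_diff_distrib mult_ac)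
    qed
    finally show ?case by (simp add: sum_Pow_insert b)
  qed
  then show ?thesis by (simp only: ind)
qed

lemma stem_of_conj_coord_prod: "stem_of D (conj_coord_prod T) (conj_stem T)"
proof -
  have "stem_function D (conj_stem T :: ('b, 'a) stem_fun)"
    by (rule stem_functionI) (auto simp: conj_stem_def coord_monomial_flip mult.left_commute)
  then show ?thesis
    by (simp add: stem_of_def conj_coord_prod_eq)
qed

text \<open>A nonzero term has its first index \<open>C\<close> inside \<open>T\<close>, hence
  inside \<open>H\<close>, and the symmetric difference of \<open>C\<close> and \<open>L\<close>
  disjoint from \<open>H\<close>. This forces \<open>C = L \<inter> H\<close>, so the convolution
  over all index sets collapses to one term.\<close>

lemma stem_mult_conj_stem:
  fixes F :: "('m::{finite,linorder}, 'n::finite) stem_fun"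
  assumes F: "\<And>B. B \<inter> H \<noteq> {} \<Longrightarrow> F z $ B = 0" and T: "T \<subseteq> H"
  shows "stem_mult (conj_stem T) F z $ L =
    (if L \<inter> H \<subseteq> T then ((-1) ^ card (L \<inter> H) * coord_monomial T (L \<inter> H) z) *\<^sub>R (F z $ (L - H)) else 0)"
proof -
  have "stem_mult (conj_stem T) F z $ L =
      (\<Sum>C\<in>{L \<inter> H}. (-1) ^ card (C - L) *\<^sub>R (conj_stem T z $ C \<star> F z $ sym_diff C L))"
    unfolding stem_mult_nth
  proof (rule sum.mono_neutral_right)
    show "\<forall>C\<in>UNIV - {L \<inter> H}. (-1) ^ card (C - L) *\<^sub>R (conj_stem T z $ C \<star> F z $ sym_diff C L) = 0"
    proof
      fix C assume C: "C \<in> UNIV - {L \<inter> H}"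
      show "(-1) ^ card (C - L) *\<^sub>R (conj_stem T z $ C \<star> F z $ sym_diff C L) = 0"
      proof (cases "C \<subseteq> T")
        case True
        with C T have "sym_diff C L \<inter> H \<noteq> {}" by blast
        then show ?thesis by (simp add: F clifford.zero_right del: Un_iff)
      qed (simp add: conj_stem_def clifford.zero_left)
    qed
  qed auto
  also have "\<dots> = conj_stem T z $ (L \<inter> H) \<star> F z $ (L - H)"
  proof -
    have "sym_diff (L \<inter> H) L = L - H" "L \<inter> H - L = {}" by auto
    then show ?thesis
      by (simp only: sum.insert[OF finite.emptyI] sum.empty empty_iff not_False_eq_True add_0_right
          card.empty power_0 scaleR_one)
  qed
  also have "\<dots> = (if L \<inter> H \<subseteq> T then ((-1) ^ card (L \<inter> H) * coord_monomial T (L \<inter> H) z) *\<^sub>R (F z $ (L - H)) else 0)"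
    by (simp add: conj_stem_def clifford.zero_left clifford.scaleR_left clifford_one_mult)
  finally show ?thesis .
qed

text \<open>The Almansi-type decomposition $f = \sum_K (-1)^{|H \setminus K|} (\overline{x})_{H \setminus K} \odot
  \mathcal{S}^H_K(f)$ on the level of the component \<open>L = B \<union> C\<close> of the stem functions, where \<open>q A\<close> is
  $F_{B \cup A} / \beta_A$.\<close>

lemma almansi_type_identity:
  fixes q :: "'n::finite set \<Rightarrow> 'a::real_vector" and z :: "complex ^ 'n"
  assumes C: "C \<subseteq> H"
  shows "(\<Sum>K\<in>Pow H. (-1) ^ card (H - K) *\<^sub>R
      (if C \<subseteq> H - K then ((-1) ^ card C * coord_monomial (H - K) C z) *\<^sub>R
        (\<Sum>A\<in>Pow K. (\<Prod>l\<in>K - A. Re (z $ l)) *\<^sub>R q (H - A)) else 0)) = (\<Prod>l\<in>C. Im (z $ l)) *\<^sub>R q C"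
proof -
  \<comment> \<open>Only sets \<open>K\<close> disjoint from \<open>C\<close> contribute, that is,
    the subsets of \<open>M\<close>.\<close>
  define M where "M = H - C"
  define r where "r = (\<lambda>S. \<Prod>l\<in>S. Re (z $ l))"
  define b where "b = (\<Prod>l\<in>C. Im (z $ l))"
  have M: "H - M = C" using C by (auto simp: M_def)
  let ?s = "\<lambda>K. (-1) ^ card (H - K) *\<^sub>R (if C \<subseteq> H - K then ((-1) ^ card C * coord_monomial (H - K) C z) *\<^sub>R
      (\<Sum>A\<in>Pow K. r (K - A) *\<^sub>R q (H - A)) else 0)"
  let ?t = "\<lambda>K A. ((-1) ^ card (M - K) * (r (M - A) * b)) *\<^sub>R q (H - A)"
  have "(\<Sum>K\<in>Pow H. ?s K) = (\<Sum>K\<in>Pow M. ?s K)"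
    using C by (intro sum.mono_neutral_right) (auto simp: M_def)
  also have "\<dots> = (\<Sum>K\<in>Pow M. \<Sum>A\<in>Pow M. if A \<subseteq> K then ?t K A else 0)"
  proof (rule sum.cong[OF refl])
    fix K assume K: "K \<in> Pow M"
    have CK: "C \<subseteq> H - K" using K C by (auto simp: M_def)
    have HK: "H - K = C \<union> (M - K)" "C \<inter> (M - K) = {}" using K C by (auto simp: M_def)
    have card: "card (H - K) = card C + card (M - K)"
      using card_Un_disjoint[of C "M - K"] HK by simp
    have sgn: "(-1) ^ card (H - K) * ((-1) ^ card C * x) = (-1) ^ card (M - K) * x" for x :: real
      by (simp add: card power_add mult.assoc[symmetric] flip: power_mult_distrib)
    have "H - K - C = M - K" by (auto simp: M_def)
    then have mon: "coord_monomial (H - K) C z = r (M - K) * b"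
      by (simp add: coord_monomial_def r_def b_def)
    have r: "r (M - K) * r (K - A) = r (M - A)" if "A \<subseteq> K" for A
    proof -
      have "M - A = (M - K) \<union> (K - A)" "(M - K) \<inter> (K - A) = {}" using K that by auto
      then show ?thesis by (simp add: r_def prod.union_disjoint)
    qed
    have "?s K =
        (\<Sum>A\<in>Pow K. ((-1) ^ card (H - K) * ((-1) ^ card C * (r (M - K) * b * r (K - A)))) *\<^sub>R q (H - A))"
      using CK by (simp add: scaleR_sum_right mon mult.assoc)
    also have "\<dots> = (\<Sum>A\<in>Pow K. ?t K A)"
    proof (rule sum.cong[OF refl])
      fix A assume "A \<in> Pow K"
      then have "A \<subseteq> K" by simp
      then have "(-1) ^ card (H - K) * ((-1) ^ card C * (r (M - K) * b * r (K - A))) = (-1) ^ card (M - K) * (r (M - A) * b)"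
        unfolding sgn using r[of A] by (simp add: mult_ac)
      then show "((-1) ^ card (H - K) * ((-1) ^ card C * (r (M - K) * b * r (K - A)))) *\<^sub>R q (H - A) = ?t K A"
        by (simp only:)
    qed
    also have "\<dots> = (\<Sum>A\<in>Pow M. if A \<subseteq> K then ?t K A else 0)"
      using K by (intro sum.mono_neutral_cong_left) auto
    finally show "?s K = \<dots>" .
  qed
  \<comment> \<open>For fixed \<open>A\<close> the real parts combine to a product over
    \<open>M - A\<close> independent of \<open>K\<close>. What remains is an alternating sum over
    \<open>A \<subseteq> K \<subseteq> M\<close>, which survives only for \<open>A = M\<close>,
    where \<open>H - A\<close> is \<open>C\<close>.\<close>
  also have "\<dots> = (\<Sum>A\<in>Pow M. \<Sum>K\<in>Pow M. if A \<subseteq> K then ?t K A else 0)"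
    by (rule sum.swap)
  also have "\<dots> = (\<Sum>A\<in>Pow M. if A = M then b *\<^sub>R q C else 0)"
  proof (rule sum.cong[OF refl])
    fix A assume A: "A \<in> Pow M"
    have "(\<Sum>K\<in>Pow M. if A \<subseteq> K then ?t K A else 0) =
        (\<Sum>K | A \<subseteq> K \<and> K \<subseteq> M. ?t K A)"
      by (intro sum.mono_neutral_cong_right) auto
    also have "\<dots> = ((\<Sum>K | A \<subseteq> K \<and> K \<subseteq> M. (-1) ^ card (M - K)) * (r (M - A) * b)) *\<^sub>R q (H - A)"
      by (simp add: sum_distrib_right scaleR_sum_left)
    also have "\<dots> = (if A = M then b *\<^sub>R q C else 0)"
      using A by (simp add: sum_between_minus_one M r_def)
    finally show "(\<Sum>K\<in>Pow M. if A \<subseteq> K then ?t K A else 0) =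
        (if A = M then b *\<^sub>R q C else 0)" .
  qed
  also have "\<dots> = b *\<^sub>R q C" by simp
  finally show ?thesis unfolding r_def b_def .
qed

section \<open>Division of stem functions by imaginary parts\<close>

text \<open>The denominator is that of the difference of the Cauchy kernels at \<open>z\<close> and
  \<open>cnj z\<close>, whose numerator \<open>2 * \<i> * Im z\<close> is split off. The numerator
  here is the derivative of the circle without its factor \<open>2 * pi * \<i>\<close>.\<close>

definition conj_kernel :: "complex \<Rightarrow> real \<Rightarrow> real \<Rightarrow> complex \<Rightarrow> complex"
  where "conj_kernel c r t z =
    (circlepath c r t - c) / ((circlepath c r t - z) * (circlepath c r t - cnj z))"

text \<open>The real part of the integral of the kernel against the complex function with parts
  \<open>u\<close> and \<open>v\<close>. In this form a real factor common to \<open>u\<close> and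
  \<open>v\<close> can be taken out.\<close>

definition conj_integral :: "complex \<Rightarrow> real \<Rightarrow> complex \<Rightarrow> (complex \<Rightarrow> real) \<Rightarrow> (complex \<Rightarrow> real) \<Rightarrow> real"
  where "conj_integral c r z u v = integral {0..1} (\<lambda>t.
    Re (conj_kernel c r t z) * u (circlepath c r t) - Im (conj_kernel c r t z) * v (circlepath c r t))"

text \<open>Subtracting the Cauchy formulas at \<open>z\<close> and \<open>cnj z\<close> exhibits the factor \<open>Im z\<close>.\<close>

lemma Im_factor_integral:
  fixes u v :: "complex \<Rightarrow> real"
  assumes hol: "(\<lambda>w. Complex (u w) (v w)) holomorphic_on ball c \<rho>"
    and c: "Im c = 0" and r: "0 < r" "r < \<rho>" and z: "z \<in> ball c r"
    and u: "u (cnj z) = u z" and v: "v (cnj z) = - v z"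
  shows "v z = Im z * conj_integral c r z u v"
proof -
  define \<Phi> where "\<Phi> = (\<lambda>w. Complex (u w) (v w))"
  let ?g = "circlepath c r"
  have hol': "\<Phi> holomorphic_on cball c r"
    using holomorphic_on_subset[OF hol[folded \<Phi>_def], of "cball c r"] r
    by (simp add: cball_subset_ball_iff)
  have cc: "cnj c = c" using c by (simp add: complex_eq_iff)
  have nz: "norm (z - c) < r" using z by (simp add: dist_norm norm_minus_commute)
  have nz': "norm (cnj z - c) < r"
    using nz cc by (metis complex_cnj_diff complex_mod_cnj)
  have ne: "?g t \<noteq> z" "?g t \<noteq> cnj z" for t
  proof -
    have "norm (?g t - c) = r" using r by (simp add: circlepath norm_mult)
    then show "?g t \<noteq> z" "?g t \<noteq> cnj z" using nz nz' by auto
  qed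
  have "((\<lambda>t. \<Phi> (?g t) / (?g t - w) * vector_derivative ?g (at t within {0..1})) has_integral
      (2 * of_real pi * \<i> * \<Phi> w)) {0..1}" if "norm (w - c) < r" for w
    using Cauchy_integral_circlepath_simple[OF hol' that] unfolding has_contour_integral_def .
  from has_integral_diff[OF this[OF nz] this[OF nz']]
  have "((\<lambda>t. \<Phi> (?g t) / (?g t - z) * vector_derivative ?g (at t within {0..1}) -
      \<Phi> (?g t) / (?g t - cnj z) * vector_derivative ?g (at t within {0..1})) has_integral
      (2 * of_real pi * \<i> * \<Phi> z - 2 * of_real pi * \<i> * \<Phi> (cnj z))) {0..1}" .
  also have "2 * of_real pi * \<i> * \<Phi> z - 2 * of_real pi * \<i> * \<Phi> (cnj z) = (2 * of_real pi * \<i>) * (2 * \<i>) * of_real (v z)"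
    using u v by (simp add: \<Phi>_def complex_eq_iff)
  finally have "((\<lambda>t. (2 * of_real pi * \<i>) * (2 * \<i>) * (of_real (Im z) * (\<Phi> (?g t) * conj_kernel c r t z)))
      has_integral (2 * of_real pi * \<i>) * (2 * \<i>) * of_real (v z)) {0..1}"
  proof (rule has_integral_eq[rotated])
    fix t :: real assume t: "t \<in> {0..1}"
    have vd: "vector_derivative ?g (at t within {0..1}) = (2 * of_real pi * \<i>) * (?g t - c)"
      using t by (subst vector_derivative_circlepath01) (auto simp: circlepath)
    have "1 / (?g t - z) - 1 / (?g t - cnj z) = (z - cnj z) / ((?g t - z) * (?g t - cnj z))"
      using ne[of t] by (simp add: divide_simps)
    also have "z - cnj z = 2 * \<i> * of_real (Im z)"
      by (simp add: complex_eq_iff)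
    finally have E: "1 / (?g t - z) - 1 / (?g t - cnj z) = 2 * \<i> * of_real (Im z) / ((?g t - z) * (?g t - cnj z))" .
    have "\<Phi> (?g t) / (?g t - z) * vector_derivative ?g (at t within {0..1}) -
        \<Phi> (?g t) / (?g t - cnj z) * vector_derivative ?g (at t within {0..1}) =
        \<Phi> (?g t) * vector_derivative ?g (at t within {0..1}) * (1 / (?g t - z) - 1 / (?g t - cnj z))"
      by (simp add: algebra_simps divide_inverse)
    also have "\<dots> = (2 * of_real pi * \<i>) * (2 * \<i>) * (of_real (Im z) * (\<Phi> (?g t) * conj_kernel c r t z))"
      unfolding E vd conj_kernel_def by (simp add: mult_ac)
    finally show "\<Phi> (?g t) / (?g t - z) * vector_derivative ?g (at t within {0..1}) -
        \<Phi> (?g t) / (?g t - cnj z) * vector_derivative ?g (at t within {0..1}) = \<dots>" .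
  qed
  from has_integral_mult_right[OF this, of "1 / ((2 * of_real pi * \<i>) * (2 * \<i>))"]
  have "((\<lambda>t. of_real (Im z) * (\<Phi> (?g t) * conj_kernel c r t z)) has_integral of_real (v z)) {0..1}"
    by simp
  from has_integral_linear[OF this bounded_linear_Re]
  have "((\<lambda>t. Im z * (Re (conj_kernel c r t z) * u (?g t) - Im (conj_kernel c r t z) * v (?g t))) has_integral v z) {0..1}"
    by (simp add: o_def \<Phi>_def mult.commute)
  from integral_unique[OF this, symmetric] show ?thesis
    by (simp only: integral_mult_right conj_integral_def)
qed

lemma upd_var_nth [simp]: "upd_var y h w $ l = (if l = h then w else y $ l)"
  by (simp add: upd_var_def)

lemma upd_var_self [simp]: "upd_var y h (y $ h) = y"
  by (simp add: vec_eq_iff)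

lemma upd_var_upd_var [simp]: "upd_var (upd_var y h v) h w = upd_var y h w"
  by (simp add: vec_eq_iff)

lemma continuous_on_upd_var:
  fixes f :: "'a::topological_space \<Rightarrow> 'b::topological_space ^ 'n"
  assumes "continuous_on S f" "continuous_on S g"
  shows "continuous_on S (\<lambda>x. upd_var (f x) h (g x))"
proof -
  have *: "continuous_on S (\<lambda>x. if l = h then g x else f x $ l)" for l
    by (cases "l = h") (auto intro!: continuous_intros assms)
  show ?thesis
    unfolding upd_var_def continuous_on_def
    by (intro ballI tendsto_vec_lambda) (use * in \<open>simp add: continuous_on_def\<close>)
qed

text \<open>Induction on \<open>C\<close>. The formula for index \<open>h\<close> involves the
  components with index sets \<open>B \<union> C\<close> and \<open>insert h (B \<union> C)\<close>
  at points with \<open>z $ h\<close> on the circle. The induction hypothesis, used for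
  \<open>B\<close> and for \<open>insert h B\<close>, has already divided both by the remaining
  imaginary parts, and these do not move along the circle, so they leave the integral. As
  \<open>z $ h\<close> stays strictly inside the circle, the kernel is continuous, also at real
  points.\<close>

lemma iterated_Im_quotient:
  fixes \<phi> :: "'n::finite set \<Rightarrow> complex ^ 'n \<Rightarrow> real" and P :: "(complex ^ 'n) set"
  assumes P: "P = {z. \<forall>l. dist (z0 $ l) (z $ l) < \<rho>}" and r: "0 < r" "r < \<rho>"
    and cont: "\<And>K. continuous_on P (\<phi> K)"
    and real: "\<And>h. h \<in> C \<Longrightarrow> Im (z0 $ h) = 0"
    and rep: "\<And>h K z. h \<in> C \<Longrightarrow> h \<notin> K \<Longrightarrow> z \<in> P \<Longrightarrow> dist (z0 $ h) (z $ h) < r \<Longrightarrow>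
      \<phi> (insert h K) z = Im (z $ h) *
        conj_integral (z0 $ h) r (z $ h) (\<lambda>w. \<phi> K (upd_var z h w)) (\<lambda>w. \<phi> (insert h K) (upd_var z h w))"
    and B: "B \<inter> C = {}"
  shows "\<exists>Q. continuous_on {z \<in> P. \<forall>l\<in>C. dist (z0 $ l) (z $ l) < r} Q \<and>
    (\<forall>z \<in> P. (\<forall>l\<in>C. dist (z0 $ l) (z $ l) < r) \<longrightarrow> \<phi> (B \<union> C) z = (\<Prod>l\<in>C. Im (z $ l)) * Q z)"
  using finite[of C] B real rep
proof (induction C arbitrary: B rule: finite_induct)
  case empty
  then show ?case using cont[of B] by (intro exI[of _ "\<phi> B"]) simp
next
  case (insert h C)
  have IH: "\<exists>Q. continuous_on {z \<in> P. \<forall>l\<in>C. dist (z0 $ l) (z $ l) < r} Q \<and>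
      (\<forall>z \<in> P. (\<forall>l\<in>C. dist (z0 $ l) (z $ l) < r) \<longrightarrow> \<phi> (B' \<union> C) z = (\<Prod>l\<in>C. Im (z $ l)) * Q z)"
    if "B' \<inter> C = {}" for B'
    by (rule insert.IH[OF that]) (use insert.prems(2,3) in auto)
  obtain Q1 where Q1: "continuous_on {z \<in> P. \<forall>l\<in>C. dist (z0 $ l) (z $ l) < r} Q1"
    "\<And>z. z \<in> P \<Longrightarrow> \<forall>l\<in>C. dist (z0 $ l) (z $ l) < r \<Longrightarrow> \<phi> (B \<union> C) z = (\<Prod>l\<in>C. Im (z $ l)) * Q1 z"
    using IH[of B] insert.prems(1) by blast
  obtain Q2 where Q2: "continuous_on {z \<in> P. \<forall>l\<in>C. dist (z0 $ l) (z $ l) < r} Q2"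
    "\<And>z. z \<in> P \<Longrightarrow> \<forall>l\<in>C. dist (z0 $ l) (z $ l) < r \<Longrightarrow> \<phi> (insert h B \<union> C) z = (\<Prod>l\<in>C. Im (z $ l)) * Q2 z"
    using IH[of "insert h B"] insert.prems(1) insert.hyps by blast
  let ?R = "{z \<in> P. \<forall>l\<in>insert h C. dist (z0 $ l) (z $ l) < r}"
  let ?g = "circlepath (z0 $ h) r"
  define Q where "Q = (\<lambda>z. conj_integral (z0 $ h) r (z $ h) (\<lambda>w. Q1 (upd_var z h w)) (\<lambda>w. Q2 (upd_var z h w)))"
  have dist_g: "dist (z0 $ h) (?g t) = r" for t
    using r by (simp add: circlepath dist_norm norm_mult)
  have upd: "upd_var z h (?g t) \<in> {z \<in> P. \<forall>l\<in>C. dist (z0 $ l) (z $ l) < r}" if "z \<in> ?R" for z t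
    using that r insert.hyps dist_g by (auto simp: P)
  have cc: "cnj (z0 $ h) = z0 $ h" using insert.prems(2)[of h] by (simp add: complex_eq_iff)
  have contg: "continuous_on A ?g" for A
    unfolding circlepath by (intro continuous_intros)
  have cont_k: "continuous_on (?R \<times> {0..1}) (\<lambda>(z, t). conj_kernel (z0 $ h) r t (z $ h))"
    unfolding conj_kernel_def split_beta
  proof (intro continuous_intros continuous_on_compose2[OF contg[of UNIV]] ballI)
    fix p assume p: "p \<in> ?R \<times> {0..1::real}"
    have 1: "dist (z0 $ h) (fst p $ h) < r" using p by auto
    have "dist (z0 $ h) (cnj (fst p $ h)) = dist (z0 $ h) (fst p $ h)"
      by (metis cc complex_cnj_diff complex_mod_cnj dist_norm)
    with 1 have 2: "dist (z0 $ h) (cnj (fst p $ h)) < r" by simp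
    show "(?g (snd p) - fst p $ h) * (?g (snd p) - cnj (fst p $ h)) \<noteq> 0"
      using 1 2 dist_g[of "snd p"] by auto
  qed auto
  have cont_upd: "continuous_on (?R \<times> {0..1}) (\<lambda>p. upd_var (fst p) h (?g (snd p)))"
    by (intro continuous_on_upd_var continuous_intros continuous_on_compose2[OF contg[of UNIV]]) auto
  have c1: "continuous_on (?R \<times> {0..1}) (\<lambda>p. Q1 (upd_var (fst p) h (?g (snd p))))"
    by (rule continuous_on_compose2[OF Q1(1) cont_upd]) (use upd in force)
  have c2: "continuous_on (?R \<times> {0..1}) (\<lambda>p. Q2 (upd_var (fst p) h (?g (snd p))))"
    by (rule continuous_on_compose2[OF Q2(1) cont_upd]) (use upd in force)
  have "continuous_on (?R \<times> cbox 0 1) (\<lambda>(z, t).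
        Re (conj_kernel (z0 $ h) r t (z $ h)) * Q1 (upd_var z h (?g t))
        - Im (conj_kernel (z0 $ h) r t (z $ h)) * Q2 (upd_var z h (?g t)))"
    unfolding split_beta cbox_interval
    by (intro continuous_on_diff continuous_on_mult continuous_on_Re continuous_on_Im
        cont_k[unfolded split_beta] c1 c2)
  from integral_continuous_on_param[OF this]
  have "continuous_on ?R Q"
    by (simp add: Q_def[abs_def] conj_integral_def)
  moreover have "\<phi> (B \<union> insert h C) z = (\<Prod>l\<in>insert h C. Im (z $ l)) * Q z" if z: "z \<in> ?R" for z
  proof -
    have hBC: "h \<notin> B \<union> C" using insert.prems(1) insert.hyps by auto
    let ?p = "\<Prod>l\<in>C. Im (z $ l)"
    have p: "(\<Prod>l\<in>C. Im (upd_var z h w $ l)) = ?p" for w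
      using insert.hyps by (intro prod.cong) auto
    have e1: "\<phi> (B \<union> C) (upd_var z h (?g t)) = ?p * Q1 (upd_var z h (?g t))" for t
      using Q1(2)[of "upd_var z h (?g t)"] upd[OF z, of t] p by auto
    have e2: "\<phi> (insert h (B \<union> C)) (upd_var z h (?g t)) = ?p * Q2 (upd_var z h (?g t))" for t
      using Q2(2)[of "upd_var z h (?g t)"] upd[OF z, of t] p by auto
    have "\<phi> (B \<union> insert h C) z = \<phi> (insert h (B \<union> C)) z" by simp
    also have "\<dots> = Im (z $ h) * conj_integral (z0 $ h) r (z $ h)
        (\<lambda>w. \<phi> (B \<union> C) (upd_var z h w)) (\<lambda>w. \<phi> (insert h (B \<union> C)) (upd_var z h w))"
      by (rule insert.prems(3)) (use z hBC in auto)
    also have "\<dots> = Im (z $ h) * integral {0..1} (\<lambda>t. ?p *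
        (Re (conj_kernel (z0 $ h) r t (z $ h)) * Q1 (upd_var z h (?g t))
        - Im (conj_kernel (z0 $ h) r t (z $ h)) * Q2 (upd_var z h (?g t))))"
      unfolding conj_integral_def e1 e2 by (simp add: algebra_simps)
    also have "\<dots> = Im (z $ h) * (?p * Q z)"
      by (simp only: Q_def conj_integral_def integral_mult_right)
    finally show ?thesis using insert.hyps by simp
  qed
  ultimately show ?case by blast
qed

lemma upd_var_has_derivative:
  fixes z :: "complex ^ 'n"
  shows "((\<lambda>w. upd_var z h w) has_derivative (\<lambda>s. axis h s)) (at w)"
proof -
  have eq: "(\<lambda>w. upd_var z h w) = (\<lambda>w. upd_var z h 0 + axis h w)"
    by (auto simp: fun_eq_iff vec_eq_iff axis_def)
  have "bounded_linear (axis h :: complex \<Rightarrow> complex ^ 'n)"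
    by (intro linear_conv_bounded_linear[THEN iffD1] linearI) (auto simp: vec_eq_iff axis_def)
  from has_derivative_add[OF has_derivative_const bounded_linear_imp_has_derivative[OF this]]
  show ?thesis by (subst eq) simp
qed

text \<open>For each pair of index sets \<open>K\<close> and \<open>insert h K\<close> the equations
  of slice regularity are the Cauchy-Riemann equations in the variable \<open>h\<close>. The complex
  derivative is \<open>Complex p (- q)\<close>, with \<open>p\<close> and \<open>q\<close> the two
  partial derivatives of the component with index \<open>K\<close>.\<close>

lemma slice_regular_holomorphic:
  fixes F :: "('m::finite, 'n::finite) stem_fun"
  assumes d: "F differentiable (at (upd_var z h w))" and h: "h \<notin> K"
    and cr1: "frechet_derivative (\<lambda>w. F w $ K) (at (upd_var z h w)) (axis h 1)
             = frechet_derivative (\<lambda>w. F w $ insert h K) (at (upd_var z h w)) (axis h \<i>)"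
    and cr2: "frechet_derivative (\<lambda>w. F w $ K) (at (upd_var z h w)) (axis h \<i>)
             = - frechet_derivative (\<lambda>w. F w $ insert h K) (at (upd_var z h w)) (axis h 1)"
  shows "(\<lambda>w. Complex (F (upd_var z h w) $ K $ A) (F (upd_var z h w) $ insert h K $ A)) field_differentiable (at w)"
proof -
  let ?y = "upd_var z h w"
  obtain F' where F': "(F has_derivative F') (at ?y)"
    using d by (auto simp: differentiable_def)
  have lin: "linear F'" using has_derivative_linear[OF F'] .
  have fr: "frechet_derivative (\<lambda>w. F w $ L) (at ?y) = (\<lambda>s. F' s $ L)" for L
    using frechet_derivative_at[OF bounded_linear.has_derivative[OF bounded_linear_vec_nth F']] by simp
  define p q where "p = F' (axis h 1) $ K $ A" and "q = F' (axis h \<i>) $ K $ A"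
  have ax: "axis h s = Re s *\<^sub>R axis h 1 + Im s *\<^sub>R (axis h \<i> :: complex ^ 'n)" for s
    by (auto simp: vec_eq_iff axis_def complex_eq_iff)
  have FK: "F' (axis h s) $ L $ A = Re s * (F' (axis h 1) $ L $ A) + Im s * (F' (axis h \<i>) $ L $ A)" for s L
    by (subst ax) (simp add: linear_add[OF lin] linear_cmul[OF lin])
  have "F' (axis h \<i>) $ insert h K $ A = p" "F' (axis h 1) $ insert h K $ A = - q"
    using cr1 cr2 by (simp_all add: fr p_def q_def)
  then have u': "F' (axis h s) $ K $ A = Re s * p + Im s * q"
    and v': "F' (axis h s) $ insert h K $ A = - Re s * q + Im s * p" for s
    using FK[of s K] FK[of s "insert h K"] by (simp_all add: p_def q_def)
  have D: "((\<lambda>w. F (upd_var z h w) $ L $ A) has_derivative (\<lambda>s. F' (axis h s) $ L $ A)) (at w)" for L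
    by (intro bounded_linear.has_derivative[OF bounded_linear_vec_nth] has_derivative_compose[OF upd_var_has_derivative F'])
  have "((\<lambda>w. complex_of_real (F (upd_var z h w) $ K $ A) + \<i> * complex_of_real (F (upd_var z h w) $ insert h K $ A))
      has_derivative (\<lambda>s. complex_of_real (F' (axis h s) $ K $ A) + \<i> * complex_of_real (F' (axis h s) $ insert h K $ A))) (at w)"
    by (intro derivative_intros D)
  also have "(\<lambda>s. complex_of_real (F' (axis h s) $ K $ A) + \<i> * complex_of_real (F' (axis h s) $ insert h K $ A)) =
      (\<lambda>s. Complex p (- q) * s)"
    by (auto simp: u' v' complex_eq_iff fun_eq_iff algebra_simps)
  finally show ?thesis
    unfolding field_differentiable_def has_field_derivative_def Complex_eq by blast
qed

section \<open>Approaching real points through non-real ones\<close>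

lemma at_within_nontrivial_path:
  fixes p :: "real \<Rightarrow> 'a::topological_space"
  assumes "(p \<longlongrightarrow> x) (at_right 0)" "eventually (\<lambda>t. p t \<in> S \<and> p t \<noteq> x) (at_right 0)"
  shows "at x within S \<noteq> bot"
proof
  assume "at x within S = bot"
  moreover have "filterlim p (at x within S) (at_right 0)"
    using assms by (simp add: filterlim_at)
  ultimately have "at_right (0::real) = bot"
    by (simp add: filterlim_def filtermap_bot_iff bot_unique)
  then show False by simp
qed

lemma eventually_add_scaleR_nonzero:
  fixes a e :: "'a::real_normed_vector"
  assumes "e \<noteq> 0"
  shows "eventually (\<lambda>t. a + t *\<^sub>R e \<noteq> 0) (at_right 0)"
proof (cases "a = 0")
  case True
  with assms show ?thesis by (auto simp: eventually_at_filter)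
next
  case False
  have "((\<lambda>t. a + t *\<^sub>R e) \<longlongrightarrow> a + 0 *\<^sub>R e) (at_right 0)" by (intro tendsto_intros)
  with False show ?thesis using tendsto_imp_eventually_ne by fastforce
qed

definition nonreal_set :: "(complex ^ 'n) set \<Rightarrow> 'n set \<Rightarrow> (complex ^ 'n) set"
  where "nonreal_set D C = {z \<in> D. \<forall>l\<in>C. Im (z $ l) \<noteq> 0}"

text \<open>A limit determines \<open>Lim\<close> only along a filter other than \<open>bot\<close>.
  Shifting all coordinates by a small imaginary amount leaves the excluded set, because each
  coordinate excludes at most one value of \<open>t\<close>.\<close>

lemma nonreal_set_nontrivial:
  fixes z0 :: "complex ^ 'n::finite"
  assumes "open D" "z0 \<in> D"
  shows "at z0 within nonreal_set D C \<noteq> bot"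
proof (rule at_within_nontrivial_path[where p = "\<lambda>t. z0 + t *\<^sub>R (\<chi> l. \<i>)"])
  have "((\<lambda>t. z0 + t *\<^sub>R (\<chi> l. \<i>)) \<longlongrightarrow> z0 + 0 *\<^sub>R (\<chi> l. \<i>)) (at_right 0)" by (intro tendsto_intros)
  then show lim: "((\<lambda>t. z0 + t *\<^sub>R (\<chi> l. \<i>)) \<longlongrightarrow> z0) (at_right 0)" by simp
  have "eventually (\<lambda>t. z0 + t *\<^sub>R (\<chi> l. \<i>) \<in> D) (at_right 0)"
    by (rule topological_tendstoD[OF lim assms])
  moreover have "eventually (\<lambda>t. \<forall>l\<in>UNIV. Im (z0 $ l) + t *\<^sub>R 1 \<noteq> 0) (at_right 0)"
    by (intro eventually_ball_finite finite ballI eventually_add_scaleR_nonzero) simp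
  moreover have "eventually (\<lambda>t::real. t > 0) (at_right 0)"
    by (simp add: eventually_at_right_less)
  ultimately show "eventually (\<lambda>t. z0 + t *\<^sub>R (\<chi> l. \<i>) \<in> nonreal_set D C \<and> z0 + t *\<^sub>R (\<chi> l. \<i>) \<noteq> z0) (at_right 0)"
  proof eventually_elim
    case (elim t)
    then show ?case by (auto simp: nonreal_set_def vec_eq_iff)
  qed
qed

lemma nonreal_points_nontrivial:
  fixes x :: "('m::{finite,linorder}, 'n::finite) points"
  assumes "open U" "x \<in> U"
  shows "at x within (U \<inter> nonreal_points H) \<noteq> bot"
proof (rule at_within_nontrivial_path)
  define v :: "('m, 'n) points" where "v = (\<chi> l. (0, axis undefined 1))"
  have "((\<lambda>t. x + t *\<^sub>R v) \<longlongrightarrow> x + 0 *\<^sub>R v) (at_right 0)" by (intro tendsto_intros)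
  then show lim: "((\<lambda>t. x + t *\<^sub>R v) \<longlongrightarrow> x) (at_right 0)" by simp
  have "eventually (\<lambda>t. x + t *\<^sub>R v \<in> U) (at_right 0)"
    by (rule topological_tendstoD[OF lim assms])
  moreover have "eventually (\<lambda>t. \<forall>l\<in>UNIV. snd (x $ l) + t *\<^sub>R axis undefined 1 \<noteq> 0) (at_right 0)"
    by (intro eventually_ball_finite finite ballI eventually_add_scaleR_nonzero) (simp add: axis_eq_0_iff)
  moreover have "eventually (\<lambda>t::real. t > 0) (at_right 0)"
    by (simp add: eventually_at_right_less)
  ultimately show "eventually (\<lambda>t. x + t *\<^sub>R v \<in> U \<inter> nonreal_points H \<and> x + t *\<^sub>R v \<noteq> x) (at_right 0)"
  proof eventually_elim
    case (elim t)
    moreover have "v \<noteq> 0"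
      by (auto simp: v_def vec_eq_iff prod_eq_iff axis_def)
    ultimately show ?case by (auto simp: nonreal_points_def v_def)
  qed
qed

definition stem_CR :: "(complex ^ 'n::finite) set \<Rightarrow> ('m::finite, 'n) stem_fun \<Rightarrow> bool" where
  "stem_CR D F \<longleftrightarrow> C_k_on 1 F D \<and>
        (\<forall>z\<in>D. \<forall>h K. h \<notin> K \<longrightarrow>
           frechet_derivative (\<lambda>w. F w $ K) (at z) (axis h 1)
             = frechet_derivative (\<lambda>w. F w $ (insert h K)) (at z) (axis h \<i>) \<and>
           frechet_derivative (\<lambda>w. F w $ K) (at z) (axis h \<i>)
             = - frechet_derivative (\<lambda>w. F w $ (insert h K)) (at z) (axis h 1))"

lemma slice_regular_iff: "slice_regular D f \<longleftrightarrow> (\<exists>F. stem_of D f F \<and> stem_CR D F)"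
  by (simp add: slice_regular_def stem_CR_def)

lemma open_polydisc:
  fixes z0 :: "'a::metric_space ^ 'n"
  shows "open {z. \<forall>l\<in>C. dist (z0 $ l) (z $ l) < r}"
proof -
  have "{z. \<forall>l\<in>C. dist (z0 $ l) (z $ l) < r} = (\<Inter>l\<in>C. {z. dist (z0 $ l) (z $ l) < r})" by auto
  moreover have "open {z::'a ^ 'n. dist (z0 $ l) (z $ l) < r}" for l
    by (intro open_Collect_less continuous_intros)
  ultimately show ?thesis by auto
qed

lemma open_contains_polydisc:
  fixes z0 :: "'a::metric_space ^ 'n"
  assumes "open D" "z0 \<in> D"
  obtains \<rho> where "\<rho> > 0" "{z. \<forall>l. dist (z0 $ l) (z $ l) < \<rho>} \<subseteq> D"
proof -
  obtain e where e: "e > 0" "ball z0 e \<subseteq> D" using assms open_contains_ball by blast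
  have "{z. \<forall>l. dist (z0 $ l) (z $ l) < e / CARD('n)} \<subseteq> ball z0 e"
  proof
    fix z assume z: "z \<in> {z. \<forall>l. dist (z0 $ l) (z $ l) < e / CARD('n)}"
    have "dist z0 z \<le> (\<Sum>l\<in>UNIV. dist (z0 $ l) (z $ l))"
      unfolding dist_vec_def by (rule L2_set_le_sum) simp
    also have "\<dots> < (\<Sum>l\<in>(UNIV :: 'n set). e / CARD('n))"
      using z by (intro sum_strict_mono) auto
    finally show "z \<in> ball z0 e" by simp
  qed
  with e that[of "e / CARD('n)"] show ?thesis by auto
qed

text \<open>The Cauchy argument needs circles with real centres, so it is applied only to the
  indices \<open>C0\<close> whose coordinate of \<open>z0\<close> is real. The indices in
  \<open>C1\<close> are counted with \<open>B\<close> there; their imaginary parts do not vanish at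
  \<open>z0\<close> and are divided out by continuity.\<close>

lemma stem_quotient_component_limit:
  fixes F :: "('m::finite, 'n::finite) stem_fun"
  assumes D: "open D" "symmetric_domain D" and F: "stem_function D F" and CR: "stem_CR D F"
    and z0: "z0 \<in> D" and BC: "B \<inter> C = {}"
  shows "\<exists>q. ((\<lambda>z. inverse (\<Prod>l\<in>C. Im (z $ l)) * (F z $ (B \<union> C) $ A)) \<longlongrightarrow> q) (at z0 within nonreal_set D C)"
proof -
  obtain \<rho> where \<rho>: "\<rho> > 0" "{z. \<forall>l. dist (z0 $ l) (z $ l) < \<rho>} \<subseteq> D"
    using open_contains_polydisc[OF D(1) z0] .
  define P where "P = {z. \<forall>l. dist (z0 $ l) (z $ l) < \<rho>}"
  define r where "r = \<rho> / 2"
  define C0 where "C0 = {l \<in> C. Im (z0 $ l) = 0}"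
  define C1 where "C1 = {l \<in> C. Im (z0 $ l) \<noteq> 0}"
  have C01: "C = C0 \<union> C1" "C0 \<inter> C1 = {}" by (auto simp: C0_def C1_def)
  have r: "0 < r" "r < \<rho>" using \<rho> by (auto simp: r_def)
  have PD: "P \<subseteq> D" using \<rho> by (simp add: P_def)
  have dF: "F differentiable (at z)" if "z \<in> D" for z
    using CR that C_k_on_differentiable[of 1 F D z] by (simp add: stem_CR_def)
  have cF: "continuous_on D F"
    using CR C_k_on_imp_continuous by (auto simp: stem_CR_def)
  define \<phi> where "\<phi> = (\<lambda>K z. F z $ K $ A)"
  have cont: "continuous_on P (\<phi> K)" for K
    unfolding \<phi>_def by (intro continuous_intros continuous_on_subset[OF cF PD])
  have "\<exists>Q. continuous_on {z \<in> P. \<forall>l\<in>C0. dist (z0 $ l) (z $ l) < r} Q \<and>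
    (\<forall>z \<in> P. (\<forall>l\<in>C0. dist (z0 $ l) (z $ l) < r) \<longrightarrow> \<phi> ((B \<union> C1) \<union> C0) z = (\<Prod>l\<in>C0. Im (z $ l)) * Q z)"
  proof (rule iterated_Im_quotient[OF P_def r cont])
    show "(B \<union> C1) \<inter> C0 = {}" using BC C01 by auto
    show re: "Im (z0 $ h) = 0" if "h \<in> C0" for h using that by (simp add: C0_def)
    fix h K z assume h: "h \<in> C0" "h \<notin> K" and z: "z \<in> P" and d: "dist (z0 $ h) (z $ h) < r"
    have updP: "upd_var z h w \<in> P" if "w \<in> ball (z0 $ h) \<rho>" for w
      using z that by (auto simp: P_def)
    have conj: "upd_var z h (cnj (z $ h)) = conj_var h z"
      by (auto simp: vec_eq_iff conj_var_def)
    have "\<phi> (insert h K) (upd_var z h (z $ h)) = Im (z $ h) * conj_integral (z0 $ h) r (z $ h)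
        (\<lambda>w. \<phi> K (upd_var z h w)) (\<lambda>w. \<phi> (insert h K) (upd_var z h w))"
    proof (rule Im_factor_integral[OF _ re[OF h(1)] r])
      show "(\<lambda>w. Complex (\<phi> K (upd_var z h w)) (\<phi> (insert h K) (upd_var z h w))) holomorphic_on ball (z0 $ h) \<rho>"
        unfolding holomorphic_on_def \<phi>_def
      proof
        fix w assume "w \<in> ball (z0 $ h) \<rho>"
        then have y: "upd_var z h w \<in> D" using updP PD by blast
        have "(\<lambda>w. Complex (F (upd_var z h w) $ K $ A) (F (upd_var z h w) $ insert h K $ A)) field_differentiable (at w)"
          by (rule slice_regular_holomorphic[OF dF[OF y] h(2)]) (use CR y h(2) in \<open>auto simp: stem_CR_def\<close>)
        then show "(\<lambda>w. Complex (F (upd_var z h w) $ K $ A) (F (upd_var z h w) $ insert h K $ A))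
            field_differentiable (at w within ball (z0 $ h) \<rho>)"
          by (rule field_differentiable_at_within)
      qed
      show "z $ h \<in> ball (z0 $ h) r" using d by simp
      show "\<phi> K (upd_var z h (cnj (z $ h))) = \<phi> K (upd_var z h (z $ h))"
        "\<phi> (insert h K) (upd_var z h (cnj (z $ h))) = - \<phi> (insert h K) (upd_var z h (z $ h))"
        unfolding conj using F z PD h(2) by (auto simp: \<phi>_def stem_function_def)
    qed
    then show "\<phi> (insert h K) z = Im (z $ h) * conj_integral (z0 $ h) r (z $ h)
        (\<lambda>w. \<phi> K (upd_var z h w)) (\<lambda>w. \<phi> (insert h K) (upd_var z h w))"
      by simp
  qed
  then obtain Q where Q: "continuous_on {z \<in> P. \<forall>l\<in>C0. dist (z0 $ l) (z $ l) < r} Q"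
    and Qeq: "\<And>z. z \<in> P \<Longrightarrow> \<forall>l\<in>C0. dist (z0 $ l) (z $ l) < r \<Longrightarrow>
      \<phi> ((B \<union> C1) \<union> C0) z = (\<Prod>l\<in>C0. Im (z $ l)) * Q z" by blast
  let ?R = "{z \<in> P. \<forall>l\<in>C0. dist (z0 $ l) (z $ l) < r}"
  have "?R = {z. \<forall>l\<in>UNIV. dist (z0 $ l) (z $ l) < \<rho>} \<inter> {z. \<forall>l\<in>C0. dist (z0 $ l) (z $ l) < r}"
    by (auto simp: P_def)
  then have oR: "open ?R" by (simp only: open_polydisc open_Int)
  have z0R: "z0 \<in> ?R" using r by (auto simp: P_def)
  have "(Q \<longlongrightarrow> Q z0) (at z0)"
    using Q oR z0R by (simp add: continuous_on_eq_continuous_at isCont_def)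
  then have "(Q \<longlongrightarrow> Q z0) (at z0 within nonreal_set D C)"
    by (rule tendsto_within_subset) simp
  moreover have "(\<Prod>l\<in>C1. Im (z0 $ l)) \<noteq> 0" by (simp add: C1_def)
  ultimately have "((\<lambda>z. inverse (\<Prod>l\<in>C1. Im (z $ l)) * Q z) \<longlongrightarrow> inverse (\<Prod>l\<in>C1. Im (z0 $ l)) * Q z0)
      (at z0 within nonreal_set D C)"
    by (intro tendsto_intros)
  moreover have "eventually (\<lambda>z. inverse (\<Prod>l\<in>C1. Im (z $ l)) * Q z =
      inverse (\<Prod>l\<in>C. Im (z $ l)) * (F z $ (B \<union> C) $ A)) (at z0 within nonreal_set D C)"
    unfolding eventually_at_topological
  proof (intro exI[of _ ?R] conjI oR z0R ballI impI)
    fix z assume z: "z \<in> ?R" "z \<in> nonreal_set D C"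
    have BC': "(B \<union> C1) \<union> C0 = B \<union> C" using C01 by auto
    have "\<phi> (B \<union> C) z = (\<Prod>l\<in>C0. Im (z $ l)) * Q z"
      using Qeq[of z] z(1) by (simp add: BC')
    moreover have "(\<Prod>l\<in>C0. Im (z $ l)) \<noteq> 0" using z(2) by (auto simp: nonreal_set_def C0_def)
    moreover have "(\<Prod>l\<in>C. Im (z $ l)) = (\<Prod>l\<in>C0. Im (z $ l)) * (\<Prod>l\<in>C1. Im (z $ l))"
      by (subst C01(1), rule prod.union_disjoint) (use C01 in auto)
    ultimately show "inverse (\<Prod>l\<in>C1. Im (z $ l)) * Q z = inverse (\<Prod>l\<in>C. Im (z $ l)) * (F z $ (B \<union> C) $ A)"
      by (simp add: \<phi>_def)
  qed
  ultimately have "((\<lambda>z. inverse (\<Prod>l\<in>C. Im (z $ l)) * (F z $ (B \<union> C) $ A)) \<longlongrightarrow>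
      inverse (\<Prod>l\<in>C1. Im (z0 $ l)) * Q z0) (at z0 within nonreal_set D C)"
    by (rule Lim_transform_eventually)
  then show ?thesis by blast
qed

section \<open>The extended quotients and their parity\<close>

definition stem_quotient :: "('m::finite, 'n::finite) stem_fun \<Rightarrow> 'n set \<Rightarrow> 'n set \<Rightarrow> complex ^ 'n \<Rightarrow> 'm clifford"
  where "stem_quotient F B C z = inverse (\<Prod>l\<in>C. Im (z $ l)) *\<^sub>R (F z $ (B \<union> C))"

definition stem_quotient_ext ::
    "(complex ^ 'n) set \<Rightarrow> ('m::finite, 'n::finite) stem_fun \<Rightarrow> 'n set \<Rightarrow> 'n set \<Rightarrow> (complex, 'n) vec \<Rightarrow> 'm clifford"
  where "stem_quotient_ext D F B C z = Lim (at z within nonreal_set D C) (stem_quotient F B C)"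

lemma stem_quotient_tendsto:
  fixes F :: "('m::finite, 'n::finite) stem_fun"
  assumes D: "open D" "symmetric_domain D" and F: "stem_function D F" and CR: "stem_CR D F"
    and z0: "z0 \<in> D" and BC: "B \<inter> C = {}"
  shows "(stem_quotient F B C \<longlongrightarrow> stem_quotient_ext D F B C z0) (at z0 within nonreal_set D C)"
proof -
  have "\<forall>A. \<exists>q. ((\<lambda>z. inverse (\<Prod>l\<in>C. Im (z $ l)) * (F z $ (B \<union> C) $ A)) \<longlongrightarrow> q) (at z0 within nonreal_set D C)"
    using stem_quotient_component_limit[OF assms] by blast
  from choice[OF this] obtain q where
    q: "\<And>A. ((\<lambda>z. inverse (\<Prod>l\<in>C. Im (z $ l)) * (F z $ (B \<union> C) $ A)) \<longlongrightarrow> q A) (at z0 within nonreal_set D C)"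
    by blast
  have "(stem_quotient F B C \<longlongrightarrow> (\<chi> A. q A)) (at z0 within nonreal_set D C)"
    by (rule vec_tendstoI) (use q in \<open>simp add: stem_quotient_def[abs_def]\<close>)
  moreover from this have "stem_quotient_ext D F B C z0 = (\<chi> A. q A)"
    unfolding stem_quotient_ext_def
    by (intro tendsto_Lim nonreal_set_nontrivial[OF D(1) z0])
  ultimately show ?thesis by simp
qed

lemma stem_quotient_ext_eq:
  fixes F :: "('m::finite, 'n::finite) stem_fun"
  assumes D: "open D" "symmetric_domain D" and F: "stem_function D F" and CR: "stem_CR D F"
    and z: "z \<in> nonreal_set D C"
  shows "stem_quotient_ext D F B C z = stem_quotient F B C z"
proof -
  have zD: "z \<in> D" using z by (simp add: nonreal_set_def)
  have "continuous_on D F"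
    using CR C_k_on_imp_continuous by (auto simp: stem_CR_def)
  then have "isCont F z"
    using D(1) zD by (simp add: continuous_on_eq_continuous_at)
  then have "(F \<longlongrightarrow> F z) (at z within nonreal_set D C)"
    unfolding isCont_def by (rule tendsto_within_subset) simp
  then have "(stem_quotient F B C \<longlongrightarrow> stem_quotient F B C z) (at z within nonreal_set D C)"
    unfolding stem_quotient_def[abs_def] using z
    by (intro tendsto_intros) (auto simp: nonreal_set_def)
  then show ?thesis
    unfolding stem_quotient_ext_def
    by (intro tendsto_Lim nonreal_set_nontrivial[OF D(1) zD])
qed

lemma stem_factor:
  fixes F :: "('m::finite, 'n::finite) stem_fun"
  assumes D: "open D" "symmetric_domain D" and F: "stem_function D F" and CR: "stem_CR D F" and z: "z \<in> D"
  shows "F z $ (B \<union> C) = (\<Prod>l\<in>C. Im (z $ l)) *\<^sub>R stem_quotient_ext D F B C z"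
proof (cases "z \<in> nonreal_set D C")
  case True
  then have "(\<Prod>l\<in>C. Im (z $ l)) \<noteq> 0" by (simp add: nonreal_set_def)
  then show ?thesis
    by (simp add: stem_quotient_ext_eq[OF D F CR True] stem_quotient_def)
next
  case False
  then obtain l where l: "l \<in> C" "Im (z $ l) = 0" using z by (auto simp: nonreal_set_def)
  then have "(\<Prod>l\<in>C. Im (z $ l)) = 0" by (meson finite prod_zero)
  with stem_eq_0_real[OF D(2) F z, of l "B \<union> C"] l show ?thesis by simp
qed

text \<open>Off the real points the numerator changes by the sign of \<open>B \<union> C\<close> and
  the denominator by that of \<open>C\<close>, which leaves the sign of \<open>B\<close>;
  \<open>flip S\<close> is a homeomorphism preserving the non-real set, so this passes to the
  limit.\<close>

lemma stem_quotient_ext_flip: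
  fixes F :: "('m::finite, 'n::finite) stem_fun"
  assumes D: "open D" "symmetric_domain D" and F: "stem_function D F" and CR: "stem_CR D F" and z: "z \<in> D"
    and BC: "B \<inter> C = {}"
  shows "stem_quotient_ext D F B C (flip S z) = chr S B *\<^sub>R stem_quotient_ext D F B C z"
proof -
  have nr: "flip S y \<in> nonreal_set D C" if "y \<in> nonreal_set D C" for y
    using that flip_in_domain[OF D(2)] by (auto simp: nonreal_set_def)
  have sym: "sym_diff B C = B \<union> C" using BC by auto
  have eq: "stem_quotient F B C (flip S y) = chr S B *\<^sub>R stem_quotient F B C y" if "y \<in> nonreal_set D C" for y
  proof -
    have "F (flip S y) $ (B \<union> C) = (chr S B * chr S C) *\<^sub>R (F y $ (B \<union> C))"
      using stem_flip[OF D(2) F, of y S "sym_diff B C"] that chr_sym_diff[of S B C]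
      unfolding sym by (simp add: nonreal_set_def)
    moreover have "inverse (chr S C) = chr S C" by (rule inverse_unique[OF chr_mult_self])
    moreover have "chr S C * p * (chr S B * chr S C) = chr S B * p" for p
    proof -
      have "chr S C * p * (chr S B * chr S C) = chr S B * p * (chr S C * chr S C)" by (simp only: mult_ac)
      then show ?thesis by (simp add: chr_mult_self)
    qed
    ultimately show ?thesis
      by (simp only: stem_quotient_def prod_Im_flip inverse_mult_distrib scaleR_scaleR)
  qed
  have "((\<lambda>y. stem_quotient F B C (flip S y)) \<longlongrightarrow> stem_quotient_ext D F B C (flip S z)) (at z within nonreal_set D C)"
  proof (rule filterlim_compose[OF stem_quotient_tendsto[OF D F CR flip_in_domain[OF D(2) z] BC]])
    have "continuous_on UNIV (flip S :: complex ^ 'n \<Rightarrow> _)"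
    proof -
      have "continuous_on UNIV (\<lambda>y. if l \<in> S then cnj (y $ l) else (y $ l :: complex))" for l :: 'n
        by (cases "l \<in> S") (auto intro!: continuous_intros)
      then show ?thesis unfolding flip_def[abs_def] continuous_on_def
        by (intro ballI tendsto_vec_lambda) (simp add: continuous_on_def)
    qed
    then have "(flip S \<longlongrightarrow> flip S z) (at z within nonreal_set D C)"
      by (metis UNIV_I continuous_on_def subset_UNIV tendsto_within_subset)
    moreover have "eventually (\<lambda>y. flip S y \<in> nonreal_set D C \<and> flip S y \<noteq> flip S z) (at z within nonreal_set D C)"
      unfolding eventually_at_topological
      by (intro exI[of _ UNIV]) (use nr in \<open>auto dest: arg_cong[of _ _ "flip S"] simp: flip_flip\<close>)
    ultimately show "filterlim (flip S) (at (flip S z) within nonreal_set D C) (at z within nonreal_set D C)"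
      by (simp add: filterlim_at)
  qed
  moreover have "((\<lambda>y. stem_quotient F B C (flip S y)) \<longlongrightarrow> chr S B *\<^sub>R stem_quotient_ext D F B C z) (at z within nonreal_set D C)"
  proof (rule Lim_transform_eventually)
    show "((\<lambda>y. chr S B *\<^sub>R stem_quotient F B C y) \<longlongrightarrow> chr S B *\<^sub>R stem_quotient_ext D F B C z) (at z within nonreal_set D C)"
      by (intro tendsto_intros stem_quotient_tendsto[OF D F CR z BC])
    show "eventually (\<lambda>y. chr S B *\<^sub>R stem_quotient F B C y = stem_quotient F B C (flip S y)) (at z within nonreal_set D C)"
      unfolding eventually_at_topological by (intro exI[of _ UNIV]) (use eq in auto)
  qed
  ultimately show ?thesis
    by (rule tendsto_unique[OF nonreal_set_nontrivial[OF D(1) z]])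
qed

section \<open>Extension of the spherical derivative to real points\<close>

lemma tendsto_bracket:
  assumes "\<And>l. l \<in> K \<Longrightarrow> ((\<lambda>y. J y l) \<longlongrightarrow> J0 l) Fl" "(a \<longlongrightarrow> a0) Fl"
  shows "((\<lambda>y. bracket (J y) K (a y)) \<longlongrightarrow> bracket J0 K a0) Fl"
proof -
  have "((\<lambda>y. foldr (\<lambda>k b. of_paravector (J y k) \<star> b) ks (a y)) \<longlongrightarrow>
      foldr (\<lambda>k b. of_paravector (J0 k) \<star> b) ks a0) Fl" if "set ks \<subseteq> K" for ks
    using that
  proof (induction ks)
    case Nil
    then show ?case using assms(2) by simp
  next
    case (Cons k ks)
    then have "((\<lambda>y. of_paravector (J y k) \<star> foldr (\<lambda>k b. of_paravector (J y k) \<star> b) ks (a y)) \<longlongrightarrow>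
        of_paravector (J0 k) \<star> foldr (\<lambda>k b. of_paravector (J0 k) \<star> b) ks a0) Fl"
      by (intro clifford.tendsto bounded_linear.tendsto[OF bounded_linear_of_paravector] assms(1)) auto
    then show ?case by simp
  qed
  then show ?thesis by (simp add: bracket_def)
qed

text \<open>For approach to a real coordinate, where the units need not converge but the component
  they multiply tends to 0.\<close>

lemma tendsto_bracket_zero:
  assumes "\<And>y l. norm (J y l) \<le> 1" "(a \<longlongrightarrow> 0) Fl"
  shows "((\<lambda>y. bracket (J y) K (a y)) \<longlongrightarrow> 0) Fl"
proof -
  obtain M where M: "\<And>(J :: 'b \<Rightarrow> 'c paravector) a. (\<And>l. norm (J l) \<le> 1) \<Longrightarrow> norm (bracket J K a) \<le> M * norm a"
    using norm_bracket_le[of K] by blast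
  show ?thesis
  proof (rule Lim_null_comparison)
    show "eventually (\<lambda>y. norm (bracket (J y) K (a y)) \<le> M * norm (a y)) Fl"
      using M assms(1) by (intro always_eventually allI) blast
    show "((\<lambda>y. M * norm (a y)) \<longlongrightarrow> 0) Fl"
      using tendsto_mult[OF tendsto_const[of M] tendsto_norm[OF assms(2)]] by simp
  qed
qed

lemma norm_imag_unit_le: "norm (imag_unit w) \<le> 1"
  by (simp add: imag_unit_def norm_Pair norm_sgn)

lemma tendsto_imag_unit:
  fixes x :: "('m::finite, 'n::finite) points"
  assumes "snd (x $ l) \<noteq> 0"
  shows "((\<lambda>y. imag_unit (y $ l)) \<longlongrightarrow> imag_unit (x $ l)) (at x within S)"
  unfolding imag_unit_def using assms by (intro tendsto_intros)

text \<open>Component \<open>B \<union> H\<close> of the product of \<open>f\<close> with the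
  coordinates of \<open>K\<close> is a sum over \<open>A \<subseteq> K\<close> of monomials times
  \<open>F z $ (B \<union> H - A)\<close>. On division by all imaginary parts of \<open>H\<close>
  those of \<open>A\<close> cancel against the monomial, and the quotient by those of
  \<open>H - A\<close> is replaced by its extension.\<close>

definition S_stem :: "(complex ^ 'n) set \<Rightarrow> ('m::finite, 'n::finite) stem_fun \<Rightarrow> 'n set \<Rightarrow> 'n set \<Rightarrow> ('m, 'n) stem_fun"
  where "S_stem D F H K z = (\<chi> B. if B \<inter> H = {} then
    (\<Sum>A\<in>Pow K. (\<Prod>l\<in>K - A. Re (z $ l)) *\<^sub>R stem_quotient_ext D F B (H - A) z) else 0)"

lemma stem_function_S_stem:
  fixes F :: "('m::finite, 'n::finite) stem_fun"
  assumes D: "open D" "symmetric_domain D" and F: "stem_function D F" and CR: "stem_CR D F"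
  shows "stem_function D (S_stem D F H K)"
proof (rule stem_functionI)
  fix z h B assume z: "z \<in> D"
  have re: "(\<Prod>l\<in>K - A. Re (flip {h} z $ l)) = (\<Prod>l\<in>K - A. Re (z $ l))" for A
    by (intro prod.cong) auto
  have "stem_quotient_ext D F B (H - A) (flip {h} z) = chr {h} B *\<^sub>R stem_quotient_ext D F B (H - A) z"
    if "B \<inter> H = {}" for A
    by (rule stem_quotient_ext_flip[OF D F CR z]) (use that in auto)
  then show "S_stem D F H K (flip {h} z) $ B = chr {h} B *\<^sub>R (S_stem D F H K z $ B)"
    by (simp add: S_stem_def re scaleR_sum_right mult.commute del: flip_nth)
qed

lemma slice_coords_nonreal:
  "symmetric_domain D \<Longrightarrow> y \<in> circular D \<inter> nonreal_points H \<Longrightarrow> C \<subseteq> H \<Longrightarrow> slice_coords y \<in> nonreal_set D C"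
  using circular_iff by (auto simp: nonreal_set_def nonreal_points_def slice_coords_def)

lemma induced_sph_deriv_eq:
  fixes F F' :: "('m::{finite,linorder}, 'n::{finite,linorder}) stem_fun"
  assumes D: "open D" "symmetric_domain D" and F: "stem_function D F" and CR: "stem_CR D F"
    and K: "K \<subseteq> H" and y: "y \<in> circular D \<inter> nonreal_points H"
    and F': "\<And>L. K \<subseteq> L \<Longrightarrow> F' (slice_coords y) $ L =
      (\<Sum>A\<in>Pow K. coord_monomial K A (slice_coords y) *\<^sub>R (F (slice_coords y) $ (L - A)))"
  shows "induced (stem_sph_deriv H F') y = induced (S_stem D F H K) y"
proof (rule induced_cong)
  define z where "z = slice_coords y"
  have z: "z \<in> nonreal_set D C" if "C \<subseteq> H" for C
    unfolding z_def using slice_coords_nonreal[OF D(2) y that] .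
  have "stem_sph_deriv H F' z $ B = S_stem D F H K z $ B" for B
  proof (cases "B \<inter> H = {}")
    case True
    have "inverse (\<Prod>h\<in>H. Im (z $ h)) *\<^sub>R (F' z $ (B \<union> H)) =
        (\<Sum>A\<in>Pow K. (inverse (\<Prod>h\<in>H. Im (z $ h)) * coord_monomial K A z) *\<^sub>R (F z $ (B \<union> H - A)))"
      using F'[of "B \<union> H"] K by (simp add: z_def scaleR_sum_right le_supI2)
    also have "\<dots> = (\<Sum>A\<in>Pow K. (\<Prod>l\<in>K - A. Re (z $ l)) *\<^sub>R stem_quotient_ext D F B (H - A) z)"
    proof (rule sum.cong[OF refl])
      fix A assume A: "A \<in> Pow K"
      have BA: "B \<union> H - A = B \<union> (H - A)" using A K True by auto
      have H: "(\<Prod>h\<in>H. Im (z $ h)) = (\<Prod>h\<in>H - A. Im (z $ h)) * (\<Prod>h\<in>A. Im (z $ h))"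
        using A K by (subst prod.subset_diff[of A H]) auto
      have "(\<Prod>h\<in>A. Im (z $ h)) \<noteq> 0"
        using z[OF order_refl] A K by (auto simp: nonreal_set_def)
      then have "inverse (\<Prod>h\<in>H. Im (z $ h)) * coord_monomial K A z =
          (\<Prod>l\<in>K - A. Re (z $ l)) * inverse (\<Prod>h\<in>H - A. Im (z $ h))"
        by (simp add: H coord_monomial_def field_simps)
      then show "(inverse (\<Prod>h\<in>H. Im (z $ h)) * coord_monomial K A z) *\<^sub>R (F z $ (B \<union> H - A)) =
          (\<Prod>l\<in>K - A. Re (z $ l)) *\<^sub>R stem_quotient_ext D F B (H - A) z"
        using stem_quotient_ext_eq[OF D F CR z[of "H - A"], of B]
        by (simp add: stem_quotient_def BA)
    qed
    finally show ?thesis using True by (simp add: stem_sph_deriv_def S_stem_def)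
  qed (simp add: stem_sph_deriv_def S_stem_def)
  then show "stem_sph_deriv H F' (slice_coords y) = S_stem D F H K (slice_coords y)"
    by (simp add: vec_eq_iff z_def)
qed

text \<open>The filter includes \<open>z0\<close> itself when it is non-real. A punctured one could
  not be composed with \<open>slice_coords\<close>, which is not injective and may send points other
  than \<open>x\<close> to \<open>slice_coords x\<close>.\<close>

lemma stem_quotient_ext_tendsto:
  fixes F :: "('m::finite, 'n::finite) stem_fun"
  assumes D: "open D" "symmetric_domain D" and F: "stem_function D F" and CR: "stem_CR D F"
    and z0: "z0 \<in> D" and BC: "B \<inter> C = {}"
  shows "(stem_quotient_ext D F B C \<longlongrightarrow> stem_quotient_ext D F B C z0) (inf (nhds z0) (principal (nonreal_set D C)))"
proof (rule topological_tendstoI)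
  fix S assume S: "open S" "stem_quotient_ext D F B C z0 \<in> S"
  from topological_tendstoD[OF stem_quotient_tendsto[OF D F CR z0 BC] this]
  obtain T where T: "open T" "z0 \<in> T"
    "\<And>z. z \<in> T \<Longrightarrow> z \<noteq> z0 \<Longrightarrow> z \<in> nonreal_set D C \<Longrightarrow> stem_quotient F B C z \<in> S"
    unfolding eventually_at_topological by blast
  then have "stem_quotient_ext D F B C z \<in> S" if "z \<in> T" "z \<in> nonreal_set D C" for z
    using that S(2) stem_quotient_ext_eq[OF D F CR that(2), of B] by (cases "z = z0") auto
  then show "eventually (\<lambda>z. stem_quotient_ext D F B C z \<in> S) (inf (nhds z0) (principal (nonreal_set D C)))"
    unfolding eventually_inf_principal eventually_nhds using T by blast
qed

lemma induced_S_stem_tendsto: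
  fixes F :: "('m::{finite,linorder}, 'n::{finite,linorder}) stem_fun"
  assumes D: "open D" "symmetric_domain D" and F: "stem_function D F" and CR: "stem_CR D F"
    and x: "x \<in> circular D"
  shows "(induced (S_stem D F H K) \<longlongrightarrow> induced (S_stem D F H K) x) (at x within (circular D \<inter> nonreal_points H))"
  unfolding induced_def
proof (rule tendsto_sum)
  fix B
  let ?F = "at x within (circular D \<inter> nonreal_points H)"
  have zx: "slice_coords x \<in> D" using x circular_iff[OF D(2)] by blast
  have lim: "((\<lambda>y. S_stem D F H K (slice_coords y) $ B) \<longlongrightarrow> S_stem D F H K (slice_coords x) $ B) ?F"
  proof (cases "B \<inter> H = {}")
    case True
    have sc: "(slice_coords \<longlongrightarrow> slice_coords x) ?F"
      using continuous_slice_coords[of UNIV] unfolding continuous_on_def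
      by (meson UNIV_I subset_UNIV tendsto_within_subset)
    have q: "((\<lambda>y. stem_quotient_ext D F B (H - A) (slice_coords y)) \<longlongrightarrow>
        stem_quotient_ext D F B (H - A) (slice_coords x)) ?F" for A
    proof (rule filterlim_compose[OF stem_quotient_ext_tendsto[OF D F CR zx]])
      show "B \<inter> (H - A) = {}" using True by auto
      have "eventually (\<lambda>y. slice_coords y \<in> nonreal_set D (H - A)) ?F"
        unfolding eventually_at_topological
        using slice_coords_nonreal[OF D(2)] by (intro exI[of _ UNIV]) blast
      with sc show "filterlim slice_coords (inf (nhds (slice_coords x)) (principal (nonreal_set D (H - A)))) ?F"
        by (simp add: filterlim_inf filterlim_principal)
    qed
    have "((\<lambda>y. \<Sum>A\<in>Pow K. (\<Prod>l\<in>K - A. Re (slice_coords y $ l)) *\<^sub>R stem_quotient_ext D F B (H - A) (slice_coords y)) \<longlongrightarrow>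
        (\<Sum>A\<in>Pow K. (\<Prod>l\<in>K - A. Re (slice_coords x $ l)) *\<^sub>R stem_quotient_ext D F B (H - A) (slice_coords x))) ?F"
      by (intro tendsto_sum tendsto_scaleR q tendsto_prod tendsto_Re tendsto_vec_nth sc)
    with True show ?thesis by (simp add: S_stem_def)
  qed (simp add: S_stem_def)
  show "((\<lambda>y. bracket (\<lambda>l. imag_unit (y $ l)) B (S_stem D F H K (slice_coords y) $ B)) \<longlongrightarrow>
      bracket (\<lambda>l. imag_unit (x $ l)) B (S_stem D F H K (slice_coords x) $ B)) ?F"
  proof (cases "\<forall>l\<in>B. snd (x $ l) \<noteq> 0")
    case True
    then show ?thesis by (intro tendsto_bracket tendsto_imag_unit lim) auto
  next
    case False
    then obtain l where l: "l \<in> B" "snd (x $ l) = 0" by blast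
    \<comment> \<open>The index \<open>l\<close> lies outside \<open>H\<close> or the component is 0
      anyway, so approach through \<open>nonreal_points H\<close> does not control the unit at
      \<open>l\<close>. Oddness of the stem function makes up for it.\<close>
    have "S_stem D F H K (slice_coords x) $ B = 0"
      by (rule stem_eq_0_real[OF D(2) stem_function_S_stem[OF D F CR] zx l(1)]) (simp add: slice_coords_def l)
    with lim show ?thesis
      by (simp add: bracket_simps tendsto_bracket_zero norm_imag_unit_le)
  qed
qed

text \<open>On the non-real points \<open>S_stem\<close> gives the spherical derivative, and the
  induced function has there a limit equal to its own value; hence \<open>Lim\<close> yields the
  same formula at the real points.\<close>

lemma S_fun_eq_induced:
  fixes F :: "('m::{finite,linorder}, 'n::{finite,linorder}) stem_fun"
  assumes D: "open D" "symmetric_domain D" and F: "stem_of D f F" and CR: "stem_CR D F"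
    and K: "K \<subseteq> H" and x: "x \<in> circular D"
  shows "S_fun D H K f x = induced (S_stem D F H K) x"
proof -
  have sF: "stem_function D F" using F by (simp add: stem_of_def)
  let ?g = "foldr (\<lambda>k g. slice_mult D (coord_fun k) g) (sorted_list_of_set K) f"
  obtain F' where F': "stem_of D ?g F'"
    and eq: "\<And>z L. K \<subseteq> L \<Longrightarrow> F' z $ L = (\<Sum>A\<in>Pow K. coord_monomial K A z *\<^sub>R (F z $ (L - A)))"
    using stem_of_coord_mult[OF D(2) F, of "sorted_list_of_set K"] by auto
  have "(induced (stem_sph_deriv H (the_stem D ?g)) \<longlongrightarrow> induced (S_stem D F H K) x) (at x within (circular D \<inter> nonreal_points H))"
  proof (rule Lim_transform_eventually[OF induced_S_stem_tendsto[OF D sF CR x]])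
    show "eventually (\<lambda>y. induced (S_stem D F H K) y = induced (stem_sph_deriv H (the_stem D ?g)) y)
        (at x within (circular D \<inter> nonreal_points H))"
      unfolding eventually_at_topological
    proof (intro exI[of _ UNIV] conjI ballI impI)
      fix y :: "('m, 'n) points" assume y: "y \<in> circular D \<inter> nonreal_points H"
      have "the_stem D ?g (slice_coords y) = F' (slice_coords y)"
        using y circular_iff[OF D(2)] by (intro the_stem_eq[OF D(2) F']) blast
      then show "induced (S_stem D F H K) y = induced (stem_sph_deriv H (the_stem D ?g)) y"
        by (intro induced_sph_deriv_eq[symmetric, OF D sF CR K y]) (simp add: eq)
    qed auto
  qed
  then show ?thesis
    unfolding S_fun_def sph_deriv_def
    by (intro tendsto_Lim nonreal_points_nontrivial open_circular D x)
qed

section \<open>The Almansi components are slice functions\<close>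

lemma var_laplacian_upd:
  "var_laplacian g u (upd_var y g w) = laplacian (\<lambda>w. u (upd_var y g w)) w"
  by (simp add: var_laplacian_def)

text \<open>The definition tests the Laplacian of each point at its own coordinate. Since
  \<open>upd_var y g w\<close> is a point of the set with the same section, letting the point vary
  covers the whole section.\<close>

lemma polyharmonic_1_iff:
  "polyharmonic_in 1 g \<Omega> u \<longleftrightarrow> (\<forall>y\<in>\<Omega>. harmonic_on (\<lambda>w. u (upd_var y g w)) (var_section \<Omega> g y))"
proof safe
  fix y assume u: "polyharmonic_in 1 g \<Omega> u" and y: "y \<in> \<Omega>"
  have "laplacian (\<lambda>w. u (upd_var y g w)) w = 0" if "w \<in> var_section \<Omega> g y" for w
    using u that var_laplacian_upd[of g u y w] by (simp add: polyharmonic_in_def var_section_def)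
  then show "harmonic_on (\<lambda>w. u (upd_var y g w)) (var_section \<Omega> g y)"
    using u y by (simp add: polyharmonic_in_def harmonic_on_def)
next
  assume u: "\<forall>y\<in>\<Omega>. harmonic_on (\<lambda>w. u (upd_var y g w)) (var_section \<Omega> g y)"
  have "var_laplacian g u y = 0" if "y \<in> \<Omega>" for y
    using harmonic_onD(2)[OF bspec[OF u that], of "y $ g"] that
    by (simp add: var_laplacian_def var_section_def)
  with u show "polyharmonic_in 1 g \<Omega> u"
    by (simp add: polyharmonic_in_def harmonic_on_def)
qed

lemma polyharmonic_2I:
  assumes "\<And>y. y \<in> \<Omega> \<Longrightarrow> biharmonic_on (\<lambda>w. u (upd_var y g w)) (var_section \<Omega> g y)"
  shows "polyharmonic_in 2 g \<Omega> u"
proof -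
  have "(var_laplacian g ^^ 2) u y = 0" if y: "y \<in> \<Omega>" for y
  proof -
    have "(var_laplacian g ^^ 2) u y = laplacian (\<lambda>w. var_laplacian g u (upd_var y g w)) (y $ g)"
      by (simp add: numeral_2_eq_2 var_laplacian_def)
    also have "\<dots> = laplacian (laplacian (\<lambda>w. u (upd_var y g w))) (y $ g)"
      by (simp add: var_laplacian_upd)
    also have "\<dots> = 0"
      using assms[OF y] y by (simp add: biharmonic_on_def var_section_def)
    finally show ?thesis .
  qed
  then show ?thesis
    using assms by (simp add: polyharmonic_in_def biharmonic_on_def)
qed

lemma open_var_section:
  fixes \<Omega> :: "('a::topological_space ^ 'n) set"
  assumes "open \<Omega>"
  shows "open (var_section \<Omega> g y)"
proof -
  have "var_section \<Omega> g y = (\<lambda>w. upd_var y g w) -` \<Omega>" by (auto simp: var_section_def)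
  then show ?thesis
    by (simp add: open_vimage[OF assms] continuous_on_upd_var)
qed

lemma norm_power_upd: "g \<notin> G \<Longrightarrow> norm_power G T (upd_var x g w) = norm_power G T x"
  unfolding norm_power_def by (intro prod.cong) auto

text \<open>Induction on the variables in \<open>G\<close>. Grouping by the exponent of one
  \<open>x $ g\<close>, with the other variables frozen, gives a one-variable decomposition of 0, so
  every group vanishes; each group is a decomposition of 0 in the remaining variables.\<close>

lemma almansi_unique_multi:
  fixes \<Omega> :: "('a::euclidean_space ^ 'n) set" and d :: "('n \<Rightarrow> nat) \<Rightarrow> 'a ^ 'n \<Rightarrow> 'b::banach"
  assumes \<Omega>: "open \<Omega>" and star: "starlike_every_variable \<Omega>" and S: "finite S"
    and d: "\<And>T g. T \<in> G \<rightarrow>\<^sub>E S \<Longrightarrow> g \<in> G \<Longrightarrow> polyharmonic_in 1 g \<Omega> (d T)"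
    and eq: "\<And>x. x \<in> \<Omega> \<Longrightarrow> (\<Sum>T\<in>G \<rightarrow>\<^sub>E S. norm_power G T x *\<^sub>R d T x) = 0"
    and T: "T \<in> G \<rightarrow>\<^sub>E S" and x: "x \<in> \<Omega>"
  shows "d T x = 0"
  using finite[of G] d eq T x
proof (induction G arbitrary: d T x rule: finite_induct)
  case empty
  then show ?case by (simp add: norm_power_def)
next
  case (insert g G)
  have PiE: "insert g G \<rightarrow>\<^sub>E S = (\<lambda>(t, T). T(g := t)) ` (S \<times> (G \<rightarrow>\<^sub>E S))"
    by (rule PiE_insert_eq)
  have inj: "inj_on (\<lambda>(t, T). T(g := t)) (S \<times> (G \<rightarrow>\<^sub>E S))"
    using inj_combinator[OF insert.hyps(2), of "\<lambda>_. S"] by simp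
  have mem: "T(g := t) \<in> insert g G \<rightarrow>\<^sub>E S" if "T \<in> G \<rightarrow>\<^sub>E S" "t \<in> S" for T t
    using that by (auto simp: PiE)
  have np: "norm_power (insert g G) (T(g := t)) x = norm (x $ g) ^ (2 * t) * norm_power G T x" for T t and x :: "'a ^ 'n"
  proof -
    have "(\<Prod>l\<in>G. norm (x $ l) ^ (2 * (T(g := t)) l)) = norm_power G T x"
      unfolding norm_power_def by (intro prod.cong) (use insert.hyps in auto)
    then show ?thesis using insert.hyps by (simp add: norm_power_def)
  qed
  have slice: "(\<Sum>T\<in>G \<rightarrow>\<^sub>E S. norm_power G T x *\<^sub>R d (T(g := t)) x) = 0" if t: "t \<in> S" and x: "x \<in> \<Omega>" for t x
  proof -
    let ?U = "var_section \<Omega> g x"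
    define h where "h = (\<lambda>t w. \<Sum>T\<in>G \<rightarrow>\<^sub>E S. norm_power G T x *\<^sub>R d (T(g := t)) (upd_var x g w))"
    have "h t (x $ g) = 0"
    proof (rule almansi_unique[OF open_var_section[OF \<Omega>] _ S, of g x h])
      show "closed_segment 0 w \<subseteq> ?U" if "w \<in> ?U" for w
        using star x that by (auto simp: starlike_every_variable_def)
      show "harmonic_on (h t) ?U" if "t \<in> S" for t
        unfolding h_def
      proof (intro harmonic_on_sum open_var_section \<Omega> harmonic_on_compose_linear[OF _ bounded_linear_scaleR_right])
        fix T assume "T \<in> G \<rightarrow>\<^sub>E S"
        then show "harmonic_on (\<lambda>w. d (T(g := t)) (upd_var x g w)) ?U"
          using insert.prems(1)[OF mem, of T t g] that x unfolding polyharmonic_1_iff by blast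
      qed
      fix w assume "w \<in> ?U"
      then have w: "upd_var x g w \<in> \<Omega>" by (simp add: var_section_def)
      have "(\<Sum>t\<in>S. norm w ^ (2 * t) *\<^sub>R h t w) =
          (\<Sum>t\<in>S. \<Sum>T\<in>G \<rightarrow>\<^sub>E S. norm_power (insert g G) (T(g := t)) (upd_var x g w) *\<^sub>R d (T(g := t)) (upd_var x g w))"
        by (simp add: h_def np norm_power_upd insert.hyps scaleR_sum_right)
      also have "\<dots> = (\<Sum>T\<in>insert g G \<rightarrow>\<^sub>E S. norm_power (insert g G) T (upd_var x g w) *\<^sub>R d T (upd_var x g w))"
        unfolding PiE sum.reindex[OF inj] by (simp add: sum.cartesian_product case_prod_beta)
      also have "\<dots> = 0" by (rule insert.prems(2)[OF w])
      finally show "(\<Sum>t\<in>S. norm w ^ (2 * t) *\<^sub>R h t w) = 0" .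
    qed (use t x in \<open>auto simp: var_section_def\<close>)
    then show ?thesis by (simp add: h_def)
  qed
  obtain t T' where T: "T = T'(g := t)" "t \<in> S" "T' \<in> G \<rightarrow>\<^sub>E S"
    using insert.prems(3) unfolding PiE by auto
  have "d (T'(g := t)) x = 0"
    by (rule insert.IH[of "\<lambda>T. d (T(g := t))", OF _ slice[OF T(2)] T(3) insert.prems(4)])
      (rule insert.prems(1)[OF mem[OF _ T(2)]], auto)
  then show ?case using T(1) by (simp only:)
qed

lemma multi_indices_PiE:
  obtains S where "finite S" "multi_indices m G = G \<rightarrow>\<^sub>E S"
proof
  show "finite {t. real t \<le> (real m - 3) / 2}"
    by (rule finite_subset[of _ "{..m}"]) auto
qed (rule multi_indices_def)

section \<open>Slice structure of the components by rotation and uniqueness\<close>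

definition rotate_imag :: "(real ^ 'm \<Rightarrow> real ^ 'm) \<Rightarrow> 'm paravector \<Rightarrow> 'm paravector"
  where "rotate_imag \<rho> w = (fst w, \<rho> (snd w))"

lemma orthogonal_rotate_imag:
  "orthogonal_transformation \<rho> \<Longrightarrow> orthogonal_transformation (rotate_imag \<rho>)"
  unfolding orthogonal_transformation_def rotate_imag_def
  by (auto simp: inner_prod_def linear_add linear_cmul intro!: linearI)

text \<open>Conjugating one variable permutes the sets \<open>S\<close> by symmetric difference with
  \<open>{h}\<close>, and the characters change by a constant sign. So \<open>stem_comp\<close> has
  the parity of a stem function for every \<open>g\<close>.\<close>

lemma stem_comp_flip:
  fixes z :: "(complex, 'n::{finite,linorder}) vec"
  shows "stem_comp J L g (flip {h} z) = chr {h} L *\<^sub>R stem_comp J L g z"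
proof -
  have fl: "flip S (flip {h} z) = flip (sym_diff S {h}) z" for S
    by (auto simp: vec_eq_iff)
  have inv: "sym_diff (sym_diff S {h}) {h} = S" for S :: "'n set" by auto
  have "(\<Sum>S\<in>UNIV. chr S L *\<^sub>R g (point J (flip S (flip {h} z)))) =
      (\<Sum>S\<in>UNIV. chr (sym_diff S {h}) L *\<^sub>R g (point J (flip S z)))"
    unfolding fl
    by (rule sum.reindex_bij_witness[of _ "\<lambda>S. sym_diff S {h}" "\<lambda>S. sym_diff S {h}"]) (simp_all only: inv UNIV_I)
  also have "\<dots> = chr {h} L *\<^sub>R (\<Sum>S\<in>UNIV. chr S L *\<^sub>R g (point J (flip S z)))"
    by (simp only: chr_commute[of "sym_diff _ _"] chr_sym_diff chr_commute[of L] scaleR_sum_right scaleR_scaleR mult.commute)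
  finally show ?thesis
    by (simp add: stem_comp_def linear_cmul[OF linear_inverse_bracket])
qed

text \<open>The stem function of a spherical derivative with respect to \<open>H\<close> has no
  component meeting \<open>H\<close>: the function depends on the variables of \<open>H\<close> only
  through their real part and the norm of their imaginary part. The same shape is prescribed for the
  Almansi components.\<close>

definition axial_stem ::
    "'n set \<Rightarrow> ('n::{finite,linorder} \<Rightarrow> 'm::{finite,linorder} paravector) \<Rightarrow> ('m, 'n) pv_fun \<Rightarrow> ('m, 'n) stem_fun"
  where "axial_stem H J g z = (\<chi> L. if L \<inter> H = {} then stem_comp J L g z else 0)"

lemma stem_function_axial_stem: "stem_function D (axial_stem H J g)"
  by (rule stem_functionI) (simp add: axial_stem_def stem_comp_flip)

text \<open>A function is the slice function with stem \<open>axial_stem H J g\<close> as soon as it satisfies a linear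
  functional equation relating its values at \<open>x\<close> and at the points obtained from \<open>x\<close> by replacing the
  imaginary units. Applied to the Almansi components of a function that satisfies the equation, the
  defects are the components of an Almansi decomposition of 0, because the rotations \<open>R\<close> in the
  variables of \<open>G\<close> preserve harmonicity; hence the defects vanish.\<close>

lemma almansi_components_slice:
  fixes D :: "(complex ^ 'n::{finite,linorder}) set" and s :: "('m::{finite,linorder}, 'n) stem_fun"
    and E :: "('n \<Rightarrow> nat) \<Rightarrow> ('m, 'n) pv_fun"
  assumes D: "open D" "symmetric_domain D"
    and star: "starlike_every_variable (circular D :: ('m, 'n) points set)"
    and GH: "G \<subseteq> H" and I: "finite I"
    and s: "stem_function D s" and sH: "\<And>z B. z \<in> D \<Longrightarrow> B \<inter> H \<noteq> {} \<Longrightarrow> s z $ B = 0"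
    and dec: "\<And>x. x \<in> circular D \<Longrightarrow> induced s x = (\<Sum>T\<in>G \<rightarrow>\<^sub>E I. norm_power G T x *\<^sub>R E T x)"
    and harm: "\<And>T g. T \<in> G \<rightarrow>\<^sub>E I \<Longrightarrow> g \<in> G \<Longrightarrow> polyharmonic_in 1 g (circular D) (E T)"
    and T: "T \<in> G \<rightarrow>\<^sub>E I" and J0: "J0 \<in> imag_sphere" and x0: "x0 \<in> circular D"
  shows "E T x0 = induced (axial_stem H (\<lambda>_. J0) (E T)) x0"
proof -
  let ?\<Omega> = "circular D :: ('m, 'n) points set"
  have o\<Omega>: "open ?\<Omega>" by (rule open_circular[OF D])
  obtain J where J: "\<And>l. J l \<in> imag_sphere" and x0J: "x0 = point J (slice_coords x0)"
    using point_slice_coords[of x0] by blast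
  have "\<exists>\<rho>. orthogonal_transformation \<rho> \<and> \<rho> (snd (J l)) = snd J0" for l
    using J[of l] J0 orthogonal_transformation_exists[of "snd (J l)" "snd J0"] by (auto simp: imag_sphere_iff)
  then obtain \<rho> where \<rho>: "\<And>l. orthogonal_transformation (\<rho> l)" "\<And>l. \<rho> l (snd (J l)) = snd J0" by metis
  \<comment> \<open>At the variable \<open>l\<close>, the rotation takes the unit of
    \<open>x0\<close> to \<open>J0\<close>, or to \<open>- J0\<close> for \<open>l \<in> S\<close>.
    It depends on \<open>x0\<close> but not on the point it is applied to, hence it is
    linear.\<close>
  define R where "R = (\<lambda>S l. rotate_imag (\<lambda>v. (if l \<in> S then -1 else 1) *\<^sub>R \<rho> l v))"
  have "orthogonal_transformation (\<lambda>v. (if l \<in> S then -1 else 1 :: real) *\<^sub>R \<rho> l v)" for S l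
    using \<rho>(1)[of l] orthogonal_transformation_neg by (cases "l \<in> S") auto
  then have R: "orthogonal_transformation (R S l)" for S l
    unfolding R_def by (rule orthogonal_rotate_imag)
  have linR: "linear (R S l)" for S l using R orthogonal_transformation_linear by blast
  \<comment> \<open>In the variables of \<open>G\<close> only a rotation keeps harmonicity; it
    produces \<open>J0\<close> or \<open>- J0\<close> at \<open>x0\<close>, while at other points
    the resulting unit is arbitrary. This does no harm, because \<open>s\<close> has no component
    meeting \<open>H\<close>. The other variables receive \<open>J0\<close> or \<open>- J0\<close>
    at every point.\<close>
  define \<tau> :: "'n set \<Rightarrow> ('m, 'n) points \<Rightarrow> ('m, 'n) points" where
    "\<tau> = (\<lambda>S x. \<chi> l. if l \<in> G then R S l (x $ l) else (fst (x $ l), 0) + norm (snd (x $ l)) *\<^sub>R (if l \<in> S then - J0 else J0))"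
  have Rre: "R S l (a, 0) = (a, 0)" for S l a
    using linear_0[OF orthogonal_transformation_linear[OF \<rho>(1)[of l]]] by (simp add: R_def rotate_imag_def)
  have Rimag: "R S l v \<in> imag_sphere" if "v \<in> imag_sphere" for S l v
    using that orthogonal_transformation_norm[OF \<rho>(1)[of l]] by (simp add: R_def rotate_imag_def imag_sphere_iff)
  have mJ0: "- J0 \<in> imag_sphere" using J0 by (simp add: imag_sphere_iff)
  have \<tau>_point: "\<exists>J'. (\<forall>l. J' l \<in> imag_sphere) \<and> (\<forall>l. l \<notin> G \<longrightarrow> J' l = (if l \<in> S then - J0 else J0)) \<and>
      \<tau> S x = point J' (slice_coords x)" for S x
  proof -
    obtain Jx where Jx: "\<And>l. Jx l \<in> imag_sphere" and xJ: "x = point Jx (slice_coords x)"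
      using point_slice_coords[of x] by blast
    define J' where "J' = (\<lambda>l. if l \<in> G then R S l (Jx l) else if l \<in> S then - J0 else J0)"
    have "\<tau> S x $ l = point J' (slice_coords x) $ l" for l
    proof (cases "l \<in> G")
      case True
      have "x $ l = (Re (slice_coords x $ l), 0) + Im (slice_coords x $ l) *\<^sub>R Jx l"
        by (subst xJ) simp
      then have "R S l (x $ l) = (Re (slice_coords x $ l), 0) + Im (slice_coords x $ l) *\<^sub>R R S l (Jx l)"
        by (simp only: linear_add[OF linR] linear_cmul[OF linR] Rre)
      with True show ?thesis by (simp add: \<tau>_def J'_def)
    next
      case False
      then show ?thesis by (simp add: \<tau>_def J'_def slice_coords_def)
    qed
    then have "\<tau> S x = point J' (slice_coords x)" by (simp add: vec_eq_iff)
    then show ?thesis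
      using Jx Rimag J0 mJ0 by (intro exI[of _ J']) (auto simp: J'_def)
  qed
  have \<tau>_coords: "slice_coords (\<tau> S x) = slice_coords x" for S x
  proof -
    obtain J' where J': "\<And>l. J' l \<in> imag_sphere" "\<tau> S x = point J' (slice_coords x)" using \<tau>_point by blast
    have "{l. Im (slice_coords x $ l) < 0} = {}"
      using Im_slice_coords_nonneg[of x] by (auto simp: not_less)
    then show ?thesis
      unfolding J'(2) slice_coords_point[OF J'(1)] by simp
  qed
  have \<tau>\<Omega>: "\<tau> S x \<in> ?\<Omega>" if "x \<in> ?\<Omega>" for S x
    using that by (simp add: circular_iff[OF D(2)] \<tau>_coords)
  have norm_coords: "norm (x $ l) = norm (slice_coords x $ l)" for x :: "('m, 'n) points" and l
    by (simp add: slice_coords_def norm_prod_def cmod_def)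
  have np\<tau>: "norm_power G T (\<tau> S x) = norm_power G T x" for S x T
    by (simp add: norm_power_def norm_coords \<tau>_coords)
  have \<tau>_upd: "\<tau> S (upd_var x g w) = upd_var (\<tau> S x) g (R S g w)" if "g \<in> G" for S x g w
    using that by (auto simp: \<tau>_def vec_eq_iff)
  have \<tau>_x0: "\<tau> S x0 = point (\<lambda>_. J0) (flip S (slice_coords x0))" for S
  proof -
    have "\<tau> S x0 $ l = point (\<lambda>_. J0) (flip S (slice_coords x0)) $ l" for l
    proof (cases "l \<in> G")
      case True
      have "x0 $ l = (Re (slice_coords x0 $ l), 0) + Im (slice_coords x0 $ l) *\<^sub>R J l"
        by (subst x0J) simp
      then have "R S l (x0 $ l) = (Re (slice_coords x0 $ l), 0) + Im (slice_coords x0 $ l) *\<^sub>R R S l (J l)"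
        by (simp only: linear_add[OF linR] linear_cmul[OF linR] Rre)
      moreover have "R S l (J l) = (if l \<in> S then - J0 else J0)"
        using J[of l] J0 \<rho>(2)[of l] by (auto simp: R_def rotate_imag_def imag_sphere_iff prod_eq_iff)
      ultimately show ?thesis using True by (simp add: \<tau>_def)
    next
      case False
      then show ?thesis by (simp add: \<tau>_def slice_coords_def)
    qed
    then show ?thesis by (simp add: vec_eq_iff)
  qed
  \<comment> \<open>At \<open>x0\<close> this is the value of
    \<open>induced (axial_stem ...)\<close>. It is linear in \<open>u\<close>, and its brackets
    involve only variables outside \<open>H\<close>, so as a function of a variable of
    \<open>G\<close> it depends on it only through the rotations.\<close>
  define op where "op = (\<lambda>u x. \<Sum>L\<in>{L. L \<inter> H = {}}. bracket (\<lambda>l. imag_unit (x $ l)) L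
      (inverse_bracket (\<lambda>_. J0) L ((1 / 2 ^ CARD('n)) *\<^sub>R (\<Sum>S\<in>UNIV. chr S L *\<^sub>R (u :: ('m, 'n) pv_fun) (\<tau> S x)))))"
  have op_s: "op (induced s) x = induced s x" if x: "x \<in> ?\<Omega>" for x
  proof -
    have z: "slice_coords x \<in> D" using x circular_iff[OF D(2)] by blast
    let ?s = "\<lambda>M. s (slice_coords x) $ M"
    have "induced s (\<tau> S x) = (\<Sum>M\<in>UNIV. chr S M *\<^sub>R bracket (\<lambda>_. J0) M (?s M))" for S
    proof -
      obtain J' where J': "\<And>l. J' l \<in> imag_sphere" "\<And>l. l \<notin> G \<Longrightarrow> J' l = (if l \<in> S then - J0 else J0)"
        "\<tau> S x = point J' (slice_coords x)" using \<tau>_point by blast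
      have "induced s (\<tau> S x) = (\<Sum>M\<in>UNIV. bracket J' M (?s M))"
        unfolding J'(3) by (rule induced_point[OF D(2) s z J'(1)])
      also have "\<dots> = (\<Sum>M\<in>UNIV. chr S M *\<^sub>R bracket (\<lambda>_. J0) M (?s M))"
      proof (rule sum.cong[OF refl])
        fix M
        show "bracket J' M (?s M) = chr S M *\<^sub>R bracket (\<lambda>_. J0) M (?s M)"
        proof (cases "M \<inter> H = {}")
          case True
          have "bracket J' M (?s M) = bracket (\<lambda>l. (if l \<in> S then -1 else 1) *\<^sub>R J0) M (?s M)"
          proof (rule bracket_cong)
            fix l assume "l \<in> M"
            then have "l \<notin> G" using True GH by blast
            then show "J' l = (if l \<in> S then -1 else 1) *\<^sub>R J0" by (simp add: J'(2))
          qed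
          also have "\<dots> = chr M S *\<^sub>R bracket (\<lambda>_. J0) M (?s M)"
            by (simp add: bracket_scaleR chr_prod)
          finally show ?thesis by (simp only: chr_commute)
        qed (simp add: sH z bracket_simps)
      qed
      finally show ?thesis .
    qed
    then have "op (induced s) x = (\<Sum>L\<in>{L. L \<inter> H = {}}. bracket (\<lambda>l. imag_unit (x $ l)) L (?s L))"
      unfolding op_def by (simp only: average_chr inverse_bracket_bracket[OF J0])
    also have "\<dots> = induced s x"
      unfolding induced_def using sH[OF z] by (intro sum.mono_neutral_left) (auto simp: bracket_simps)
    finally show ?thesis .
  qed
  have op_sum: "op (induced s) x = (\<Sum>T\<in>G \<rightarrow>\<^sub>E I. norm_power G T x *\<^sub>R op (E T) x)" if x: "x \<in> ?\<Omega>" for x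
  proof -
    have "(\<Sum>S\<in>UNIV. chr S L *\<^sub>R induced s (\<tau> S x)) =
        (\<Sum>T\<in>G \<rightarrow>\<^sub>E I. norm_power G T x *\<^sub>R (\<Sum>S\<in>UNIV. chr S L *\<^sub>R E T (\<tau> S x)))" for L
    proof -
      have "(\<Sum>S\<in>UNIV. chr S L *\<^sub>R induced s (\<tau> S x)) =
          (\<Sum>S\<in>UNIV. \<Sum>T\<in>G \<rightarrow>\<^sub>E I. norm_power G T x *\<^sub>R chr S L *\<^sub>R E T (\<tau> S x))"
        by (simp add: dec[OF \<tau>\<Omega>[OF x]] np\<tau> scaleR_sum_right mult.commute)
      also have "\<dots> = (\<Sum>T\<in>G \<rightarrow>\<^sub>E I. \<Sum>S\<in>UNIV. norm_power G T x *\<^sub>R chr S L *\<^sub>R E T (\<tau> S x))"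
        by (rule sum.swap)
      finally show ?thesis by (simp add: scaleR_sum_right)
    qed
    then have "op (induced s) x = (\<Sum>L\<in>{L. L \<inter> H = {}}. \<Sum>T\<in>G \<rightarrow>\<^sub>E I. norm_power G T x *\<^sub>R bracket (\<lambda>l. imag_unit (x $ l)) L
      (inverse_bracket (\<lambda>_. J0) L ((1 / 2 ^ CARD('n)) *\<^sub>R (\<Sum>S\<in>UNIV. chr S L *\<^sub>R E T (\<tau> S x)))))"
      unfolding op_def
      by (simp only: scaleR_sum_right[of "1 / 2 ^ CARD('n)"] scaleR_left_commute[of "1 / 2 ^ CARD('n)"]
          linear_sum[OF linear_inverse_bracket] linear_cmul[OF linear_inverse_bracket]
          linear_sum[OF linear_bracket] linear_cmul[OF linear_bracket])
    also have "\<dots> = (\<Sum>T\<in>G \<rightarrow>\<^sub>E I. norm_power G T x *\<^sub>R op (E T) x)"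
      unfolding op_def by (subst sum.swap) (simp add: scaleR_sum_right)
    finally show ?thesis .
  qed
  have "E T x0 - op (E T) x0 = 0"
  proof (rule almansi_unique_multi[OF o\<Omega> star I _ _ T x0, where d = "\<lambda>T x. E T x - op (E T) x"])
    fix x :: "('m, 'n) points" assume x: "x \<in> ?\<Omega>"
    have "(\<Sum>T\<in>G \<rightarrow>\<^sub>E I. norm_power G T x *\<^sub>R (E T x - op (E T) x)) = induced s x - op (induced s) x"
      by (simp add: dec[OF x] op_sum[OF x] scaleR_right_diff_distrib sum_subtractf)
    then show "(\<Sum>T\<in>G \<rightarrow>\<^sub>E I. norm_power G T x *\<^sub>R (E T x - op (E T) x)) = 0"
      using op_s[OF x] by simp
  next
    fix T g assume T: "T \<in> G \<rightarrow>\<^sub>E I" and g: "g \<in> G"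
    show "polyharmonic_in 1 g ?\<Omega> (\<lambda>x. E T x - op (E T) x)"
      unfolding polyharmonic_1_iff
    proof
      fix x :: "('m, 'n) points" assume x: "x \<in> ?\<Omega>"
      let ?U = "var_section ?\<Omega> g x"
      have oU: "open ?U" by (rule open_var_section[OF o\<Omega>])
      have E: "harmonic_on (\<lambda>w. E T (upd_var y g w)) (var_section ?\<Omega> g y)" if "y \<in> ?\<Omega>" for y
        using harm[OF T g] that unfolding polyharmonic_1_iff by blast
      have "harmonic_on (\<lambda>w. E T (upd_var (\<tau> S x) g (R S g w))) ?U" for S
      proof (rule harmonic_on_orthogonal[OF R oU _ E[OF \<tau>\<Omega>[OF x]]])
        show "R S g ` ?U \<subseteq> var_section ?\<Omega> g (\<tau> S x)"
          using \<tau>\<Omega> by (auto simp: var_section_def \<tau>_upd[OF g, symmetric])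
      qed
      then have E\<tau>: "harmonic_on (\<lambda>w. E T (\<tau> S (upd_var x g w))) ?U" for S
        by (simp add: \<tau>_upd[OF g])
      have "harmonic_on (\<lambda>w. \<Sum>L\<in>{L. L \<inter> H = {}}. bracket (\<lambda>l. imag_unit (x $ l)) L
          (inverse_bracket (\<lambda>_. J0) L ((1 / 2 ^ CARD('n)) *\<^sub>R (\<Sum>S\<in>UNIV. chr S L *\<^sub>R E T (\<tau> S (upd_var x g w)))))) ?U"
        by (intro harmonic_on_sum oU harmonic_on_compose_linear[OF oU bounded_linear_bracket]
            harmonic_on_compose_linear[OF oU bounded_linear_inverse_bracket]
            harmonic_on_compose_linear[OF oU bounded_linear_scaleR_right] E\<tau>)
      moreover have "bracket (\<lambda>l. imag_unit (x $ l)) L a = bracket (\<lambda>l. imag_unit (upd_var x g w $ l)) L a"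
        if "L \<inter> H = {}" for L a w
        using that g GH by (intro bracket_cong) auto
      ultimately have "harmonic_on (\<lambda>w. op (E T) (upd_var x g w)) ?U"
        unfolding op_def by (simp cong: sum.cong_simp)
      then show "harmonic_on (\<lambda>w. E T (upd_var x g w) - op (E T) (upd_var x g w)) ?U"
        by (intro harmonic_on_diff oU E x)
    qed
  qed
  moreover have "op (E T) x0 = induced (axial_stem H (\<lambda>_. J0) (E T)) x0"
  proof -
    have "induced (axial_stem H (\<lambda>_. J0) (E T)) x0 = (\<Sum>L\<in>{L. L \<inter> H = {}}. bracket (\<lambda>l. imag_unit (x0 $ l)) L
        (axial_stem H (\<lambda>_. J0) (E T) (slice_coords x0) $ L))"
      unfolding induced_def by (intro sum.mono_neutral_right) (auto simp: axial_stem_def bracket_simps)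
    also have "\<dots> = op (E T) x0"
      unfolding op_def by (intro sum.cong) (auto simp: axial_stem_def stem_comp_def \<tau>_x0)
    finally show ?thesis by simp
  qed
  ultimately show ?thesis by simp
qed

text \<open>The component evaluates \<open>u\<close> at points whose unit in the variable
  \<open>g\<close> is fixed, which depends on \<open>w\<close> through \<open>norm (snd w)\<close>
  and would spoil harmonicity. But a slice function without components meeting \<open>H\<close>
  takes the same value when \<open>w\<close> itself is put back in that variable, and there
  harmonicity is given.\<close>

lemma axial_stem_harmonic:
  fixes D :: "(complex ^ 'n::{finite,linorder}) set" and u :: "('m::{finite,linorder}, 'n) pv_fun"
    and y :: "('m, 'n) points"
  assumes D: "open D" "symmetric_domain D" and J0: "J0 \<in> imag_sphere" and g: "g \<in> H"
    and eq: "\<And>x. x \<in> circular D \<Longrightarrow> u x = induced (axial_stem H (\<lambda>_. J0) u) x"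
    and u: "polyharmonic_in 1 g (circular D) u" and y: "y \<in> circular D"
  shows "harmonic_on (\<lambda>w. axial_stem H (\<lambda>_. J0) u (slice_coords (upd_var y g w)) $ L) (var_section (circular D) g y)"
proof (cases "L \<inter> H = {}")
  case False
  then show ?thesis by (simp add: axial_stem_def harmonic_on_const)
next
  case True
  let ?\<Omega> = "circular D :: ('m, 'n) points set"
  let ?U = "var_section ?\<Omega> g y"
  have oU: "open ?U" by (intro open_var_section open_circular D)
  define p where "p = (\<lambda>S (x :: ('m, 'n) points). point (\<lambda>_. J0) (flip S (slice_coords x)) :: ('m, 'n) points)"
  have pc: "slice_coords (p S x) = slice_coords x" for S and x :: "('m, 'n) points"
    using Im_slice_coords_nonneg[of x] J0
    by (auto simp: p_def slice_coords_def vec_eq_iff complex_eq_iff imag_sphere_iff)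
  have p\<Omega>: "p S x \<in> ?\<Omega>" if "x \<in> ?\<Omega>" for S x
    using that by (simp add: circular_iff[OF D(2)] pc)
  have pc': "slice_coords (upd_var (p S y) g w) = slice_coords (upd_var y g w)" for S w
    using pc[of S y] by (simp add: slice_coords_def vec_eq_iff)
  have up: "u (p S (upd_var y g w)) = u (upd_var (p S y) g w)" if w: "w \<in> ?U" for S w
  proof -
    have w': "upd_var y g w \<in> ?\<Omega>" using w by (simp add: var_section_def)
    then have w'': "upd_var (p S y) g w \<in> ?\<Omega>" by (simp add: circular_iff[OF D(2)] pc')
    have "induced (axial_stem H (\<lambda>_. J0) u) (p S (upd_var y g w)) =
        induced (axial_stem H (\<lambda>_. J0) u) (upd_var (p S y) g w)"
      unfolding induced_def pc pc'
    proof (rule sum.cong[OF refl])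
      fix K
      show "bracket (\<lambda>l. imag_unit (p S (upd_var y g w) $ l)) K (axial_stem H (\<lambda>_. J0) u (slice_coords (upd_var y g w)) $ K) =
        bracket (\<lambda>l. imag_unit (upd_var (p S y) g w $ l)) K (axial_stem H (\<lambda>_. J0) u (slice_coords (upd_var y g w)) $ K)"
      proof (cases "K \<inter> H = {}")
        case True
        have "p S (upd_var y g w) $ l = upd_var (p S y) g w $ l" if "l \<in> K" for l
          using that True g by (auto simp: p_def slice_coords_def)
        then show ?thesis by (intro bracket_cong) simp
      qed (simp add: axial_stem_def bracket_simps)
    qed
    then show ?thesis by (simp add: eq[OF p\<Omega>[OF w']] eq[OF w''])
  qed
  have sec: "var_section ?\<Omega> g (p S y) = ?U" for S
    by (auto simp: var_section_def circular_iff[OF D(2)] pc')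
  have h: "harmonic_on (\<lambda>w. u (p S (upd_var y g w))) ?U" for S
  proof (rule harmonic_on_cong[OF oU up[symmetric]])
    have "harmonic_on (\<lambda>w. u (upd_var (p S y) g w)) (var_section ?\<Omega> g (p S y))"
      using u p\<Omega>[OF y, of S] unfolding polyharmonic_1_iff by blast
    then show "harmonic_on (\<lambda>w. u (upd_var (p S y) g w)) ?U" by (simp only: sec)
  qed
  have "harmonic_on (\<lambda>w. inverse_bracket (\<lambda>_. J0) L ((1 / 2 ^ CARD('n)) *\<^sub>R
      (\<Sum>S\<in>UNIV. chr S L *\<^sub>R u (p S (upd_var y g w))))) ?U"
    by (intro harmonic_on_compose_linear[OF oU bounded_linear_inverse_bracket]
        harmonic_on_compose_linear[OF oU bounded_linear_scaleR_right] harmonic_on_sum oU h)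
  with True show ?thesis by (simp add: axial_stem_def stem_comp_def p_def)
qed

section \<open>Biharmonicity\<close>

text \<open>Norm times unit is the imaginary part of \<open>w\<close>, also when that part is 0, and
  the bracket is linear in it. The singularity of \<open>imag_unit\<close> disappears. The basis
  vector in the real direction contributes nothing, since its second component is 0.\<close>

lemma bracket_update_expand:
  fixes y :: "('m::{finite,linorder}, 'n::{finite,linorder}) points"
  assumes "g \<in> L"
  shows "norm (snd w) *\<^sub>R bracket (\<lambda>l. imag_unit (upd_var y g w $ l)) L a =
    (\<Sum>b\<in>Basis. (w \<bullet> b) *\<^sub>R bracket ((\<lambda>l. imag_unit (y $ l))(g := (0, snd b))) L a)"
proof -
  define B where "B = (\<lambda>v. bracket ((\<lambda>l. imag_unit (y $ l))(g := v)) L a)"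
  have lin: "linear B" unfolding B_def by (rule linear_bracket_update[OF assms])
  have "linear (\<lambda>w :: 'm paravector. (0, snd w) :: 'm paravector)" by (intro linearI) auto
  from linear_compose[OF this lin] have lin': "linear (\<lambda>w :: 'm paravector. B (0, snd w))" by (simp add: o_def)
  have "bracket (\<lambda>l. imag_unit (upd_var y g w $ l)) L a = B (imag_unit w)"
    unfolding B_def by (rule bracket_cong) simp
  then have "norm (snd w) *\<^sub>R bracket (\<lambda>l. imag_unit (upd_var y g w $ l)) L a = B (norm (snd w) *\<^sub>R imag_unit w)"
    by (simp add: linear_cmul[OF lin])
  also have "norm (snd w) *\<^sub>R imag_unit w = (0, snd w)"
    by (cases "snd w = 0") (simp_all add: imag_unit_def sgn_div_norm)
  also have "B (0, snd w) = (\<Sum>b\<in>Basis. (w \<bullet> b) *\<^sub>R B (0, snd b))"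
    using linear_sum[OF lin', of "\<lambda>b. (w \<bullet> b) *\<^sub>R b" Basis]
    by (simp only: euclidean_representation linear_cmul[OF lin'])
  finally show ?thesis by (simp add: B_def)
qed

lemma slice_coords_upd:
  "slice_coords (upd_var y g w) $ l = (if l = g then Complex (fst w) (norm (snd w)) else slice_coords y $ l)"
  by (simp add: slice_coords_def)

text \<open>In the variable of \<open>g\<close>, a component of $(\overline{x})_T \odot u$ depends on \<open>w\<close> through a harmonic
  function and at most one factor $\alpha_g$ or $\beta_g J_g$, that is, one real coordinate of \<open>w\<close>.\<close>

lemma biharmonic_conj_coord_term:
  fixes u :: "'m::{finite,linorder} paravector \<Rightarrow> 'm clifford" and y :: "('m, 'n::{finite,linorder}) points"
  assumes U: "open U" and u: "harmonic_on u U" and g: "g \<in> H" and LT: "L \<inter> H \<subseteq> T" and TH: "T \<subseteq> H"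
  shows "biharmonic_on (\<lambda>w. bracket (\<lambda>l. imag_unit (upd_var y g w $ l)) L
    (coord_monomial T (L \<inter> H) (slice_coords (upd_var y g w)) *\<^sub>R u w)) U"
proof -
  define C where "C = L \<inter> H"
  define J where "J = (\<lambda>l. imag_unit (y $ l))"
  let ?z = "\<lambda>w. slice_coords (upd_var y g w)"
  have J: "bracket (\<lambda>l. imag_unit (upd_var y g w $ l)) L a = bracket J L a" if "g \<notin> L" for w a
    unfolding J_def using that by (intro bracket_cong) auto
  have h: "harmonic_on (\<lambda>w. bracket J' L (k *\<^sub>R u w)) U" for J' k
    by (intro harmonic_on_compose_linear[OF U bounded_linear_bracket]
        harmonic_on_compose_linear[OF U bounded_linear_scaleR_right] u)
  have re: "(\<Prod>l\<in>S. Re (?z w $ l)) = (\<Prod>l\<in>S. Re (slice_coords y $ l))" if "g \<notin> S" for S w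
    using that by (intro prod.cong) (auto simp: slice_coords_upd)
  have im: "(\<Prod>l\<in>S. Im (?z w $ l)) = (\<Prod>l\<in>S. Im (slice_coords y $ l))" if "g \<notin> S" for S w
    using that by (intro prod.cong) (auto simp: slice_coords_upd)
  \<comment> \<open>The conjugated variable \<open>g\<close> is absent, or it contributes its real
    part, or it contributes its imaginary part together with a unit in the bracket.\<close>
  consider "g \<notin> T" | "g \<in> T" "g \<notin> C" | "g \<in> C" by blast
  then have "biharmonic_on (\<lambda>w. bracket (\<lambda>l. imag_unit (upd_var y g w $ l)) L (coord_monomial T C (?z w) *\<^sub>R u w)) U"
  proof cases
    case 1
    then have gL: "g \<notin> L" "g \<notin> C" "g \<notin> T - C" using g LT by (auto simp: C_def)
    have "coord_monomial T C (?z w) = coord_monomial T C (slice_coords y)" for w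
      by (simp only: coord_monomial_def re[OF gL(3)] im[OF gL(2)])
    then show ?thesis
      by (simp only: J[OF gL(1)]) (intro biharmonic_on_harmonic U h)
  next
    case 2
    then have gL: "g \<notin> L" using g by (auto simp: C_def)
    define k where "k = (\<Prod>l\<in>T - C - {g}. Re (slice_coords y $ l)) * (\<Prod>l\<in>C. Im (slice_coords y $ l))"
    have r: "g \<notin> T - C - {g}" by simp
    have p: "(\<Prod>l\<in>T - C. Re (?z w $ l)) = Re (?z w $ g) * (\<Prod>l\<in>T - C - {g}. Re (?z w $ l))" for w
      using 2 by (intro prod.remove) auto
    have mon: "coord_monomial T C (?z w) = fst w * k" for w
      by (simp only: coord_monomial_def p re[OF r] im[OF 2(2)] k_def) (simp add: slice_coords_upd)
    have eq: "bracket (\<lambda>l. imag_unit (upd_var y g w $ l)) L (coord_monomial T C (?z w) *\<^sub>R u w) =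
        (w \<bullet> (1, 0)) *\<^sub>R bracket J L (k *\<^sub>R u w)" for w
      unfolding J[OF gL] mon by (simp add: bracket_simps inner_prod_def)
    show ?thesis
      unfolding eq by (rule biharmonic_on_inner_scaleR[OF U h]) (simp add: Basis_prod_def)
  next
    case 3
    then have gL: "g \<in> L" "g \<notin> T - C" by (auto simp: C_def)
    define k where "k = (\<Prod>l\<in>T - C. Re (slice_coords y $ l)) * (\<Prod>l\<in>C - {g}. Im (slice_coords y $ l))"
    have r: "g \<notin> C - {g}" by simp
    have p: "(\<Prod>l\<in>C. Im (?z w $ l)) = Im (?z w $ g) * (\<Prod>l\<in>C - {g}. Im (?z w $ l))" for w
      using 3 by (intro prod.remove) auto
    have mon: "coord_monomial T C (?z w) = norm (snd w) * k" for w
      by (simp only: coord_monomial_def re[OF gL(2)] p im[OF r] k_def) (simp add: slice_coords_upd)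
    have eq: "bracket (\<lambda>l. imag_unit (upd_var y g w $ l)) L (coord_monomial T C (?z w) *\<^sub>R u w) =
        (\<Sum>b\<in>Basis. (w \<bullet> b) *\<^sub>R bracket (J(g := (0, snd b))) L (k *\<^sub>R u w))" for w
      unfolding J_def bracket_update_expand[OF gL(1), symmetric] mon
      by (simp add: bracket_simps)
    show ?thesis
      unfolding eq by (intro biharmonic_on_sum biharmonic_on_inner_scaleR U h)
  qed
  then show ?thesis by (simp only: C_def)
qed

section \<open>Assembling the decomposition\<close>

lemma norm_point: "J l \<in> imag_sphere \<Longrightarrow> norm (point J z $ l) = norm (z $ l)"
  by (simp add: norm_prod_def cmod_def imag_sphere_iff)

lemma norm_slice_coords: "norm (x $ l) = norm (slice_coords x $ l)"
  by (simp add: slice_coords_def norm_prod_def cmod_def)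

lemma stem_comp_sum:
  assumes "\<And>S. g (point J (flip S z)) = (\<Sum>T\<in>M. c T *\<^sub>R e T (point J (flip S z)))"
  shows "stem_comp J L g z = (\<Sum>T\<in>M. c T *\<^sub>R stem_comp J L (e T) z)"
proof -
  have "(\<Sum>S\<in>UNIV. chr S L *\<^sub>R g (point J (flip S z))) =
      (\<Sum>S\<in>UNIV. \<Sum>T\<in>M. c T *\<^sub>R chr S L *\<^sub>R e T (point J (flip S z)))"
    by (simp add: assms scaleR_sum_right mult.commute)
  also have "\<dots> = (\<Sum>T\<in>M. c T *\<^sub>R (\<Sum>S\<in>UNIV. chr S L *\<^sub>R e T (point J (flip S z))))"
    by (subst sum.swap) (simp add: scaleR_sum_right)
  finally show ?thesis
    unfolding stem_comp_def
    by (simp only: scaleR_sum_right[of "1 / 2 ^ CARD('a)"] scaleR_left_commute[of "1 / 2 ^ CARD('a)"]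
        linear_sum[OF linear_inverse_bracket] linear_cmul[OF linear_inverse_bracket])
qed

lemma induced_sum:
  "induced (\<lambda>z. \<Sum>i\<in>I. c i *\<^sub>R F i z) x = (\<Sum>i\<in>I. c i *\<^sub>R induced (F i) x)"
proof -
  have "induced (\<lambda>z. \<Sum>i\<in>I. c i *\<^sub>R F i z) x =
      (\<Sum>K\<in>UNIV. \<Sum>i\<in>I. c i *\<^sub>R bracket (\<lambda>l. imag_unit (x $ l)) K (F i (slice_coords x) $ K))"
    by (simp add: induced_def bracket_simps)
  also have "\<dots> = (\<Sum>i\<in>I. c i *\<^sub>R induced (F i) x)"
    unfolding induced_def by (subst sum.swap) (simp add: scaleR_sum_right)
  finally show ?thesis .
qed

theorem corollary5p7:
  fixes D :: "(complex ^ 'n::{finite,linorder}) set"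
    and f :: "('m::{finite,linorder}, 'n) pv_fun"
    and G H :: "'n set"
    and E :: "'n set \<Rightarrow> ('n \<Rightarrow> nat) \<Rightarrow> ('m, 'n) pv_fun"
  assumes "odd CARD('m)"
    and "open D" and "symmetric_domain D"
    and "starlike_every_variable (circular D :: ('m, 'n) points set)"
    and "slice_regular D f"
    and "G \<subseteq> H"
    and "almansi_components D H G f E"
  shows "(\<forall>T\<in>multi_indices CARD('m) G. slice_function D (G_fun D H E T)) \<and>
         (\<forall>x\<in>circular D. f x =
            (\<Sum>T\<in>multi_indices CARD('m) G. norm_power G T x *\<^sub>R G_fun D H E T x)) \<and>
         (\<forall>T\<in>multi_indices CARD('m) G. \<forall>g\<in>G. polyharmonic_in 2 g (circular D) (G_fun D H E T))"
proof -
  let ?\<Omega> = "circular D :: ('m, 'n) points set"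
  let ?M = "multi_indices CARD('m) G"
  note D = assms(2,3)
  obtain F where F: "stem_of D f F" and CR: "stem_CR D F"
    using assms(5) by (auto simp: slice_regular_iff)
  have sF: "stem_function D F" using F by (simp add: stem_of_def)
  obtain J0 :: "'m paravector" where J0: "J0 \<in> imag_sphere" using imag_sphere_nonempty by blast
  obtain I where I: "finite I" "?M = G \<rightarrow>\<^sub>E I"
    by (rule multi_indices_PiE)
  let ?s = "S_stem D F H"
  have s: "stem_function D (?s K)" for K
    by (rule stem_function_S_stem[OF D sF CR])
  have dec: "induced (?s K) x = (\<Sum>T\<in>?M. norm_power G T x *\<^sub>R E K T x)" if "K \<subseteq> H" "x \<in> ?\<Omega>" for K x
    using assms(7) that S_fun_eq_induced[OF D F CR that] by (simp add: almansi_components_def)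
  have harm: "polyharmonic_in 1 g ?\<Omega> (E K T)" if "K \<subseteq> H" "T \<in> ?M" "g \<in> G" for K T g
    using assms(7) that by (simp add: almansi_components_def)
  define FE where "FE = (\<lambda>K T. axial_stem H (\<lambda>_. J0) (E K T))"
  have E_induced: "E K T x = induced (FE K T) x" if K: "K \<subseteq> H" and T: "T \<in> ?M" and x: "x \<in> ?\<Omega>" for K T x
    unfolding FE_def
  proof (rule almansi_components_slice[OF D assms(4,6) I(1) s _ _ _ _ J0 x])
    show "\<And>z B. z \<in> D \<Longrightarrow> B \<inter> H \<noteq> {} \<Longrightarrow> ?s K z $ B = 0" by (simp add: S_stem_def)
  qed (use dec[OF K] harm[OF K] T I(2) in auto)
  have E_stem: "stem_of D (E K T) (FE K T)" if "K \<subseteq> H" "T \<in> ?M" for K T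
    using E_induced[OF that] by (auto simp: stem_of_def FE_def stem_function_axial_stem)
  define GS where "GS = (\<lambda>T z. \<Sum>K\<in>Pow H. (-1) ^ card (H - K) *\<^sub>R stem_mult (conj_stem (H - K)) (FE K T) z)"
  have G_induced: "G_fun D H E T x = induced (GS T) x" if T: "T \<in> ?M" and x: "x \<in> ?\<Omega>" for T x
    unfolding G_fun_def GS_def induced_sum
    using slice_mult_eq[OF D(2) stem_of_conj_coord_prod E_stem[OF _ T] x] by (intro sum.cong) auto
  \<comment> \<open>Since \<open>FE K T\<close> has no component meeting \<open>H\<close>, the index
    of each component splits into \<open>L \<inter> H\<close>, coming from the conjugated variables,
    and \<open>L - H\<close>, coming from \<open>FE K T\<close>.\<close>
  have GS_nth: "GS T z $ L = (\<Sum>K\<in>Pow H. (-1) ^ card (H - K) *\<^sub>R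
      (if L \<inter> H \<subseteq> H - K then ((-1) ^ card (L \<inter> H) * coord_monomial (H - K) (L \<inter> H) z) *\<^sub>R (FE K T z $ (L - H)) else 0))" for T z L
    unfolding GS_def sum_component vector_scaleR_component
    by (intro sum.cong refl, subst stem_mult_conj_stem[where H = H]) (auto simp: FE_def axial_stem_def)
  have GS_stem: "stem_function D (GS T)" if "T \<in> ?M" for T
  proof (rule stem_functionI)
    fix z h L assume z: "z \<in> D"
    have "stem_mult (conj_stem (H - K)) (FE K T) (flip {h} z) $ L =
        chr {h} L *\<^sub>R (stem_mult (conj_stem (H - K)) (FE K T) z $ L)" if K: "K \<in> Pow H" for K
    proof (rule stem_flip[OF D(2) stem_function_mult[OF D(2)] z])
      show "stem_function D (conj_stem (H - K) :: ('m, 'n) stem_fun)"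
        using stem_of_conj_coord_prod by (auto simp: stem_of_def)
      show "stem_function D (FE K T)" by (simp add: FE_def stem_function_axial_stem)
    qed
    then show "GS T (flip {h} z) $ L = chr {h} L *\<^sub>R (GS T z $ L)"
      by (simp add: GS_def scaleR_sum_right mult.commute)
  qed
  have "slice_function D (G_fun D H E T)" if "T \<in> ?M" for T
    unfolding slice_function_def stem_of_def using GS_stem[OF that] G_induced[OF that] by blast
  moreover have "f x = (\<Sum>T\<in>?M. norm_power G T x *\<^sub>R G_fun D H E T x)" if x: "x \<in> ?\<Omega>" for x
  proof -
    define z where "z = slice_coords x"
    have z: "z \<in> D" using x circular_iff[OF D(2)] unfolding z_def by blast
    \<comment> \<open>The points at which \<open>stem_comp\<close> evaluates have the same norms in
      each variable as \<open>x\<close>, so the factors \<open>norm_power G T x\<close> are common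
      to all of them and the expansion passes to components.\<close>
    have FE_sum: "(\<Sum>T\<in>?M. norm_power G T x *\<^sub>R (FE K T z $ B)) = ?s K z $ B"
      if K: "K \<subseteq> H" and B: "B \<inter> H = {}" for K B
    proof -
      have "?s K z $ B = stem_comp (\<lambda>_. J0) B (induced (?s K)) z"
        by (rule stem_comp_induced[symmetric, OF D(2) _ z J0]) (simp add: stem_of_def s)
      also have "\<dots> = (\<Sum>T\<in>?M. norm_power G T x *\<^sub>R stem_comp (\<lambda>_. J0) B (E K T) z)"
      proof (rule stem_comp_sum)
        fix S
        have p: "point (\<lambda>_. J0) (flip S z) \<in> ?\<Omega>"
          using flip_in_domain[OF D(2) z] J0 by (intro point_in_circular) auto
        have "norm (point (\<lambda>_. J0) (flip S z) $ l) = norm (x $ l)" for l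
          by (simp add: norm_point[OF J0] norm_slice_coords[of x] z_def del: point_nth)
        then have "norm_power G T (point (\<lambda>_. J0) (flip S z)) = norm_power G T x" for T
          unfolding norm_power_def by (simp only:)
        then show "induced (?s K) (point (\<lambda>_. J0) (flip S z)) =
            (\<Sum>T\<in>?M. norm_power G T x *\<^sub>R E K T (point (\<lambda>_. J0) (flip S z)))"
          by (simp add: dec[OF K p])
      qed
      finally show ?thesis using B by (simp add: FE_def axial_stem_def)
    qed
    \<comment> \<open>Summing over \<open>T\<close> first restores the stem functions of the
      \<open>S_fun D H K f\<close>. The Almansi-type identity then applies with
      \<open>L \<inter> H\<close> for \<open>C\<close> and the quotients of \<open>F\<close> with
      \<open>B = L - H\<close>.\<close>
    have GS_sum: "(\<Sum>T\<in>?M. norm_power G T x *\<^sub>R (GS T z $ L)) = F z $ L" for L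
    proof -
      let ?c = "\<lambda>K v. (-1) ^ card (H - K) *\<^sub>R
        (if L \<inter> H \<subseteq> H - K then ((-1) ^ card (L \<inter> H) * coord_monomial (H - K) (L \<inter> H) z) *\<^sub>R v else 0)"
      have lin: "linear (?c K)" for K
        by (intro linearI) (simp_all add: algebra_simps)
      have "(\<Sum>T\<in>?M. norm_power G T x *\<^sub>R (GS T z $ L)) =
          (\<Sum>T\<in>?M. \<Sum>K\<in>Pow H. norm_power G T x *\<^sub>R ?c K (FE K T z $ (L - H)))"
        by (simp only: GS_nth scaleR_sum_right)
      also have "\<dots> = (\<Sum>K\<in>Pow H. \<Sum>T\<in>?M. norm_power G T x *\<^sub>R ?c K (FE K T z $ (L - H)))"
        by (rule sum.swap)
      also have "\<dots> = (\<Sum>K\<in>Pow H. ?c K (?s K z $ (L - H)))"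
      proof (rule sum.cong[OF refl])
        fix K assume "K \<in> Pow H"
        then have "(\<Sum>T\<in>?M. norm_power G T x *\<^sub>R (FE K T z $ (L - H))) = ?s K z $ (L - H)"
          by (intro FE_sum) auto
        then show "(\<Sum>T\<in>?M. norm_power G T x *\<^sub>R ?c K (FE K T z $ (L - H))) = ?c K (?s K z $ (L - H))"
          by (simp only: linear_cmul[OF lin, symmetric] linear_sum[OF lin, symmetric])
      qed
      also have "\<dots> = (\<Sum>K\<in>Pow H. ?c K (\<Sum>A\<in>Pow K. (\<Prod>l\<in>K - A. Re (z $ l)) *\<^sub>R stem_quotient_ext D F (L - H) (H - A) z))"
        by (intro sum.cong refl arg_cong[of _ _ "?c _"]) (auto simp: S_stem_def)
      also have "\<dots> = (\<Prod>l\<in>L \<inter> H. Im (z $ l)) *\<^sub>R stem_quotient_ext D F (L - H) (L \<inter> H) z"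
        by (rule almansi_type_identity) simp
      also have "\<dots> = F z $ ((L - H) \<union> (L \<inter> H))"
        by (rule stem_factor[symmetric, OF D sF CR z])
      also have "(L - H) \<union> (L \<inter> H) = L" by auto
      finally show ?thesis .
    qed
    \<comment> \<open>The powers are frozen at \<open>x\<close> and act as numbers; this is enough
      because \<open>induced\<close> evaluates its stem function only at
      \<open>slice_coords x\<close>.\<close>
    have "(\<Sum>T\<in>?M. norm_power G T x *\<^sub>R G_fun D H E T x) = induced (\<lambda>z. \<Sum>T\<in>?M. norm_power G T x *\<^sub>R GS T z) x"
      by (simp add: induced_sum G_induced[OF _ x])
    also have "\<dots> = induced F x"
      by (rule induced_cong) (simp add: vec_eq_iff GS_sum z_def[symmetric])
    also have "\<dots> = f x" using F x by (simp add: stem_of_def)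
    finally show ?thesis by simp
  qed
  moreover have "polyharmonic_in 2 g ?\<Omega> (G_fun D H E T)" if T: "T \<in> ?M" and g: "g \<in> G" for T g
  proof (rule polyharmonic_2I)
    fix y assume y: "y \<in> ?\<Omega>"
    let ?U = "var_section ?\<Omega> g y"
    have oU: "open ?U" by (intro open_var_section open_circular D)
    have gH: "g \<in> H" using g assms(6) by blast
    let ?z = "\<lambda>w. slice_coords (upd_var y g w)"
    let ?t = "\<lambda>w L K. bracket (\<lambda>l. imag_unit (upd_var y g w $ l)) L ((-1) ^ card (H - K) *\<^sub>R (if L \<inter> H \<subseteq> H - K then
        ((-1) ^ card (L \<inter> H) * coord_monomial (H - K) (L \<inter> H) (?z w)) *\<^sub>R (FE K T (?z w) $ (L - H)) else 0))"
    \<comment> \<open>Each summand separates one harmonic component of \<open>FE K T\<close> from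
      one monomial and one bracket, and the monomial and bracket together involve at most one factor
      from the variable \<open>g\<close>.\<close>
    have summand: "biharmonic_on (\<lambda>w. ?t w L K) ?U" if K: "K \<in> Pow H" for K L
    proof (cases "L \<inter> H \<subseteq> H - K")
      case True
      let ?c = "(-1) ^ card (H - K) * (-1) ^ card (L \<inter> H) :: real"
      have "harmonic_on (\<lambda>w. FE K T (?z w) $ (L - H)) ?U"
        unfolding FE_def
        by (rule axial_stem_harmonic[OF D J0 gH _ harm y]) (use K T g E_induced FE_def in auto)
      then have "harmonic_on (\<lambda>w. ?c *\<^sub>R (FE K T (?z w) $ (L - H))) ?U"
        by (rule harmonic_on_compose_linear[OF oU bounded_linear_scaleR_right])
      from biharmonic_conj_coord_term[OF oU this gH True]
      show ?thesis using True by (simp add: mult_ac)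
    qed (simp add: bracket_simps biharmonic_on_def C_k_on_const)
    have "biharmonic_on (\<lambda>w. \<Sum>L\<in>UNIV. \<Sum>K\<in>Pow H. ?t w L K) ?U"
      by (intro biharmonic_on_sum oU summand)
    then show "biharmonic_on (\<lambda>w. G_fun D H E T (upd_var y g w)) ?U"
    proof (rule biharmonic_on_cong[OF oU, rotated])
      fix w assume "w \<in> ?U"
      then have "upd_var y g w \<in> ?\<Omega>" by (simp add: var_section_def)
      from G_induced[OF T this] show "(\<Sum>L\<in>UNIV. \<Sum>K\<in>Pow H. ?t w L K) = G_fun D H E T (upd_var y g w)"
        by (simp only: induced_def GS_nth linear_sum[OF linear_bracket])
    qed
  qed
  ultimately show ?thesis by blast
qed

end
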